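(* Let $\Omega,\Omega_S,\Omega_F$, the spaces $\bar{\mathbf X},\mathbf E,\mathbf W$, the projections $\mathcal P_{\mathbf W},\mathcal P_{\mathbf E}$ and the semigroup $(\bar{\mathcal S}(t))_{t>0}$ be as defined in the context, with $\Omega_S$ a bad domain. Then the projections $\mathcal P_{\mathbf W}$ and $\mathcal P_{\mathbf E}$ commute with the semigroup: for all $t>0$ and all $\mathbf x_0\in\bar{\mathbf X}$, $$\mathcal P_{\mathbf W}\bar{\mathcal S}(t)\mathbf x_0=\bar{\mathcal S}(t)\mathcal P_{\mathbf W}\mathbf x_0,\qquad \mathcal P_{\mathbf E}\bar{\mathcal S}(t)\mathbf x_0=\bar{\mathcal S}(t)\mathcal P_{\mathbf E}\mathbf x_0.$$ In particular, the spaces $\mathbf E$ and $\mathbf W$ are invariant under $(\bar{\mathcal S}(t))_{t>0}$.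
   Context: Geometry. $\Omega\subset\mathbb R^3$ is a bounded Lipschitz domain, $\Omega_S$ is a bounded Lipschitz domain with $\overline{\Omega_S}\subset\Omega$ (so $\overline{\Omega_S}\cap\partial\Omega=\emptyset$), and $\Omega_F:=\Omega\setminus\overline{\Omega_S}$ is a Lipschitz domain. All function spaces of displacements and velocities are $\mathbb R^3$-valued. $n$ denotes a unit normal field on the boundaries; in $K_\xi$ and in integrations by parts over $\Omega_S$ it is the one pointing out of $\Omega_S$. Stress tensors. $D(v)=\frac12(\nabla v+(\nabla v)^T)$; $S(u,p)=2\nu D(u)-p\,\mathrm{Id}$ with $\nu>0$; $L(\xi)=\lambda_0D(\xi)+\lambda_1(\operatorname{div}\xi)\mathrm{Id}$ with $\lambda_0,\lambda_1>0$. Energy space. $\mathbf X=H^1(\Omega_S)^3\times L^2(\Omega_S)^3\times L_S$, where $L_S=\{u\in L^2(\Omega_F)^3:\operatorname{div}u=0,\ u\cdot n|_{\partial\Omega}=0\}$. $H^1(\Omega_S)$ carries the inner product $(\xi,\tilde\xi)_{H^1(\Omega_S)}=\int_{\Omega_S}\xi\cdot\tilde\xi+\int_{\Omega_S}L(\xi):D(\tilde\xi)$, the other factors the $L^2$ inner products. Generator and semigroup. $(\xi,\zeta,u)\in D(\mathcal A)$ iff $\xi,\zeta\in H^1(\Omega_S)^3$, $u\in H^1(\Omega_F)^3\cap L_S$, $\operatorname{div}L(\xi)\in L^2(\Omega_S)$, $u=\zeta$ on $\partial\Omega_S$, $u=0$ on $\partial\Omega$, and there is a (then unique, harmonic) $p\in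 L^2(\Omega_F)$ with $\operatorname{div}S(u,p)\in L_S$ and $S(u,p)n=L(\xi)n$ in $H^{-1/2}(\partial\Omega_S)$. Then $\mathcal A(\xi,\zeta,u)=(\zeta,\ \operatorname{div}L(\xi)-\xi,\ \operatorname{div}S(u,p))$. It is known (Avalos–Triggiani) that $\mathcal A$ generates a strongly continuous semigroup of contractions $(\mathcal S(t))_{t>0}$ on $\mathbf X$ and that $\bar{\mathbf X}:=\{(\xi,\zeta,u)\in\mathbf X:K_\xi=0\}$, where $K_\xi:=\int_{\partial\Omega_S}\xi\cdot n=\int_{\Omega_S}\operatorname{div}\xi$, is a closed subspace invariant under it. $(\bar{\mathcal S}(t))_{t>0}$ is the restriction of $(\mathcal S(t))_{t>0}$ to $\bar{\mathbf X}$. Also $\bar H^1(\Omega_S):=\{\xi\in H^1(\Omega_S)^3:K_\xi=0\}$. Overdetermined eigenvalue problem. For $\mu>0$, $q\in\mathbb R$: (P$_\mu$) $-\operatorname{div}L(\psi)=\mu\psi$ in $\Omega_S$, $\psi=0$ on $\partial\Omega_S$, $L(\psi)n=qn$ on $\partial\Omega_S$; in weak form: $\psi\in H^1_0(\Omega_S)^3$ and $\int_{\Omega_S}L(\psi):\nabla v-\mu\int_{\Omega_S}\psi\cdot v=q\int_{\Omega_S}\operatorname{div}v$ for all $v\in H^1(\Omega_S)^3$. $\Omega_S$ is a bad domain if (P$_\mu$) has a solution $(\psi,q)\ne(0,0)$ for some $\mu>0$. Let $(\tilde\psi_n)_{n\in\mathbb N}$ be an $L^2(\Omega_S)$-orthonormal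 basis of eigenfunctions of the Dirichlet–Lamé operator $-\operatorname{div}L$ with eigenvalues $\mu_n>0$, chosen so that inside each eigenspace the subspace of solutions of (P$_\mu$) is spanned by basis elements, and set $\psi_n=\tilde\psi_n/\sqrt{1+\mu_n}$ (an orthonormal basis of $H^1_0(\Omega_S)$). Let $K\subseteq\mathbb N$ be the set of indices $k$ such that $\psi_k$ solves (P$_{\mu_k}$) for some $q_k\in\mathbb R$. Spaces and projections. $E=\{\xi\in\bar H^1(\Omega_S):(\xi,\psi_k)_{H^1(\Omega_S)}=0\ \forall k\in K\}$, $\tilde E=\{\zeta\in L^2(\Omega_S):(\zeta,\tilde\psi_k)_{L^2(\Omega_S)}=0\ \forall k\in K\}$, $W$ the $H^1$-closure of $\operatorname{span}\{\psi_k:k\in K\}$, $\tilde W$ the $L^2$-closure of $\operatorname{span}\{\tilde\psi_k:k\in K\}$; $\mathbf E=E\times\tilde E\times L_S$, $\mathbf W=W\times\tilde W\times\{0\}$, so that $\bar{\mathbf X}=\mathbf E\oplus\mathbf W$. $\mathcal P_W\xi=\sum_{k\in K}(\xi,\psi_k)_{H^1(\Omega_S)}\psi_k$ for $\xi\in\bar H^1(\Omega_S)$, $\mathcal P_{\tilde W}\zeta=\sum_{k\in K}(\zeta,\tilde\psi_k)_{L^2(\Omega_S)}\tilde\psi_k$ for $\zeta\in L^2(\Omega_S)$, $\mathcal P_{\mathbf W}(\xi,\zeta,u)=(\mathcal P_W\xi,\mathcal P_{\tilde W}\zeta,0)$ and $\mathcal P_{\mathbf E}=\mathrm{Id}-\mathcal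 P_{\mathbf W}$ on $\bar{\mathbf X}$. *)

theory Defs
  imports "HOL-Analysis.Analysis"
begin

(* Elements of the function spaces below are represented by functions on the whole space, of
   which only the values on the domain U at hand matter; integrals and null sets refer to
   "lebesgue_on U".  Spaces are predicates or sets closed under almost-everywhere equality, and
   equality of elements of a space is almost-everywhere equality (state_eq for triples). *)

type_synonym vfield = "real^3 \<Rightarrow> real^3"
type_synonym tfield = "real^3 \<Rightarrow> real^3^3"
type_synonym state = "vfield \<times> vfield \<times> vfield"

section \<open>Lipschitz domains\<close>

definition bounded_lipschitz_domain :: "(real^3) set \<Rightarrow> bool" where
  "bounded_lipschitz_domain U \<longleftrightarrow>
     open U \<and> connected U \<and> U \<noteq> {} \<and> bounded U \<and>
     (\<forall>x\<in>frontier U. \<exists>r>0. \<exists>T :: real^3 \<Rightarrow> real^3. \<exists>C. \<exists>g :: real^2 \<Rightarrow> real.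
        orthogonal_transformation T \<and> C-lipschitz_on UNIV g \<and>
        (\<forall>z\<in>ball x r. z \<in> U \<longleftrightarrow> g (vector [T (z - x) $ 1, T (z - x) $ 2]) < T (z - x) $ 3))"

definition fluid_domain :: "(real^3) set \<Rightarrow> (real^3) set \<Rightarrow> (real^3) set" where
  "fluid_domain \<Omega> \<Omega>S = \<Omega> - closure \<Omega>S"

definition fsi_geometry :: "(real^3) set \<Rightarrow> (real^3) set \<Rightarrow> bool" where
  "fsi_geometry \<Omega> \<Omega>S \<longleftrightarrow>
     bounded_lipschitz_domain \<Omega> \<and> bounded_lipschitz_domain \<Omega>S \<and> closure \<Omega>S \<subseteq> \<Omega> \<and>
     bounded_lipschitz_domain (fluid_domain \<Omega> \<Omega>S)"

section \<open>Test functions\<close>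

primrec k_times_cont_diff :: "nat \<Rightarrow> (real^3 \<Rightarrow> 'b::real_normed_vector) \<Rightarrow> bool" where
  "k_times_cont_diff 0 f \<longleftrightarrow> continuous_on UNIV f"
| "k_times_cont_diff (Suc k) f \<longleftrightarrow>
     (\<forall>x. f differentiable (at x)) \<and>
     (\<forall>j. k_times_cont_diff k (\<lambda>x. frechet_derivative f (at x) (axis j 1)))"

(* C_c^\infty(U) *)
definition test_fun :: "(real^3) set \<Rightarrow> (real^3 \<Rightarrow> 'b::real_normed_vector) \<Rightarrow> bool" where
  "test_fun U f \<longleftrightarrow>
     (\<forall>k. k_times_cont_diff k f) \<and> (\<exists>C. compact C \<and> C \<subseteq> U \<and> (\<forall>x. x \<notin> C \<longrightarrow> f x = 0))"

definition grad :: "(real^3 \<Rightarrow> real) \<Rightarrow> vfield" where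
  "grad f x = (\<chi> j. frechet_derivative f (at x) (axis j 1))"

(* (jac f x) $ i $ j is the j-th partial derivative of the i-th component *)
definition jac :: "vfield \<Rightarrow> tfield" where
  "jac f x = jacobian f (at x)"

section \<open>Square-integrable fields and Sobolev spaces\<close>

definition L2 :: "(real^3) set \<Rightarrow> (real^3 \<Rightarrow> 'b::euclidean_space) \<Rightarrow> bool" where
  "L2 U f \<longleftrightarrow> f \<in> borel_measurable (lebesgue_on U) \<and> integrable (lebesgue_on U) (\<lambda>x. (norm (f x))\<^sup>2)"

definition l2_inner ::
    "(real^3) set \<Rightarrow> (real^3 \<Rightarrow> 'b::euclidean_space) \<Rightarrow> (real^3 \<Rightarrow> 'b) \<Rightarrow> real" where
  "l2_inner U f g = (\<integral>x. f x \<bullet> g x \<partial>lebesgue_on U)"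

definition l2_norm :: "(real^3) set \<Rightarrow> (real^3 \<Rightarrow> 'b::euclidean_space) \<Rightarrow> real" where
  "l2_norm U f = sqrt (l2_inner U f f)"

definition has_weak_grad :: "(real^3) set \<Rightarrow> vfield \<Rightarrow> tfield \<Rightarrow> bool" where
  "has_weak_grad U f G \<longleftrightarrow> L2 U f \<and> L2 U G \<and>
     (\<forall>\<phi> :: real^3 \<Rightarrow> real. test_fun U \<phi> \<longrightarrow>
        (\<forall>i j. (\<integral>x. f x $ i * grad \<phi> x $ j \<partial>lebesgue_on U) = - (\<integral>x. G x $ i $ j * \<phi> x \<partial>lebesgue_on U)))"

definition H1 :: "(real^3) set \<Rightarrow> vfield \<Rightarrow> bool" where
  "H1 U f \<longleftrightarrow> (\<exists>G. has_weak_grad U f G)"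

(* unique up to a null set if f is in H1 *)
definition wgrad :: "(real^3) set \<Rightarrow> vfield \<Rightarrow> tfield" where
  "wgrad U f = (SOME G. has_weak_grad U f G)"

definition sgrad :: "(real^3) set \<Rightarrow> vfield \<Rightarrow> tfield" where
  "sgrad U f x = (1/2) *\<^sub>R (wgrad U f x + transpose (wgrad U f x))"

definition wdiv :: "(real^3) set \<Rightarrow> vfield \<Rightarrow> real^3 \<Rightarrow> real" where
  "wdiv U f x = trace (wgrad U f x)"

(* f is the row-wise divergence of the tensor field T in the sense of distributions; the inner
   product of real^3^3 is the Frobenius product A : B *)
definition has_weak_tensor_div :: "(real^3) set \<Rightarrow> tfield \<Rightarrow> vfield \<Rightarrow> bool" where
  "has_weak_tensor_div U T f \<longleftrightarrow>
     (\<forall>\<phi> :: vfield. test_fun U \<phi> \<longrightarrow> l2_inner U T (jac \<phi>) = - l2_inner U f \<phi>)"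

definition h1_converges :: "(real^3) set \<Rightarrow> (nat \<Rightarrow> vfield) \<Rightarrow> vfield \<Rightarrow> bool" where
  "h1_converges U \<phi> f \<longleftrightarrow>
     (\<lambda>n. l2_norm U (\<lambda>x. \<phi> n x - f x)) \<longlonglongrightarrow> 0 \<and>
     (\<lambda>n. l2_norm U (\<lambda>x. jac (\<phi> n) x - wgrad U f x)) \<longlonglongrightarrow> 0"

definition H10 :: "(real^3) set \<Rightarrow> vfield \<Rightarrow> bool" where
  "H10 U f \<longleftrightarrow> H1 U f \<and> (\<exists>\<phi>. (\<forall>n. test_fun U (\<phi> n)) \<and> h1_converges U \<phi> f)"

section \<open>Boundary traces\<close>

(* Two-dimensional Hausdorff measure, normalised so that it is surface area. *)
definition hausdorff2_size :: "real \<Rightarrow> (real^3) set \<Rightarrow> ennreal" where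
  "hausdorff2_size \<delta> A =
     Inf {(\<Sum>i. ennreal (pi / 4 * (diameter (C i))\<^sup>2)) | C :: nat \<Rightarrow> (real^3) set.
            A \<subseteq> (\<Union>i. C i) \<and> (\<forall>i. bounded (C i) \<and> diameter (C i) \<le> \<delta>)}"

definition hausdorff2 :: "(real^3) measure" where
  "hausdorff2 = measure_of UNIV (sets borel) (\<lambda>A. SUP \<delta>\<in>{0<..}. hausdorff2_size \<delta> A)"

(* g is the trace on the part \<Gamma> of the boundary of U of the H1 function f: the trace operator
   is the continuous extension, from the restrictions to U of smooth functions to H1, of the map
   that restricts a function to the boundary, with values in L2 of the surface measure. *)
definition has_trace :: "(real^3) set \<Rightarrow> (real^3) set \<Rightarrow> vfield \<Rightarrow> vfield \<Rightarrow> bool" where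
  "has_trace U \<Gamma> f g \<longleftrightarrow> H1 U f \<and> g \<in> borel_measurable borel \<and>
     (\<exists>\<phi>. (\<forall>n. test_fun UNIV (\<phi> n)) \<and> h1_converges U \<phi> f \<and>
          (\<lambda>n. \<integral>\<^sup>+x\<in>\<Gamma>. ennreal ((norm (\<phi> n x - g x))\<^sup>2) \<partial>hausdorff2) \<longlonglongrightarrow> 0)"

section \<open>Stress tensors and spaces\<close>

definition lame_stress :: "real \<Rightarrow> real \<Rightarrow> (real^3) set \<Rightarrow> vfield \<Rightarrow> tfield" where
  "lame_stress l0 l1 U \<xi> x = l0 *\<^sub>R sgrad U \<xi> x + (l1 * wdiv U \<xi> x) *\<^sub>R mat 1"

definition fluid_stress ::
    "real \<Rightarrow> (real^3) set \<Rightarrow> vfield \<Rightarrow> (real^3 \<Rightarrow> real) \<Rightarrow> tfield" where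
  "fluid_stress \<nu> U u p x = (2 * \<nu>) *\<^sub>R sgrad U u x - p x *\<^sub>R mat 1"

definition h1_inner :: "real \<Rightarrow> real \<Rightarrow> (real^3) set \<Rightarrow> vfield \<Rightarrow> vfield \<Rightarrow> real" where
  "h1_inner l0 l1 U \<xi> \<eta> = l2_inner U \<xi> \<eta> + l2_inner U (lame_stress l0 l1 U \<xi>) (sgrad U \<eta>)"

definition h1_norm :: "real \<Rightarrow> real \<Rightarrow> (real^3) set \<Rightarrow> vfield \<Rightarrow> real" where
  "h1_norm l0 l1 U \<xi> = sqrt (h1_inner l0 l1 U \<xi> \<xi>)"

(* The space L_S.  For div u = 0, Green's formula defines u . n in H^{-1/2} of the boundary of
   the fluid domain by < u . n, \<phi> > = \<integral> u . grad \<phi>; it vanishes on the outer boundary iff this is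
   zero for all \<phi> that vanish near the inner boundary. *)
definition L_S :: "(real^3) set \<Rightarrow> (real^3) set \<Rightarrow> vfield \<Rightarrow> bool" where
  "L_S \<Omega> \<Omega>S u \<longleftrightarrow> L2 (fluid_domain \<Omega> \<Omega>S) u \<and>
     (\<forall>\<phi>. test_fun (fluid_domain \<Omega> \<Omega>S) \<phi> \<longrightarrow> l2_inner (fluid_domain \<Omega> \<Omega>S) u (grad \<phi>) = 0) \<and>
     (\<forall>\<phi>. test_fun (- closure \<Omega>S) \<phi> \<longrightarrow> l2_inner (fluid_domain \<Omega> \<Omega>S) u (grad \<phi>) = 0)"

(* K_\<xi>, the outward flux of \<xi> through the boundary of U *)
definition flux :: "(real^3) set \<Rightarrow> vfield \<Rightarrow> real" where
  "flux U \<xi> = (\<integral>x. wdiv U \<xi> x \<partial>lebesgue_on U)"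

definition H1_bar :: "(real^3) set \<Rightarrow> vfield \<Rightarrow> bool" where
  "H1_bar U \<xi> \<longleftrightarrow> H1 U \<xi> \<and> flux U \<xi> = 0"

section \<open>States, generator and semigroup\<close>

definition X :: "(real^3) set \<Rightarrow> (real^3) set \<Rightarrow> state set" where
  "X \<Omega> \<Omega>S = {(\<xi>, \<zeta>, u). H1 \<Omega>S \<xi> \<and> L2 \<Omega>S \<zeta> \<and> L_S \<Omega> \<Omega>S u}"

definition X_bar :: "(real^3) set \<Rightarrow> (real^3) set \<Rightarrow> state set" where
  "X_bar \<Omega> \<Omega>S = {(\<xi>, \<zeta>, u) \<in> X \<Omega> \<Omega>S. flux \<Omega>S \<xi> = 0}"

fun state_eq :: "(real^3) set \<Rightarrow> (real^3) set \<Rightarrow> state \<Rightarrow> state \<Rightarrow> bool" where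
  "state_eq \<Omega> \<Omega>S (\<xi>, \<zeta>, u) (\<xi>', \<zeta>', u') \<longleftrightarrow>
     (AE x in lebesgue_on \<Omega>S. \<xi> x = \<xi>' x) \<and> (AE x in lebesgue_on \<Omega>S. \<zeta> x = \<zeta>' x) \<and>
     (AE x in lebesgue_on (fluid_domain \<Omega> \<Omega>S). u x = u' x)"

fun lincomb :: "real \<Rightarrow> state \<Rightarrow> real \<Rightarrow> state \<Rightarrow> state" where
  "lincomb a (\<xi>, \<zeta>, u) b (\<xi>', \<zeta>', u') =
     (\<lambda>x. a *\<^sub>R \<xi> x + b *\<^sub>R \<xi>' x, \<lambda>x. a *\<^sub>R \<zeta> x + b *\<^sub>R \<zeta>' x, \<lambda>x. a *\<^sub>R u x + b *\<^sub>R u' x)"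

abbreviation state_diff :: "state \<Rightarrow> state \<Rightarrow> state" where
  "state_diff x y \<equiv> lincomb 1 x (- 1) y"

fun state_norm :: "real \<Rightarrow> real \<Rightarrow> (real^3) set \<Rightarrow> (real^3) set \<Rightarrow> state \<Rightarrow> real" where
  "state_norm l0 l1 \<Omega> \<Omega>S (\<xi>, \<zeta>, u) =
     sqrt (h1_inner l0 l1 \<Omega>S \<xi> \<xi> + l2_inner \<Omega>S \<zeta> \<zeta> + l2_inner (fluid_domain \<Omega> \<Omega>S) u u)"

(* < T n, \<phi> > in the duality of H^{-1/2} and H^{1/2} on the boundary of U, n pointing out of U
   and f the divergence of T (Green's formula) *)
definition normal_pairing :: "(real^3) set \<Rightarrow> tfield \<Rightarrow> vfield \<Rightarrow> vfield \<Rightarrow> real" where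
  "normal_pairing U T f \<phi> = l2_inner U T (wgrad U \<phi>) + l2_inner U f \<phi>"

(* The graph of the generator: the first triple lies in D(A) and the second is its image.
   In the balance of normal stresses, the traces of the elements of H^1_0(\<Omega>) exhaust H^{1/2} of
   the boundary of \<Omega>S and vanish on the boundary of \<Omega>; the minus sign turns the normal that
   points out of the fluid domain into the one that points out of \<Omega>S. *)
fun fsi_generator ::
    "real \<Rightarrow> real \<Rightarrow> real \<Rightarrow> (real^3) set \<Rightarrow> (real^3) set \<Rightarrow> state \<Rightarrow> state \<Rightarrow> bool" where
  "fsi_generator \<nu> l0 l1 \<Omega> \<Omega>S (\<xi>, \<zeta>, u) y \<longleftrightarrow>
     H1 \<Omega>S \<xi> \<and> H1 \<Omega>S \<zeta> \<and> H1 (fluid_domain \<Omega> \<Omega>S) u \<and> L_S \<Omega> \<Omega>S u \<and>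
     (\<exists>g. has_trace (fluid_domain \<Omega> \<Omega>S) (frontier \<Omega>S) u g \<and> has_trace \<Omega>S (frontier \<Omega>S) \<zeta> g) \<and>
     has_trace (fluid_domain \<Omega> \<Omega>S) (frontier \<Omega>) u (\<lambda>x. 0) \<and>
     (\<exists>f h. \<exists>p :: real^3 \<Rightarrow> real.
        L2 \<Omega>S f \<and> has_weak_tensor_div \<Omega>S (lame_stress l0 l1 \<Omega>S \<xi>) f \<and>
        L2 (fluid_domain \<Omega> \<Omega>S) p \<and> L_S \<Omega> \<Omega>S h \<and>
        has_weak_tensor_div (fluid_domain \<Omega> \<Omega>S) (fluid_stress \<nu> (fluid_domain \<Omega> \<Omega>S) u p) h \<and>
        (\<forall>\<phi>. H10 \<Omega> \<phi> \<longrightarrow>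
           - normal_pairing (fluid_domain \<Omega> \<Omega>S) (fluid_stress \<nu> (fluid_domain \<Omega> \<Omega>S) u p) h \<phi> =
           normal_pairing \<Omega>S (lame_stress l0 l1 \<Omega>S \<xi>) f \<phi>) \<and>
        state_eq \<Omega> \<Omega>S y (\<zeta>, \<lambda>x. f x - \<xi> x, h))"

definition contraction_semigroup ::
    "real \<Rightarrow> real \<Rightarrow> (real^3) set \<Rightarrow> (real^3) set \<Rightarrow> (real \<Rightarrow> state \<Rightarrow> state) \<Rightarrow> bool" where
  "contraction_semigroup l0 l1 \<Omega> \<Omega>S S \<longleftrightarrow>
     (\<forall>t>0. \<forall>x\<in>X \<Omega> \<Omega>S. S t x \<in> X \<Omega> \<Omega>S) \<and>
     (\<forall>t>0. \<forall>x\<in>X \<Omega> \<Omega>S. \<forall>y\<in>X \<Omega> \<Omega>S. \<forall>a b.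
        state_eq \<Omega> \<Omega>S (S t (lincomb a x b y)) (lincomb a (S t x) b (S t y))) \<and>
     (\<forall>s>0. \<forall>t>0. \<forall>x\<in>X \<Omega> \<Omega>S. state_eq \<Omega> \<Omega>S (S (s + t) x) (S s (S t x))) \<and>
     (\<forall>t>0. \<forall>x\<in>X \<Omega> \<Omega>S. state_norm l0 l1 \<Omega> \<Omega>S (S t x) \<le> state_norm l0 l1 \<Omega> \<Omega>S x) \<and>
     (\<forall>x\<in>X \<Omega> \<Omega>S. ((\<lambda>t. state_norm l0 l1 \<Omega> \<Omega>S (state_diff (S t x) x)) \<longlongrightarrow> 0) (at_right 0))"

(* A is the infinitesimal generator of S *)
definition generates ::
    "real \<Rightarrow> real \<Rightarrow> (real^3) set \<Rightarrow> (real^3) set \<Rightarrow>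
     (state \<Rightarrow> state \<Rightarrow> bool) \<Rightarrow> (real \<Rightarrow> state \<Rightarrow> state) \<Rightarrow> bool" where
  "generates l0 l1 \<Omega> \<Omega>S A S \<longleftrightarrow>
     (\<forall>x\<in>X \<Omega> \<Omega>S. \<forall>y\<in>X \<Omega> \<Omega>S. A x y \<longleftrightarrow>
        ((\<lambda>t. state_norm l0 l1 \<Omega> \<Omega>S (state_diff (lincomb (1 / t) (S t x) (- 1 / t) x) y)) \<longlongrightarrow> 0)
          (at_right 0))"

section \<open>Overdetermined eigenvalue problem and eigenbasis\<close>

definition solves_P :: "real \<Rightarrow> real \<Rightarrow> (real^3) set \<Rightarrow> real \<Rightarrow> vfield \<Rightarrow> real \<Rightarrow> bool" where
  "solves_P l0 l1 U m \<psi> q \<longleftrightarrow> H10 U \<psi> \<and>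
     (\<forall>v. H1 U v \<longrightarrow>
        l2_inner U (lame_stress l0 l1 U \<psi>) (wgrad U v) - m * l2_inner U \<psi> v =
        q * (\<integral>x. wdiv U v x \<partial>lebesgue_on U))"

definition bad_domain :: "real \<Rightarrow> real \<Rightarrow> (real^3) set \<Rightarrow> bool" where
  "bad_domain l0 l1 U \<longleftrightarrow>
     (\<exists>m>0. \<exists>\<psi> q. solves_P l0 l1 U m \<psi> q \<and> (\<not> (AE x in lebesgue_on U. \<psi> x = 0) \<or> q \<noteq> 0))"

definition psi :: "(nat \<Rightarrow> vfield) \<Rightarrow> (nat \<Rightarrow> real) \<Rightarrow> nat \<Rightarrow> vfield" where
  "psi \<psi>t \<mu> n x = \<psi>t n x /\<^sub>R sqrt (1 + \<mu> n)"

definition K_set ::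
    "real \<Rightarrow> real \<Rightarrow> (real^3) set \<Rightarrow> (nat \<Rightarrow> vfield) \<Rightarrow> (nat \<Rightarrow> real) \<Rightarrow> nat set" where
  "K_set l0 l1 U \<psi>t \<mu> = {k. \<exists>q. solves_P l0 l1 U (\<mu> k) (psi \<psi>t \<mu> k) q}"

definition dirichlet_lame_eigenfunction ::
    "real \<Rightarrow> real \<Rightarrow> (real^3) set \<Rightarrow> real \<Rightarrow> vfield \<Rightarrow> bool" where
  "dirichlet_lame_eigenfunction l0 l1 U m \<psi> \<longleftrightarrow>
     H10 U \<psi> \<and> \<not> (AE x in lebesgue_on U. \<psi> x = 0) \<and>
     has_weak_tensor_div U (lame_stress l0 l1 U \<psi>) (\<lambda>x. - m *\<^sub>R \<psi> x)"

definition l2_orthonormal_basis :: "(real^3) set \<Rightarrow> (nat \<Rightarrow> vfield) \<Rightarrow> bool" where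
  "l2_orthonormal_basis U b \<longleftrightarrow>
     (\<forall>n. L2 U (b n)) \<and> (\<forall>m n. l2_inner U (b m) (b n) = (if m = n then 1 else 0)) \<and>
     (\<forall>f. L2 U f \<longrightarrow> (\<forall>\<epsilon>>0. \<exists>F c. finite F \<and> l2_norm U (\<lambda>x. f x - (\<Sum>k\<in>F. c k *\<^sub>R b k x)) < \<epsilon>))"

(* By linearity, combinations of the \<psi>t k with k in K_set and \<mu> k = m always solve the problem for
   m, so the inclusion in the last clause makes the solution space equal to their span. *)
definition adapted_eigenbasis ::
    "real \<Rightarrow> real \<Rightarrow> (real^3) set \<Rightarrow> (nat \<Rightarrow> vfield) \<Rightarrow> (nat \<Rightarrow> real) \<Rightarrow> bool" where
  "adapted_eigenbasis l0 l1 U \<psi>t \<mu> \<longleftrightarrow>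
     l2_orthonormal_basis U \<psi>t \<and>
     (\<forall>n. \<mu> n > 0 \<and> dirichlet_lame_eigenfunction l0 l1 U (\<mu> n) (\<psi>t n)) \<and>
     (\<forall>m>0. \<forall>\<psi> q. solves_P l0 l1 U m \<psi> q \<longrightarrow>
        (\<exists>F c. finite F \<and> F \<subseteq> {k \<in> K_set l0 l1 U \<psi>t \<mu>. \<mu> k = m} \<and>
               (AE x in lebesgue_on U. \<psi> x = (\<Sum>k\<in>F. c k *\<^sub>R \<psi>t k x))))"

section \<open>The spaces E and W and the projections\<close>

definition E_xi ::
    "real \<Rightarrow> real \<Rightarrow> (real^3) set \<Rightarrow> (nat \<Rightarrow> vfield) \<Rightarrow> (nat \<Rightarrow> real) \<Rightarrow> vfield set" where
  "E_xi l0 l1 U \<psi>t \<mu> =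
     {\<xi>. H1_bar U \<xi> \<and> (\<forall>k\<in>K_set l0 l1 U \<psi>t \<mu>. h1_inner l0 l1 U \<xi> (psi \<psi>t \<mu> k) = 0)}"

definition E_zeta ::
    "real \<Rightarrow> real \<Rightarrow> (real^3) set \<Rightarrow> (nat \<Rightarrow> vfield) \<Rightarrow> (nat \<Rightarrow> real) \<Rightarrow> vfield set" where
  "E_zeta l0 l1 U \<psi>t \<mu> =
     {\<zeta>. L2 U \<zeta> \<and> (\<forall>k\<in>K_set l0 l1 U \<psi>t \<mu>. l2_inner U \<zeta> (\<psi>t k) = 0)}"

definition W_xi ::
    "real \<Rightarrow> real \<Rightarrow> (real^3) set \<Rightarrow> (nat \<Rightarrow> vfield) \<Rightarrow> (nat \<Rightarrow> real) \<Rightarrow> vfield set" where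
  "W_xi l0 l1 U \<psi>t \<mu> =
     {\<xi>. H1 U \<xi> \<and> (\<forall>\<epsilon>>0. \<exists>F c. finite F \<and> F \<subseteq> K_set l0 l1 U \<psi>t \<mu> \<and>
            h1_norm l0 l1 U (\<lambda>x. \<xi> x - (\<Sum>k\<in>F. c k *\<^sub>R psi \<psi>t \<mu> k x)) < \<epsilon>)}"

definition W_zeta ::
    "real \<Rightarrow> real \<Rightarrow> (real^3) set \<Rightarrow> (nat \<Rightarrow> vfield) \<Rightarrow> (nat \<Rightarrow> real) \<Rightarrow> vfield set" where
  "W_zeta l0 l1 U \<psi>t \<mu> =
     {\<zeta>. L2 U \<zeta> \<and> (\<forall>\<epsilon>>0. \<exists>F c. finite F \<and> F \<subseteq> K_set l0 l1 U \<psi>t \<mu> \<and>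
            l2_norm U (\<lambda>x. \<zeta> x - (\<Sum>k\<in>F. c k *\<^sub>R \<psi>t k x)) < \<epsilon>)}"

definition E_space ::
    "real \<Rightarrow> real \<Rightarrow> (real^3) set \<Rightarrow> (real^3) set \<Rightarrow> (nat \<Rightarrow> vfield) \<Rightarrow> (nat \<Rightarrow> real) \<Rightarrow> state set" where
  "E_space l0 l1 \<Omega> \<Omega>S \<psi>t \<mu> =
     {(\<xi>, \<zeta>, u). \<xi> \<in> E_xi l0 l1 \<Omega>S \<psi>t \<mu> \<and> \<zeta> \<in> E_zeta l0 l1 \<Omega>S \<psi>t \<mu> \<and> L_S \<Omega> \<Omega>S u}"

definition W_space ::
    "real \<Rightarrow> real \<Rightarrow> (real^3) set \<Rightarrow> (real^3) set \<Rightarrow> (nat \<Rightarrow> vfield) \<Rightarrow> (nat \<Rightarrow> real) \<Rightarrow> state set" where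
  "W_space l0 l1 \<Omega> \<Omega>S \<psi>t \<mu> =
     {(\<xi>, \<zeta>, u). \<xi> \<in> W_xi l0 l1 \<Omega>S \<psi>t \<mu> \<and> \<zeta> \<in> W_zeta l0 l1 \<Omega>S \<psi>t \<mu> \<and>
                 (AE x in lebesgue_on (fluid_domain \<Omega> \<Omega>S). u x = 0)}"

(* The projections are the sums of the (possibly infinite) series over K, i.e. limits, unique up
   to null sets, of the finite partial sums in the norm of H1 and of L2, respectively. *)
definition proj_W_xi ::
    "real \<Rightarrow> real \<Rightarrow> (real^3) set \<Rightarrow> (nat \<Rightarrow> vfield) \<Rightarrow> (nat \<Rightarrow> real) \<Rightarrow> vfield \<Rightarrow> vfield" where
  "proj_W_xi l0 l1 U \<psi>t \<mu> \<xi> = (SOME \<eta>. H1 U \<eta> \<and>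
     ((\<lambda>F. h1_norm l0 l1 U
        (\<lambda>x. (\<Sum>k\<in>F. h1_inner l0 l1 U \<xi> (psi \<psi>t \<mu> k) *\<^sub>R psi \<psi>t \<mu> k x) - \<eta> x)) \<longlongrightarrow> 0)
       (finite_subsets_at_top (K_set l0 l1 U \<psi>t \<mu>)))"

definition proj_W_zeta ::
    "real \<Rightarrow> real \<Rightarrow> (real^3) set \<Rightarrow> (nat \<Rightarrow> vfield) \<Rightarrow> (nat \<Rightarrow> real) \<Rightarrow> vfield \<Rightarrow> vfield" where
  "proj_W_zeta l0 l1 U \<psi>t \<mu> \<zeta> = (SOME \<eta>. L2 U \<eta> \<and>
     ((\<lambda>F. l2_norm U (\<lambda>x. (\<Sum>k\<in>F. l2_inner U \<zeta> (\<psi>t k) *\<^sub>R \<psi>t k x) - \<eta> x)) \<longlongrightarrow> 0)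
       (finite_subsets_at_top (K_set l0 l1 U \<psi>t \<mu>)))"

fun proj_W ::
    "real \<Rightarrow> real \<Rightarrow> (real^3) set \<Rightarrow> (nat \<Rightarrow> vfield) \<Rightarrow> (nat \<Rightarrow> real) \<Rightarrow> state \<Rightarrow> state" where
  "proj_W l0 l1 \<Omega>S \<psi>t \<mu> (\<xi>, \<zeta>, u) =
     (proj_W_xi l0 l1 \<Omega>S \<psi>t \<mu> \<xi>, proj_W_zeta l0 l1 \<Omega>S \<psi>t \<mu> \<zeta>, \<lambda>x. 0)"

definition proj_E ::
    "real \<Rightarrow> real \<Rightarrow> (real^3) set \<Rightarrow> (nat \<Rightarrow> vfield) \<Rightarrow> (nat \<Rightarrow> real) \<Rightarrow> state \<Rightarrow> state" where
  "proj_E l0 l1 \<Omega>S \<psi>t \<mu> x = state_diff x (proj_W l0 l1 \<Omega>S \<psi>t \<mu> x)"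

end

theory Submission
  imports Defs "HOL-Library.Function_Algebras"
begin

text \<open>
  For \<open>k \<in> K\<close> the fluid can stay at rest under a constant pressure while the solid oscillates along
  the eigenfunction, so the plane spanned by \<open>(\<psi>\<^sub>k, 0, 0)\<close> and \<open>(0, \<psi>t\<^sub>k, 0)\<close> lies in the domain of
  the generator, which acts on it as an infinitesimal rotation; hence the semigroup rotates this
  plane.  A contraction that maps a vector \<open>v\<close> to a vector of the same norm preserves the inner
  products with \<open>v\<close>.  So the coefficients of a state along the plane are rotated by the same angle,
  which gives the commutation with each partial sum of \<open>\<P>\<^sub>W\<close>, without any reference to the adjoint
  semigroup.  The series for \<open>\<P>\<^sub>W\<close> converges in \<open>H\<^sup>1\<close> by Bessel's inequality and Korn's inequality
  on \<open>H\<^sup>1\<^sub>0\<close>.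
\<close>

text \<open>The spaces contain functions instead of classes modulo null sets, \<open>wgrad\<close>
  and the projections are choices, and the laws of the semigroup hold almost everywhere only. The
  Hilbert space arguments are therefore carried out for positive semidefinite forms, with
  \<open>nrm (x - y) = 0\<close> in place of equality; on the energy space this relation is exactly
  \<open>state_eq\<close>. Because \<open>wgrad\<close> is a choice, every identity for it rests on
  uniqueness of weak gradients, hence on the fundamental lemma of the calculus of variations. Korn's
  inequality comes from the identity of \<integral> \<nabla>\<phi> : \<nabla>\<phi>^T and
  \<integral> (div \<phi>)^2 for test fields. A constant pressure can balance the stress q n because
  the divergence of a field in H^1_0(\<Omega>) integrates to zero over \<Omega> and the interface is
  a null set, so its integrals over solid and fluid cancel. Convergence of the projection series
  must be proved before anything can be said about the projections, since a choice without a witness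
  has no known properties.\<close>

instantiation "fun" :: (type, real_vector) real_vector
begin

definition "r *\<^sub>R f = (\<lambda>x. r *\<^sub>R f x)"

instance
  by standard (simp_all add: scaleR_fun_def fun_eq_iff algebra_simps)

end

lemma scaleR_fun_apply [simp]: "(r *\<^sub>R f) x = r *\<^sub>R f x"
  by (simp add: scaleR_fun_def)

lemma sum_fun_apply [simp]: "(\<Sum>k\<in>F. f k) x = (\<Sum>k\<in>F. f k x)"
  by (induction F rule: infinite_finite_induct) simp_all

lemma lincomb_eq: "lincomb a x b y = a *\<^sub>R x + b *\<^sub>R y"
  by (cases x; cases y) (simp add: fun_eq_iff)

section \<open>Positive semidefinite forms and Fourier series\<close>

text \<open>A carrier \<open>V\<close> is needed because the integrals behind \<open>B\<close> are
  meaningful for suitable functions only. No definiteness is assumed: vectors with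
  \<open>nrm x = 0\<close> play the part of functions that vanish almost everywhere. The instances
  are L^2, H^1 of the solid, and the energy space.\<close>

locale semi_inner =
  fixes V :: "'v::real_vector set" and B :: "'v \<Rightarrow> 'v \<Rightarrow> real"
  assumes subspace_V: "subspace V"
    and sym: "x \<in> V \<Longrightarrow> y \<in> V \<Longrightarrow> B x y = B y x"
    and add_left: "x \<in> V \<Longrightarrow> y \<in> V \<Longrightarrow> z \<in> V \<Longrightarrow> B (x + y) z = B x z + B y z"
    and scale_left: "x \<in> V \<Longrightarrow> y \<in> V \<Longrightarrow> B (r *\<^sub>R x) y = r * B x y"
    and nonneg: "x \<in> V \<Longrightarrow> B x x \<ge> 0"
begin

definition nrm :: "'v \<Rightarrow> real" where
  "nrm x = sqrt (B x x)"

lemma V_0 [intro, simp]: "0 \<in> V"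
  and V_add [intro, simp]: "x \<in> V \<Longrightarrow> y \<in> V \<Longrightarrow> x + y \<in> V"
  and V_scale [intro, simp]: "x \<in> V \<Longrightarrow> r *\<^sub>R x \<in> V"
  and V_diff [intro, simp]: "x \<in> V \<Longrightarrow> y \<in> V \<Longrightarrow> x - y \<in> V"
  and V_minus [intro, simp]: "x \<in> V \<Longrightarrow> - x \<in> V"
  using subspace_V
  by (auto intro: subspace_0 subspace_add subspace_scale subspace_diff subspace_neg)

lemma V_sum [intro, simp]: "(\<And>k. k \<in> F \<Longrightarrow> f k \<in> V) \<Longrightarrow> (\<Sum>k\<in>F. f k) \<in> V"
  using subspace_V by (rule subspace_sum)

lemma add_right: "x \<in> V \<Longrightarrow> y \<in> V \<Longrightarrow> z \<in> V \<Longrightarrow> B z (x + y) = B z x + B z y"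
  using add_left[of x y z] sym by auto

lemma scale_right: "x \<in> V \<Longrightarrow> y \<in> V \<Longrightarrow> B y (r *\<^sub>R x) = r * B y x"
  using scale_left[of x y r] sym by auto

lemma minus_left: "x \<in> V \<Longrightarrow> y \<in> V \<Longrightarrow> B (- x) y = - B x y"
  using scale_left[of x y "- 1"] by simp

lemma minus_right: "x \<in> V \<Longrightarrow> y \<in> V \<Longrightarrow> B y (- x) = - B y x"
  using scale_right[of x y "- 1"] by simp

lemma diff_left: "x \<in> V \<Longrightarrow> y \<in> V \<Longrightarrow> z \<in> V \<Longrightarrow> B (x - y) z = B x z - B y z"
  using add_left[of x "- y" z] by (simp add: minus_left)

lemma diff_right: "x \<in> V \<Longrightarrow> y \<in> V \<Longrightarrow> z \<in> V \<Longrightarrow> B z (x - y) = B z x - B z y"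
  using add_right[of x "- y" z] by (simp add: minus_right)

lemma zero_left: "y \<in> V \<Longrightarrow> B 0 y = 0"
  using scale_left[of 0 y 0] by simp

lemma zero_right: "y \<in> V \<Longrightarrow> B y 0 = 0"
  using scale_right[of 0 y 0] by simp

lemma sum_left: "(\<And>k. k \<in> F \<Longrightarrow> f k \<in> V) \<Longrightarrow> y \<in> V \<Longrightarrow> B (\<Sum>k\<in>F. f k) y = (\<Sum>k\<in>F. B (f k) y)"
  by (induction F rule: infinite_finite_induct) (auto simp: add_left zero_left)

lemma sum_right: "(\<And>k. k \<in> F \<Longrightarrow> f k \<in> V) \<Longrightarrow> y \<in> V \<Longrightarrow> B y (\<Sum>k\<in>F. f k) = (\<Sum>k\<in>F. B y (f k))"
  by (induction F rule: infinite_finite_induct) (auto simp: add_right zero_right)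

lemmas bilin = add_left add_right scale_left scale_right diff_left diff_right
  minus_left minus_right zero_left zero_right

lemma nrm_nonneg [simp]: "x \<in> V \<Longrightarrow> nrm x \<ge> 0"
  by (simp add: nrm_def nonneg)

lemma nrm_sq: "x \<in> V \<Longrightarrow> (nrm x)\<^sup>2 = B x x"
  by (simp add: nrm_def nonneg)

lemma nrm_0 [simp]: "nrm 0 = 0"
  by (simp add: nrm_def zero_left)

lemma nrm_minus: "x \<in> V \<Longrightarrow> nrm (- x) = nrm x"
  by (simp add: nrm_def bilin)

lemma nrm_scale: "x \<in> V \<Longrightarrow> nrm (r *\<^sub>R x) = \<bar>r\<bar> * nrm x"
  by (simp add: nrm_def bilin real_sqrt_mult flip: mult.assoc)

lemma nrm_minus_commute: "x \<in> V \<Longrightarrow> y \<in> V \<Longrightarrow> nrm (x - y) = nrm (y - x)"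
  using nrm_minus[of "x - y"] by simp

lemma Cauchy_Schwarz: 
  assumes "x \<in> V" "y \<in> V"
  shows "\<bar>B x y\<bar> \<le> nrm x * nrm y"
proof -
  have expand: "0 \<le> B x x - 2 * s * B x y + s\<^sup>2 * B y y" for s
    using nonneg[of "x - s *\<^sub>R y"] assms sym[of x y]
    by (simp add: bilin power2_eq_square algebra_simps)
  have "(B x y)\<^sup>2 \<le> B x x * B y y"
  proof (cases "B y y = 0")
    case True
    show ?thesis
    proof (cases "B x y = 0")
      case False
      \<comment> \<open>Without definiteness this case does not give \<open>y = 0\<close>. The
        quadratic in \<open>s\<close> degenerates to a linear function, and this \<open>s\<close>
        gives it the value -1, contradicting positivity.\<close>
      with expand[of "(B x x + 1) / (2 * B x y)"] True show ?thesis by simp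
    qed (simp add: True)
  next
    case False
    with nonneg[OF assms(2)] have "B y y > 0" by simp
    \<comment> \<open>The chosen \<open>s\<close> is the minimiser of the quadratic.\<close>
    then show ?thesis
      using expand[of "B x y / B y y"] by (simp add: power2_eq_square field_simps)
  qed
  then have "sqrt ((B x y)\<^sup>2) \<le> sqrt (B x x * B y y)" by (rule real_sqrt_le_mono)
  then show ?thesis by (simp add: nrm_def real_sqrt_mult)
qed

lemma nrm_triangle:
  assumes "x \<in> V" "y \<in> V"
  shows "nrm (x + y) \<le> nrm x + nrm y"
proof (rule power2_le_imp_le)
  have "(nrm (x + y))\<^sup>2 = B x x + 2 * B x y + B y y"
    using assms sym[of x y] by (simp add: nrm_sq bilin)
  also have "\<dots> \<le> (nrm x + nrm y)\<^sup>2"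
    using Cauchy_Schwarz[OF assms] assms by (simp add: power2_sum nrm_sq abs_le_iff)
  finally show "(nrm (x + y))\<^sup>2 \<le> (nrm x + nrm y)\<^sup>2" .
qed (use assms in simp)

lemma nrm_triangle_diff:
  assumes "x \<in> V" "y \<in> V" "z \<in> V"
  shows "nrm (x - z) \<le> nrm (x - y) + nrm (y - z)"
  using nrm_triangle[of "x - y" "y - z"] assms by simp

lemma null_left: "x \<in> V \<Longrightarrow> y \<in> V \<Longrightarrow> nrm x = 0 \<Longrightarrow> B x y = 0"
  using Cauchy_Schwarz[of x y] by simp

text \<open>By Cauchy-Schwarz null vectors lie in the radical of the form, so inner products do not
  depend on the representative.\<close>

lemma null_cong: 
  assumes "x \<in> V" "y \<in> V" "z \<in> V" "nrm (x - y) = 0"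
  shows "B x z = B y z" "B z x = B z y"
  using null_left[of "x - y" z] assms sym[of z] by (simp_all add: bilin)

lemma nrm_cong:
  assumes "x \<in> V" "y \<in> V" "nrm (x - y) = 0"
  shows "nrm x = nrm y"
  using assms nrm_triangle_diff[of x y 0] nrm_triangle_diff[of y x 0] nrm_minus_commute[of x y] by simp

lemma nrm_orthonormal_sum:
  assumes e: "\<And>k. k \<in> F \<Longrightarrow> e k \<in> V" "finite F"
    and orth: "\<And>k l. k \<in> F \<Longrightarrow> l \<in> F \<Longrightarrow> B (e k) (e l) = (if k = l then 1 else 0)"
  shows "(nrm (\<Sum>k\<in>F. c k *\<^sub>R e k))\<^sup>2 = (\<Sum>k\<in>F. (c k)\<^sup>2)"
proof -
  have "(nrm (\<Sum>k\<in>F. c k *\<^sub>R e k))\<^sup>2 = (\<Sum>k\<in>F. c k * (\<Sum>l\<in>F. c l * B (e l) (e k)))"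
    using e(1) by (simp add: nrm_sq sum_left sum_right bilin)
  also have "\<dots> = (\<Sum>k\<in>F. c k * (\<Sum>l\<in>F. if l = k then c k else 0))"
    by (intro sum.cong arg_cong2[where f = "(*)"] refl) (simp add: orth)
  finally show ?thesis using e(2) by (simp add: power2_eq_square)
qed

text \<open>For the partial sum \<open>p\<close> both \<open>B p p\<close> and \<open>B x p\<close>
  equal the sum of squares, so positivity of \<open>B (x - p) (x - p)\<close> is the claim.\<close>

lemma Bessel:
  assumes e: "\<And>k. k \<in> F \<Longrightarrow> e k \<in> V" "finite F" "x \<in> V"
    and orth: "\<And>k l. k \<in> F \<Longrightarrow> l \<in> F \<Longrightarrow> B (e k) (e l) = (if k = l then 1 else 0)"
  shows "(\<Sum>k\<in>F. (B x (e k))\<^sup>2) \<le> B x x"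
proof -
  define p where "p = (\<Sum>k\<in>F. B x (e k) *\<^sub>R e k)"
  have p: "p \<in> V" unfolding p_def using e(1) by simp
  have "B p p = (\<Sum>k\<in>F. (B x (e k))\<^sup>2)"
    using nrm_orthonormal_sum[of F e "\<lambda>k. B x (e k)"] e orth p nrm_sq[OF p] by (simp add: p_def)
  moreover have "B x p = (\<Sum>k\<in>F. (B x (e k))\<^sup>2)"
    unfolding p_def using e by (simp add: sum_right bilin power2_eq_square)
  moreover have "0 \<le> B (x - p) (x - p)" using e p by (intro nonneg) simp
  ultimately show ?thesis using e(3) p sym[of x p] by (simp add: bilin)
qed

text \<open>The nets of partial sums of a Fourier series and the sequence of its initial sums converge
  together: their distance is controlled by a tail of the Bessel series.\<close>
lemma Fourier_net_limit:
  fixes e :: "nat \<Rightarrow> 'v" and c :: "nat \<Rightarrow> real"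
  assumes e: "\<And>k. k \<in> K \<Longrightarrow> e k \<in> V"
    and orth: "\<And>k l. k \<in> K \<Longrightarrow> l \<in> K \<Longrightarrow> B (e k) (e l) = (if k = l then 1 else 0)"
    and bound: "\<And>F. finite F \<Longrightarrow> F \<subseteq> K \<Longrightarrow> (\<Sum>k\<in>F. (c k)\<^sup>2) \<le> M"
    and complete: "\<And>s. (\<And>n. s n = (\<Sum>k\<in>K \<inter> {..<n}. c k *\<^sub>R e k)) \<Longrightarrow>
       (\<And>\<epsilon>. \<epsilon> > 0 \<Longrightarrow> \<exists>N. \<forall>m\<ge>N. \<forall>n\<ge>N. nrm (s m - s n) < \<epsilon>) \<Longrightarrow>
       \<exists>\<eta>\<in>V. (\<lambda>n. nrm (s n - \<eta>)) \<longlonglongrightarrow> 0"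
  obtains \<eta> where "\<eta> \<in> V"
    "((\<lambda>F. nrm ((\<Sum>k\<in>F. c k *\<^sub>R e k) - \<eta>)) \<longlongrightarrow> 0) (finite_subsets_at_top K)"
proof -
  define s where "s n = (\<Sum>k\<in>K \<inter> {..<n}. c k *\<^sub>R e k)" for n
  have sV: "s n \<in> V" for n unfolding s_def using e by (intro V_sum V_scale) auto
  define d where "d k = (if k \<in> K then (c k)\<^sup>2 else 0)" for k
  have "summable d"
  proof (rule summableI_nonneg_bounded)
    show "(\<Sum>i<n. d i) \<le> M" for n
    proof -
      have "(\<Sum>i<n. d i) = (\<Sum>k\<in>K \<inter> {..<n}. (c k)\<^sup>2)"
        unfolding d_def by (subst sum.inter_restrict[symmetric]) (simp_all add: Int_commute)
      then show ?thesis using bound[of "K \<inter> {..<n}"] by simp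
    qed
  qed (simp add: d_def)
  then have tail: "\<exists>N. \<forall>D. finite D \<longrightarrow> (\<forall>k\<in>D. k \<ge> N) \<longrightarrow> sum d D < \<epsilon>" if \<epsilon>: "\<epsilon> > 0" for \<epsilon>
  proof -
    obtain N where N: "\<And>m n. m \<ge> N \<Longrightarrow> norm (sum d {m..<n}) < \<epsilon>"
      using \<open>summable d\<close> \<epsilon> unfolding summable_Cauchy by meson
    have "sum d D < \<epsilon>" if "finite D" "\<forall>k\<in>D. k \<ge> N" for D
    proof -
      \<comment> \<open>Inserting 0 keeps \<open>Max\<close> defined when \<open>D\<close> is
        empty.\<close>
      have "sum d D \<le> sum d {N..<Suc (Max (insert 0 D))}"
        using that by (intro sum_mono2) (auto simp: d_def less_Suc_eq_le)
      also have "\<dots> < \<epsilon>" using N[of N "Suc (Max (insert 0 D))"] by (simp add: abs_less_iff)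
      finally show ?thesis .
    qed
    then show ?thesis by blast
  qed
  have close: "\<exists>N. \<forall>F n. finite F \<longrightarrow> F \<subseteq> K \<longrightarrow> K \<inter> {..<N} \<subseteq> F \<longrightarrow> n \<ge> N \<longrightarrow>
                 nrm ((\<Sum>k\<in>F. c k *\<^sub>R e k) - s n) < \<epsilon>" if \<epsilon>: "\<epsilon> > 0" for \<epsilon>
  proof -
    obtain N where N: "\<And>D. finite D \<Longrightarrow> (\<And>k. k\<in>D \<Longrightarrow> k \<ge> N) \<Longrightarrow> sum d D < \<epsilon>\<^sup>2"
      using tail[of "\<epsilon>\<^sup>2"] \<epsilon> by (meson zero_less_power)
    have "nrm ((\<Sum>k\<in>F. c k *\<^sub>R e k) - s n) < \<epsilon>"
      if F: "finite F" "F \<subseteq> K" "K \<inter> {..<N} \<subseteq> F" "n \<ge> N" for F n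
    proof -
      define A where "A = K \<inter> {..<n}"
      \<comment> \<open>The difference of two partial sums lives on the symmetric difference of
        their index sets. The sign change in \<open>c'\<close> leaves the squares unchanged, so its
        squared norm is a sum of \<open>d\<close> over \<open>D\<close>.\<close>
      define D where "D = (F - A) \<union> (A - F)"
      define c' where "c' k = (if k \<in> F then c k else - c k)" for k
      have A: "finite A" "A \<subseteq> K" unfolding A_def by auto
      have "(\<Sum>k\<in>F. c k *\<^sub>R e k) - s n = (\<Sum>k\<in>F - A. c k *\<^sub>R e k) - (\<Sum>k\<in>A - F. c k *\<^sub>R e k)"
        unfolding s_def A_def[symmetric]
        by (simp add: sum.Int_Diff[OF F(1), of _ A] sum.Int_Diff[OF A(1), of _ F] Int_commute)
      also have "\<dots> = (\<Sum>k\<in>F - A. c' k *\<^sub>R e k) + (\<Sum>k\<in>A - F. c' k *\<^sub>R e k)"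
        by (simp add: c'_def sum_negf)
      also have "\<dots> = (\<Sum>k\<in>D. c' k *\<^sub>R e k)"
        unfolding D_def using F A by (intro sum.union_disjoint[symmetric]) auto
      finally have eq: "(\<Sum>k\<in>F. c k *\<^sub>R e k) - s n = (\<Sum>k\<in>D. c' k *\<^sub>R e k)" .
      have DK: "D \<subseteq> K" "finite D" using F A D_def by auto
      have "(nrm (\<Sum>k\<in>D. c' k *\<^sub>R e k))\<^sup>2 = (\<Sum>k\<in>D. (c' k)\<^sup>2)"
        using DK e orth by (intro nrm_orthonormal_sum) (auto simp: subset_iff)
      also have "\<dots> = sum d D"
        using DK by (intro sum.cong) (auto simp: c'_def d_def)
      \<comment> \<open>Both \<open>F\<close> and \<open>A\<close> contain
        \<open>K \<inter> {..<N}\<close>, the latter because \<open>n \<ge> N\<close>; so every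
        index in \<open>D\<close> is at least \<open>N\<close>.\<close>
      also have "\<dots> < \<epsilon>\<^sup>2"
        using DK F by (intro N) (auto simp: D_def A_def not_less)
      finally show ?thesis unfolding eq using \<open>\<epsilon> > 0\<close> by (intro power2_less_imp_less[of _ \<epsilon>]) auto
    qed
    then show ?thesis by blast
  qed
  obtain \<eta> where \<eta>: "\<eta> \<in> V" "(\<lambda>n. nrm (s n - \<eta>)) \<longlonglongrightarrow> 0"
  proof -
    have "\<exists>\<eta>\<in>V. (\<lambda>n. nrm (s n - \<eta>)) \<longlonglongrightarrow> 0"
    proof (rule complete)
      show "s n = (\<Sum>k\<in>K \<inter> {..<n}. c k *\<^sub>R e k)" for n by (simp add: s_def)
      fix \<epsilon> :: real assume "\<epsilon> > 0"
      then obtain N where N: "\<And>F n. finite F \<Longrightarrow> F \<subseteq> K \<Longrightarrow> K \<inter> {..<N} \<subseteq> F \<Longrightarrow> n \<ge> N \<Longrightarrow>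
                 nrm ((\<Sum>k\<in>F. c k *\<^sub>R e k) - s n) < \<epsilon>" using close by meson
      \<comment> \<open>The initial sum \<open>s m\<close> is itself the partial sum over an
        admissible finite set, so closeness of net and sequence contains the Cauchy
        property.\<close>
      have "nrm (s m - s n) < \<epsilon>" if "m \<ge> N" "n \<ge> N" for m n
        unfolding s_def[of m] using that by (intro N) auto
      then show "\<exists>N. \<forall>m\<ge>N. \<forall>n\<ge>N. nrm (s m - s n) < \<epsilon>" by blast
    qed
    then show ?thesis using that by blast
  qed
  have "((\<lambda>F. nrm ((\<Sum>k\<in>F. c k *\<^sub>R e k) - \<eta>)) \<longlongrightarrow> 0) (finite_subsets_at_top K)"
  proof (rule tendstoI)
    fix \<epsilon> :: real assume "\<epsilon> > 0"
    then obtain N where N: "\<And>F n. finite F \<Longrightarrow> F \<subseteq> K \<Longrightarrow> K \<inter> {..<N} \<subseteq> F \<Longrightarrow> n \<ge> N \<Longrightarrow>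
               nrm ((\<Sum>k\<in>F. c k *\<^sub>R e k) - s n) < \<epsilon> / 2" using close[of "\<epsilon> / 2"] by (meson half_gt_zero)
    have "\<forall>\<^sub>F n in sequentially. nrm (s n - \<eta>) < \<epsilon> / 2 \<and> n \<ge> N"
      using \<open>\<epsilon> > 0\<close> by (intro eventually_conj order_tendstoD(2)[OF \<eta>(2)] eventually_ge_at_top) auto
    from eventually_happens[OF this] obtain n where n: "nrm (s n - \<eta>) < \<epsilon> / 2" "n \<ge> N" by auto
    have "dist (nrm ((\<Sum>k\<in>F. c k *\<^sub>R e k) - \<eta>)) 0 < \<epsilon>"
      if "finite F" "F \<subseteq> K" "K \<inter> {..<N} \<subseteq> F" for F
    proof -
      have FV: "(\<Sum>k\<in>F. c k *\<^sub>R e k) \<in> V" using that e by (intro V_sum V_scale) auto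
      have "nrm ((\<Sum>k\<in>F. c k *\<^sub>R e k) - \<eta>) \<ge> 0" using FV \<eta>(1) by (intro nrm_nonneg V_diff)
      with N[OF that n(2)] n(1) nrm_triangle_diff[OF FV sV[of n] \<eta>(1)]
      show ?thesis unfolding dist_real_def by linarith
    qed
    then show "\<forall>\<^sub>F F in finite_subsets_at_top K. dist (nrm ((\<Sum>k\<in>F. c k *\<^sub>R e k) - \<eta>)) 0 < \<epsilon>"
      unfolding eventually_finite_subsets_at_top by (intro exI[of _ "K \<inter> {..<N}"]) auto
  qed
  with \<eta>(1) show ?thesis by (rule that)
qed

lemma nrm_sum_null:
  assumes "\<And>k. k \<in> F \<Longrightarrow> f k \<in> V" "\<And>k. k \<in> F \<Longrightarrow> nrm (f k) = 0"
  shows "nrm (\<Sum>k\<in>F. f k) = 0"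
  using assms
proof (induction F rule: infinite_finite_induct)
  case (insert k F)
  have V: "f k \<in> V" "sum f F \<in> V" using insert by auto
  have "nrm (f k + sum f F) \<le> nrm (f k) + nrm (sum f F)" using V by (rule nrm_triangle)
  then have "nrm (f k + sum f F) \<le> 0" using insert by simp
  then have "nrm (f k + sum f F) = 0" using V by (intro antisym nrm_nonneg V_add)
  then show ?case using insert by simp
qed simp_all

end

section \<open>Contraction semigroups up to null vectors\<close>

locale contraction_semi_inner = semi_inner +
  fixes T :: "real \<Rightarrow> 'a \<Rightarrow> 'a"
  assumes T_V: "t > 0 \<Longrightarrow> x \<in> V \<Longrightarrow> T t x \<in> V"
    and T_lin: "t > 0 \<Longrightarrow> x \<in> V \<Longrightarrow> y \<in> V \<Longrightarrow>
      nrm (T t (a *\<^sub>R x + b *\<^sub>R y) - (a *\<^sub>R T t x + b *\<^sub>R T t y)) = 0"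
    and T_sg: "s > 0 \<Longrightarrow> t > 0 \<Longrightarrow> x \<in> V \<Longrightarrow> nrm (T (s + t) x - T s (T t x)) = 0"
    and T_contr: "t > 0 \<Longrightarrow> x \<in> V \<Longrightarrow> nrm (T t x) \<le> nrm x"
begin

text \<open>\<open>T t x - T t y\<close> differs from \<open>T t (x - y)\<close> by a null vector.
  In particular \<open>T t\<close> respects equality up to null vectors.\<close>

lemma T_contr_diff:
  assumes "t > 0" "x \<in> V" "y \<in> V"
  shows "nrm (T t x - T t y) \<le> nrm (x - y)"
proof -
  have "nrm (T t (x - y) - (T t x - T t y)) = 0"
    using T_lin[of t x y 1 "- 1"] assms by simp
  then have "nrm (T t x - T t y) = nrm (T t (x - y))"
    using assms by (intro nrm_cong[symmetric]) (auto simp: T_V)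
  then show ?thesis using T_contr[of t "x - y"] assms by simp
qed

lemma T_sum:
  assumes "t > 0" "finite F" "\<And>k. k \<in> F \<Longrightarrow> f k \<in> V"
  shows "nrm (T t (\<Sum>k\<in>F. f k) - (\<Sum>k\<in>F. T t (f k))) = 0"
  using assms(2,3)
proof (induction F rule: finite_induct)
  case empty
  \<comment> \<open>\<open>T t 0\<close> need not be the zero function; contractivity makes it a
    null vector.\<close>
  show ?case using T_contr[of t 0] assms(1) nrm_nonneg[OF T_V[of t 0]] by simp
next
  case (insert k F)
  define y where "y = sum f F"
  have V: "f k \<in> V" "y \<in> V" "(\<Sum>k\<in>F. T t (f k)) \<in> V" unfolding y_def using insert assms(1) by (auto simp: T_V)
  have 1: "nrm (T t (f k + y) - (T t (f k) + T t y)) = 0"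
    using T_lin[of t "f k" y 1 1] assms(1) V by simp
  have 2: "nrm (T t y - (\<Sum>k\<in>F. T t (f k))) = 0" using insert by (simp add: y_def)
  have "nrm (T t (f k + y) - (T t (f k) + (\<Sum>k\<in>F. T t (f k)))) \<le>
        nrm (T t (f k + y) - (T t (f k) + T t y)) + nrm ((T t (f k) + T t y) - (T t (f k) + (\<Sum>k\<in>F. T t (f k))))"
    using V assms(1) by (intro nrm_triangle_diff) (auto simp: T_V)
  also have "\<dots> = 0" using 1 2 by simp
  finally have "nrm (T t (f k + y) - (T t (f k) + (\<Sum>k\<in>F. T t (f k)))) = 0"
    using V assms(1) by (intro antisym nrm_nonneg) (auto simp: T_V)
  then show ?case using insert by (simp add: y_def)
qed

text \<open>In the inequality of the squared norms of \<open>T t (x + s *\<^sub>R v)\<close> and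
  \<open>x + s *\<^sub>R v\<close> the terms quadratic in \<open>s\<close> cancel, since
  \<open>v\<close> keeps its norm. What remains bounds a linear function of \<open>s\<close> from
  above on the whole line, so its slope \<open>2 * d\<close> is zero.\<close>

lemma inner_preserved:
  assumes t: "t > 0" and V: "x \<in> V" "v \<in> V" and iso: "nrm (T t v) = nrm v"
  shows "B (T t x) (T t v) = B x v"
proof -
  define d where "d = B (T t x) (T t v) - B x v"
  have TV: "T t x \<in> V" "T t v \<in> V" using T_V t V by auto
  have Bv: "B (T t v) (T t v) = B v v" using iso nrm_sq V TV by metis
  have ineq: "2 * s * d \<le> B x x - B (T t x) (T t x)" for s
  proof -
    have *: "B (z + s *\<^sub>R w) (z + s *\<^sub>R w) = B z z + 2 * s * B z w + s\<^sup>2 * B w w"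
      if "z \<in> V" "w \<in> V" for z w
      using that sym[of w z] by (simp add: bilin algebra_simps power2_eq_square)
    have "nrm (T t (x + s *\<^sub>R v) - (T t x + s *\<^sub>R T t v)) = 0"
      using T_lin[of t x v 1 s] t V by simp
    then have "nrm (T t x + s *\<^sub>R T t v) = nrm (T t (x + s *\<^sub>R v))"
      using t V TV by (intro nrm_cong[symmetric]) (auto simp: T_V)
    also have "\<dots> \<le> nrm (x + s *\<^sub>R v)" using t V by (intro T_contr) auto
    finally have "B (T t x + s *\<^sub>R T t v) (T t x + s *\<^sub>R T t v) \<le> B (x + s *\<^sub>R v) (x + s *\<^sub>R v)"
      using V TV nrm_sq by (metis V_add V_scale power_mono nrm_nonneg)
    then show ?thesis using V TV Bv by (simp add: * d_def algebra_simps)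
  qed
  have "d = 0"
  proof (rule ccontr)
    assume "d \<noteq> 0"
    \<comment> \<open>For this \<open>s\<close> the left-hand side exceeds the bound by exactly
      1.\<close>
    then show False using ineq[of "(B x x - B (T t x) (T t x) + 1) / (2 * d)"] by simp
  qed
  then show ?thesis by (simp add: d_def)
qed

end

section \<open>The plane on which the semigroup rotates\<close>

text \<open>\<open>gen_v\<close> and \<open>gen_w\<close> say that the generator sends
  \<open>v\<close> to \<open>- \<omega>\<close> times \<open>w\<close> and \<open>w\<close> to
  \<open>\<omega>\<close> times \<open>v\<close>. The solution with these data that starts at
  \<open>v\<close> is \<open>orbit (\<omega> * t)\<close>, which makes the signs in
  \<open>orbit\<close> the right ones.\<close>

locale rotation_pair = contraction_semi_inner +
  fixes v w :: 'a and \<omega> :: real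
  assumes vw: "v \<in> V" "w \<in> V" and \<omega>: "\<omega> > 0"
    and vv: "B v v = 1" and ww: "B w w = 1" and vw0: "B v w = 0"
    and gen_v: "((\<lambda>t. nrm ((1/t) *\<^sub>R T t v - (1/t) *\<^sub>R v - (- \<omega>) *\<^sub>R w)) \<longlongrightarrow> 0) (at_right 0)"
    and gen_w: "((\<lambda>t. nrm ((1/t) *\<^sub>R T t w - (1/t) *\<^sub>R w - \<omega> *\<^sub>R v)) \<longlongrightarrow> 0) (at_right 0)"
begin

text \<open>Differentiability at 0 in the form of a first-order defect below
  \<open>\<epsilon> * h\<close>, the form in which errors of single time steps can be added.\<close>

lemma gen_defect:
  assumes z: "z \<in> V" "z' \<in> V" and "\<epsilon> > 0"
    and lim: "((\<lambda>t. nrm ((1/t) *\<^sub>R T t z - (1/t) *\<^sub>R z - z')) \<longlongrightarrow> 0) (at_right 0)"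
  shows "\<exists>\<delta>>0. \<forall>h. 0 < h \<and> h < \<delta> \<longrightarrow> nrm (T h z - (z + h *\<^sub>R z')) \<le> \<epsilon> * h"
proof -
  have "\<forall>\<^sub>F t in at_right 0. nrm ((1/t) *\<^sub>R T t z - (1/t) *\<^sub>R z - z') < \<epsilon>"
    using order_tendstoD(2)[OF lim \<open>\<epsilon> > 0\<close>] .
  then obtain \<delta> where \<delta>: "\<delta> > 0" 
    "\<And>h. 0 < h \<Longrightarrow> h < \<delta> \<Longrightarrow> nrm ((1/h) *\<^sub>R T h z - (1/h) *\<^sub>R z - z') < \<epsilon>"
    unfolding eventually_at_right_field by auto
  have "nrm (T h z - (z + h *\<^sub>R z')) \<le> \<epsilon> * h" if h: "0 < h" "h < \<delta>" for h
  proof -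
    have "T h z - (z + h *\<^sub>R z') = h *\<^sub>R ((1/h) *\<^sub>R T h z - (1/h) *\<^sub>R z - z')"
      using h by (simp add: algebra_simps)
    then have "nrm (T h z - (z + h *\<^sub>R z')) = h * nrm ((1/h) *\<^sub>R T h z - (1/h) *\<^sub>R z - z')"
      using h z by (simp add: nrm_scale T_V)
    with \<delta>(2)[OF h] h show ?thesis by (simp add: mult.commute)
  qed
  with \<delta>(1) show ?thesis by blast
qed

definition orbit :: "real \<Rightarrow> 'a" where
  "orbit s = cos s *\<^sub>R v - sin s *\<^sub>R w"

lemma orbit_V [simp]: "orbit s \<in> V"
  using vw by (simp add: orbit_def)

lemma nrm_orbit: "nrm (orbit s) = 1"
  using vw vv ww vw0 sym[of w v]
  by (simp add: nrm_def orbit_def bilin flip: power2_eq_square)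

lemma nrm_lin_le: "nrm (a *\<^sub>R v + b *\<^sub>R w) \<le> \<bar>a\<bar> + \<bar>b\<bar>"
  using nrm_triangle[of "a *\<^sub>R v" "b *\<^sub>R w"] vw vv ww by (simp add: nrm_scale nrm_def bilin real_sqrt_mult)

text \<open>The counterpart of \<open>gen_defect\<close> for the exact rotation: both motions are
  compared with the same linear step.\<close>

lemma cos_sin_defect:
  fixes \<epsilon> :: real
  assumes "\<epsilon> > 0"
  shows "\<exists>\<delta>>0. \<forall>h. 0 < h \<and> h < \<delta> \<longrightarrow> \<bar>cos (\<omega> * h) - 1\<bar> \<le> \<epsilon> * h \<and> \<bar>sin (\<omega> * h) - \<omega> * h\<bar> \<le> \<epsilon> * h"
proof -
  have "((\<lambda>h. cos (\<omega> * h)) has_real_derivative 0) (at 0)"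
    by (auto intro!: derivative_eq_intros)
  from DERIV_D[OF this] have c: "((\<lambda>h. (cos (\<omega> * h) - 1) / h) \<longlongrightarrow> 0) (at 0)" by simp
  have "((\<lambda>h. sin (\<omega> * h)) has_real_derivative \<omega>) (at 0)"
    by (auto intro!: derivative_eq_intros)
  from DERIV_D[OF this] have s: "((\<lambda>h. sin (\<omega> * h) / h) \<longlongrightarrow> \<omega>) (at 0)" by simp
  obtain d1 where d1: "d1 > 0" "\<And>h. h \<noteq> 0 \<Longrightarrow> \<bar>h\<bar> < d1 \<Longrightarrow> \<bar>(cos (\<omega> * h) - 1) / h\<bar> < \<epsilon>"
    using LIM_D[OF c assms] by auto
  obtain d2 where d2: "d2 > 0" "\<And>h. h \<noteq> 0 \<Longrightarrow> \<bar>h\<bar> < d2 \<Longrightarrow> \<bar>sin (\<omega> * h) / h - \<omega>\<bar> < \<epsilon>"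
    using LIM_D[OF s assms] by auto
  show ?thesis
  proof (intro exI[of _ "min d1 d2"] conjI allI impI)
    show "min d1 d2 > 0" using d1 d2 by simp
    fix h assume h: "0 < h \<and> h < min d1 d2"
    show "\<bar>cos (\<omega> * h) - 1\<bar> \<le> \<epsilon> * h"
      using d1(2)[of h] h by (simp add: abs_divide field_simps)
    have "sin (\<omega> * h) / h - \<omega> = (sin (\<omega> * h) - \<omega> * h) / h" using h by (simp add: field_simps)
    then show "\<bar>sin (\<omega> * h) - \<omega> * h\<bar> \<le> \<epsilon> * h"
      using d2(2)[of h] h by (simp add: abs_divide field_simps)
  qed
qed

text \<open>Stability and consistency give convergence, as for the explicit Euler scheme: the one-step
  defects along the rotation are o(h), and the contraction property merely adds them up.\<close>
lemma T_v:
  assumes t: "t > 0"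
  shows "nrm (T t v - orbit (\<omega> * t)) = 0"
proof -
  have "nrm (T t v - orbit (\<omega> * t)) \<le> 6 * \<epsilon> * t" if \<epsilon>: "\<epsilon> > 0" for \<epsilon>
  proof -
    obtain \<delta>1 where \<delta>1: "\<delta>1 > 0" "\<And>h. 0 < h \<Longrightarrow> h < \<delta>1 \<Longrightarrow> nrm (T h v - (v + h *\<^sub>R ((- \<omega>) *\<^sub>R w))) \<le> \<epsilon> * h"
      using gen_defect[OF _ _ \<epsilon> gen_v] vw by auto
    obtain \<delta>2 where \<delta>2: "\<delta>2 > 0" "\<And>h. 0 < h \<Longrightarrow> h < \<delta>2 \<Longrightarrow> nrm (T h w - (w + h *\<^sub>R (\<omega> *\<^sub>R v))) \<le> \<epsilon> * h"
      using gen_defect[OF _ _ \<epsilon> gen_w] vw by auto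
    obtain \<delta>3 where \<delta>3: "\<delta>3 > 0" "\<And>h. 0 < h \<Longrightarrow> h < \<delta>3 \<Longrightarrow> 
        \<bar>cos (\<omega> * h) - 1\<bar> \<le> \<epsilon> * h \<and> \<bar>sin (\<omega> * h) - \<omega> * h\<bar> \<le> \<epsilon> * h"
      using cos_sin_defect[OF \<epsilon>] by auto
    \<comment> \<open>The six units of \<open>\<epsilon> * h\<close> are one for each generator
      defect \<open>p\<close> and \<open>r\<close>, and two for each coordinate \<open>a\<close> and
      \<open>b\<close> of the trigonometric defect.\<close>
    have step: "nrm (T h (orbit s) - orbit (s + \<omega> * h)) \<le> 6 * \<epsilon> * h"
      if h: "0 < h" "h < \<delta>1" "h < \<delta>2" "h < \<delta>3" for h s
    proof -
      define p where "p = T h v - (v - (h * \<omega>) *\<^sub>R w)"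
      define r where "r = T h w - (w + (h * \<omega>) *\<^sub>R v)"
      define C where "C = cos (\<omega> * h)"
      define D where "D = sin (\<omega> * h)"
      \<comment> \<open>By the addition theorems, \<open>a\<close> and \<open>b\<close> are the
        coordinates in \<open>v\<close> and \<open>w\<close> of the linearised step applied to
        \<open>orbit s\<close>, minus the rotated vector
        \<open>orbit (s + \<omega> * h)\<close>.\<close>
      define a where "a = cos s * (1 - C) + sin s * (D - \<omega> * h)"
      define b where "b = cos s * (D - \<omega> * h) + sin s * (C - 1)"
      have pr: "p \<in> V" "r \<in> V" "T h v \<in> V" "T h w \<in> V" using h vw by (auto simp: p_def r_def T_V)
      have p: "nrm p \<le> \<epsilon> * h" and r: "nrm r \<le> \<epsilon> * h"
        using \<delta>1(2)[of h] \<delta>2(2)[of h] h by (simp_all add: p_def r_def)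
      have CD: "\<bar>C - 1\<bar> \<le> \<epsilon> * h" "\<bar>D - \<omega> * h\<bar> \<le> \<epsilon> * h" using \<delta>3(2)[of h] h by (simp_all add: C_def D_def)
      have cs: "\<bar>cos s * y\<bar> \<le> \<bar>y\<bar>" "\<bar>sin s * y\<bar> \<le> \<bar>y\<bar>" for y
        by (simp_all add: abs_mult mult_left_le_one_le)
      have a: "\<bar>a\<bar> \<le> 2 * (\<epsilon> * h)" and b: "\<bar>b\<bar> \<le> 2 * (\<epsilon> * h)"
        unfolding a_def b_def
        using cs(1)[of "1 - C"] cs(2)[of "D - \<omega> * h"] cs(1)[of "D - \<omega> * h"] cs(2)[of "C - 1"] CD
        by (simp_all add: abs_le_iff; linarith)+
      have lin: "nrm (T h (orbit s) - (cos s *\<^sub>R T h v - sin s *\<^sub>R T h w)) = 0"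
        using T_lin[of h v w "cos s" "- sin s"] h vw by (simp add: orbit_def)
      have "(cos s *\<^sub>R T h v - sin s *\<^sub>R T h w) - orbit (s + \<omega> * h) =
            (cos s *\<^sub>R p + (- sin s) *\<^sub>R r) + (a *\<^sub>R v + b *\<^sub>R w)"
        unfolding orbit_def cos_add sin_add p_def r_def a_def b_def C_def D_def
        by (simp add: algebra_simps)
      also have "nrm \<dots> \<le> (nrm (cos s *\<^sub>R p) + nrm ((- sin s) *\<^sub>R r)) + nrm (a *\<^sub>R v + b *\<^sub>R w)"
        using pr vw by (intro order_trans[OF nrm_triangle] add_right_mono nrm_triangle) auto
      also have "\<dots> \<le> (\<epsilon> * h + \<epsilon> * h) + (2 * (\<epsilon> * h) + 2 * (\<epsilon> * h))"
      proof (intro add_mono order_trans[OF nrm_lin_le] a b)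
        have "\<bar>cos s\<bar> * nrm p \<le> 1 * nrm p" "\<bar>- sin s\<bar> * nrm r \<le> 1 * nrm r"
          using pr by (intro mult_right_mono; simp)+
        then show "nrm (cos s *\<^sub>R p) \<le> \<epsilon> * h" "nrm ((- sin s) *\<^sub>R r) \<le> \<epsilon> * h"
          using p r pr by (simp_all only: nrm_scale mult_1; linarith)+
      qed
      finally have "nrm ((cos s *\<^sub>R T h v - sin s *\<^sub>R T h w) - orbit (s + \<omega> * h)) \<le> 6 * \<epsilon> * h" by simp
      with lin nrm_triangle_diff[of "T h (orbit s)" "cos s *\<^sub>R T h v - sin s *\<^sub>R T h w" "orbit (s + \<omega> * h)"]
      show ?thesis using pr h by (simp add: T_V)
    qed
    obtain n :: nat where n: "t / real (Suc n) < min \<delta>1 (min \<delta>2 \<delta>3)"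
    proof -
      define d where "d = min \<delta>1 (min \<delta>2 \<delta>3)"
      have d: "d > 0" using \<delta>1 \<delta>2 \<delta>3 by (simp add: d_def)
      obtain n where "t / d < real n" using reals_Archimedean2 by blast
      then have "t / d < real (Suc n)" by simp
      then have "t / real (Suc n) < d" using d by (simp add: divide_less_eq mult.commute del: of_nat_Suc)
      then show ?thesis using that d_def by blast
    qed
    define h where "h = t / real (Suc n)"
    have h: "0 < h" "h < \<delta>1" "h < \<delta>2" "h < \<delta>3" using n t by (simp_all add: h_def)
    \<comment> \<open>Steps are counted from one, because the laws of \<open>T\<close> are available
      for positive times only. Each further step adds \<open>6 * \<epsilon> * h\<close>, and at
      \<open>m = n\<close> the total is \<open>6 * \<epsilon> * t\<close> independently of the
      number of steps.\<close>
    have "nrm (T (real (Suc m) * h) v - orbit (\<omega> * (real (Suc m) * h))) \<le> real (Suc m) * (6 * \<epsilon> * h)" for m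
    proof (induction m)
      case 0
      show ?case using step[OF h, of 0] by (simp add: orbit_def)
    next
      case (Suc m)
      define s where "s = real (Suc m) * h"
      have s: "s > 0" using h by (simp add: s_def)
      have eq: "real (Suc (Suc m)) * h = h + s" by (simp add: s_def algebra_simps)
      have V: "T s v \<in> V" "T (h + s) v \<in> V" "T h (T s v) \<in> V" "T h (orbit (\<omega> * s)) \<in> V"
        using s h vw by (auto simp: T_V)
      have "nrm (T (h + s) v - orbit (\<omega> * (h + s))) \<le>
          nrm (T (h + s) v - T h (T s v)) + nrm (T h (T s v) - orbit (\<omega> * (h + s)))"
        using V by (intro nrm_triangle_diff) auto
      also have "nrm (T (h + s) v - T h (T s v)) = 0" using T_sg h s vw by simp
      also have "nrm (T h (T s v) - orbit (\<omega> * (h + s))) \<le>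
          nrm (T h (T s v) - T h (orbit (\<omega> * s))) + nrm (T h (orbit (\<omega> * s)) - orbit (\<omega> * (h + s)))"
        using V by (intro nrm_triangle_diff) auto
      also have "nrm (T h (T s v) - T h (orbit (\<omega> * s))) \<le> nrm (T s v - orbit (\<omega> * s))"
        using V h by (intro T_contr_diff) auto
      also have "\<dots> \<le> real (Suc m) * (6 * \<epsilon> * h)" using Suc unfolding s_def .
      also have "nrm (T h (orbit (\<omega> * s)) - orbit (\<omega> * (h + s))) \<le> 6 * \<epsilon> * h"
        using step[OF h, of "\<omega> * s"] by (simp add: algebra_simps)
      finally show ?case unfolding eq by (simp add: algebra_simps)
    qed
    from this[of n] show ?thesis by (simp add: h_def)
  qed
  note * = this
  have "nrm (T t v - orbit (\<omega> * t)) \<le> 0"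
  proof (rule field_le_epsilon)
    fix e :: real assume "e > 0"
    then show "nrm (T t v - orbit (\<omega> * t)) \<le> 0 + e"
      using *[of "e / (6 * t)"] t by simp
  qed
  then show ?thesis using t vw by (intro antisym nrm_nonneg) (auto simp: T_V)
qed

text \<open>The hypotheses are invariant under the quarter turn that takes the pair to
  \<open>w\<close> and \<open>- v\<close>. The formula for the orbit of \<open>w\<close> is then an
  instance of the one for \<open>v\<close>.\<close>

lemma turned: "rotation_pair V B T w (- v) \<omega>"
proof
  show "((\<lambda>t. nrm ((1/t) *\<^sub>R T t w - (1/t) *\<^sub>R w - (- \<omega>) *\<^sub>R (- v))) \<longlongrightarrow> 0) (at_right 0)"
    using gen_w by simp
  have ev: "\<forall>\<^sub>F t in at_right 0. nrm ((1/t) *\<^sub>R T t v - (1/t) *\<^sub>R v - (- \<omega>) *\<^sub>R w) =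
      nrm ((1/t) *\<^sub>R T t (- v) - (1/t) *\<^sub>R (- v) - \<omega> *\<^sub>R w)"
    unfolding eventually_at_right_field
  proof (intro exI[of _ 1] conjI allI impI)
    fix t :: real assume t: "0 < t" 
    have V: "T t v \<in> V" "T t (- v) \<in> V" using t vw by (auto simp: T_V)
    \<comment> \<open>Negation is the two-term combination with weights -1 and 0. It commutes with
      \<open>T t\<close> up to a null vector only, hence the detour through
      \<open>nrm_cong\<close>.\<close>
    have "nrm (T t (- v) - (- T t v)) = 0" using T_lin[of t v v "- 1" 0] t vw by simp
    then have "nrm (((1/t) *\<^sub>R T t (- v) - (1/t) *\<^sub>R (- v) - \<omega> *\<^sub>R w) -
        (- ((1/t) *\<^sub>R T t v - (1/t) *\<^sub>R v - (- \<omega>) *\<^sub>R w))) = 0"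
      using nrm_scale[of "T t (- v) + T t v" "1/t"] V by (simp add: algebra_simps)
    then show "nrm ((1/t) *\<^sub>R T t v - (1/t) *\<^sub>R v - (- \<omega>) *\<^sub>R w) =
      nrm ((1/t) *\<^sub>R T t (- v) - (1/t) *\<^sub>R (- v) - \<omega> *\<^sub>R w)"
      using nrm_cong[of "(1/t) *\<^sub>R T t (- v) - (1/t) *\<^sub>R (- v) - \<omega> *\<^sub>R w"
          "- ((1/t) *\<^sub>R T t v - (1/t) *\<^sub>R v - (- \<omega>) *\<^sub>R w)"] V vw
        nrm_minus[of "(1/t) *\<^sub>R T t v - (1/t) *\<^sub>R v - (- \<omega>) *\<^sub>R w"]
      by simp
  qed simp
  then show "((\<lambda>t. nrm ((1/t) *\<^sub>R T t (- v) - (1/t) *\<^sub>R (- v) - \<omega> *\<^sub>R w)) \<longlongrightarrow> 0) (at_right 0)"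
    by (rule Lim_transform_eventually[OF gen_v])
qed (use vw vv ww vw0 \<omega> sym[of w v] in \<open>auto simp: bilin\<close>)

lemma T_w:
  assumes "t > 0"
  shows "nrm (T t w - (sin (\<omega> * t) *\<^sub>R v + cos (\<omega> * t) *\<^sub>R w)) = 0"
proof -
  interpret turned: rotation_pair V B T w "- v" \<omega> by (rule turned)
  show ?thesis using turned.T_v[OF assms] by (simp add: turned.orbit_def add.commute)
qed

lemma T_pair:
  assumes t: "t > 0"
  shows "nrm (T t (a *\<^sub>R v + b *\<^sub>R w) - ((cos (\<omega> * t) * a + sin (\<omega> * t) * b) *\<^sub>R v +
    (cos (\<omega> * t) * b - sin (\<omega> * t) * a) *\<^sub>R w)) = 0"
proof -
  let ?v = "cos (\<omega> * t) *\<^sub>R v - sin (\<omega> * t) *\<^sub>R w" and ?w = "sin (\<omega> * t) *\<^sub>R v + cos (\<omega> * t) *\<^sub>R w"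
  let ?m = "(cos (\<omega> * t) * a + sin (\<omega> * t) * b) *\<^sub>R v + (cos (\<omega> * t) * b - sin (\<omega> * t) * a) *\<^sub>R w"
  let ?z = "a *\<^sub>R T t v + b *\<^sub>R T t w"
  have V: "T t v \<in> V" "T t w \<in> V" "T t (a *\<^sub>R v + b *\<^sub>R w) \<in> V" "?v \<in> V" "?w \<in> V" "?m \<in> V" "?z \<in> V"
    using t vw by (auto simp: T_V)
  have 1: "nrm (T t v - ?v) = 0" using T_v[OF t] by (simp add: orbit_def)
  have 2: "nrm (T t w - ?w) = 0" using T_w[OF t] by simp
  have "?z - ?m = a *\<^sub>R (T t v - ?v) + b *\<^sub>R (T t w - ?w)" by (simp add: algebra_simps)
  then have "nrm (?z - ?m) \<le> nrm (a *\<^sub>R (T t v - ?v)) + nrm (b *\<^sub>R (T t w - ?w))"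
    using V nrm_triangle[of "a *\<^sub>R (T t v - ?v)" "b *\<^sub>R (T t w - ?w)"] by simp
  also have "\<dots> = 0" using V 1 2 by (simp only: nrm_scale V_diff)
  finally have 3: "nrm (?z - ?m) \<le> 0" .
  have 4: "nrm (T t (a *\<^sub>R v + b *\<^sub>R w) - ?z) = 0" using t vw by (intro T_lin)
  have "nrm (T t (a *\<^sub>R v + b *\<^sub>R w) - ?m) \<le> nrm (T t (a *\<^sub>R v + b *\<^sub>R w) - ?z) + nrm (?z - ?m)"
    using V by (intro nrm_triangle_diff)
  then have "nrm (T t (a *\<^sub>R v + b *\<^sub>R w) - ?m) \<le> 0" using 3 4 by linarith
  then show ?thesis using V by (intro antisym nrm_nonneg V_diff)
qed

text \<open>\<open>T t\<close> preserves the norms of \<open>v\<close> and \<open>w\<close>, so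
  \<open>inner_preserved\<close> equates \<open>B x v\<close> with \<open>B (T t x) (T t v)\<close>,
  and likewise for \<open>w\<close>. Inserting the known orbits gives a linear system for the two
  coefficients of \<open>T t x\<close>, whose matrix is a rotation and is inverted by cos^2 + sin^2
  = 1.\<close>

lemma T_coeffs:
  assumes t: "t > 0" and x: "x \<in> V"
  shows "B (T t x) v = cos (\<omega> * t) * B x v + sin (\<omega> * t) * B x w"
    and "B (T t x) w = cos (\<omega> * t) * B x w - sin (\<omega> * t) * B x v"
proof -
  interpret turned: rotation_pair V B T w "- v" \<omega> by (rule turned)
  have V: "T t x \<in> V" "T t v \<in> V" "T t w \<in> V" using t x vw by (auto simp: T_V)
  let ?c = "cos (\<omega> * t)" and ?s = "sin (\<omega> * t)"
  have 1: "nrm (T t v - (?c *\<^sub>R v - ?s *\<^sub>R w)) = 0" using T_v[OF t] by (simp add: orbit_def)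
  have iv: "B (T t x) (T t v) = B x v"
  proof (rule inner_preserved[OF t x vw(1)])
    have "nrm (T t v) = nrm (orbit (\<omega> * t))" using T_v[OF t] V by (intro nrm_cong) auto
    then show "nrm (T t v) = nrm v" using nrm_orbit vv by (simp add: nrm_def)
  qed
  have iw: "B (T t x) (T t w) = B x w"
  proof (rule inner_preserved[OF t x vw(2)])
    have "nrm (T t w) = nrm (turned.orbit (\<omega> * t))" using turned.T_v[OF t] V by (intro nrm_cong) auto
    then show "nrm (T t w) = nrm w" using turned.nrm_orbit ww by (simp add: nrm_def)
  qed
  have e1: "?c * B (T t x) v - ?s * B (T t x) w = B x v"
    using null_cong(2)[of "T t v" "?c *\<^sub>R v - ?s *\<^sub>R w" "T t x"] V vw 1 iv by (simp add: bilin)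
  have e2: "?s * B (T t x) v + ?c * B (T t x) w = B x w"
    using null_cong(2)[of "T t w" "?s *\<^sub>R v + ?c *\<^sub>R w" "T t x"] V vw T_w[OF t] iw by (simp add: bilin)
  have cs: "?c * ?c + ?s * ?s = 1" by (simp flip: power2_eq_square)
  show "B (T t x) v = ?c * B x v + ?s * B x w"
    unfolding e1[symmetric] e2[symmetric] using cs by algebra
  show "B (T t x) w = ?c * B x w - ?s * B x v"
    unfolding e1[symmetric] e2[symmetric] using cs by algebra
qed

end

section \<open>Calculus of smooth functions\<close>

lemma frechet_derivative_eqI: "(f has_derivative f') (at x) \<Longrightarrow> frechet_derivative f (at x) = f'"
  by (rule frechet_derivative_at[symmetric])

text \<open>The product rule needs this lowering of the order: each term of a derivative of a
  product still contains one undifferentiated factor.\<close>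

lemma k_times_cont_diff_SucD: "k_times_cont_diff (Suc k) f \<Longrightarrow> k_times_cont_diff k f"
proof (induction k arbitrary: f)
  case 0
  then show ?case
    by (auto intro!: continuous_at_imp_continuous_on differentiable_imp_continuous_within)
next
  case (Suc k)
  from Suc.prems show ?case
    unfolding k_times_cont_diff.simps(2)[of k f] 
    by (auto simp del: k_times_cont_diff.simps simp: k_times_cont_diff.simps(2)[of "Suc k" f] intro: Suc.IH)
qed

lemma k_times_cont_diff_bounded_linear:
  assumes "bounded_linear L" "k_times_cont_diff k f"
  shows "k_times_cont_diff k (\<lambda>x. L (f x))"
  using assms(2)
proof (induction k arbitrary: f)
  case 0
  then show ?case by (simp add: bounded_linear.continuous_on[OF assms(1)])
next
  case (Suc k)
  have d: "((\<lambda>x. L (f x)) has_derivative (\<lambda>v. L (frechet_derivative f (at x) v))) (at x)" for x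
    using Suc.prems frechet_derivative_works[of f "at x"]
    by (auto intro: bounded_linear.has_derivative[OF assms(1)])
  show ?case
    using Suc d by (auto simp: frechet_derivative_eqI[OF d] differentiable_def)
qed

lemma k_times_cont_diff_add:
  assumes "k_times_cont_diff k f" "k_times_cont_diff k g"
  shows "k_times_cont_diff k (\<lambda>x. f x + g x)"
  using assms
proof (induction k arbitrary: f g)
  case 0
  then show ?case by (auto intro: continuous_on_add)
next
  case (Suc k)
  have d: "((\<lambda>x. f x + g x) has_derivative
      (\<lambda>v. frechet_derivative f (at x) v + frechet_derivative g (at x) v)) (at x)" for x
    using Suc.prems frechet_derivative_works[of f "at x"] frechet_derivative_works[of g "at x"]
    by (auto intro: has_derivative_add)
  show ?case
    using Suc d by (auto simp: frechet_derivative_eqI[OF d] differentiable_def)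
qed

lemma k_times_cont_diff_mult:
  fixes f g :: "real^3 \<Rightarrow> real"
  assumes "k_times_cont_diff k f" "k_times_cont_diff k g"
  shows "k_times_cont_diff k (\<lambda>x. f x * g x)"
  using assms
proof (induction k arbitrary: f g)
  case 0
  then show ?case by (auto intro: continuous_on_mult)
next
  case (Suc k)
  have d: "((\<lambda>x. f x * g x) has_derivative
      (\<lambda>v. f x * frechet_derivative g (at x) v + frechet_derivative f (at x) v * g x)) (at x)" for x
    using Suc.prems frechet_derivative_works[of f "at x"] frechet_derivative_works[of g "at x"]
    by (auto intro: has_derivative_mult)
  show ?case
    using Suc d k_times_cont_diff_SucD[OF Suc.prems(1)] k_times_cont_diff_SucD[OF Suc.prems(2)]
    by (auto simp: frechet_derivative_eqI[OF d] differentiable_def intro!: k_times_cont_diff_add)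
qed

lemma k_times_cont_diff_const: "k_times_cont_diff k (\<lambda>x. c)"
  by (induction k arbitrary: c) auto

lemma k_times_cont_diff_prod:
  fixes f :: "'i \<Rightarrow> real^3 \<Rightarrow> real"
  assumes "\<And>i. i \<in> A \<Longrightarrow> k_times_cont_diff k (f i)"
  shows "k_times_cont_diff k (\<lambda>x. \<Prod>i\<in>A. f i x)"
  using assms
  by (induction A rule: infinite_finite_induct)
     (auto intro!: k_times_cont_diff_const k_times_cont_diff_mult)

section \<open>Smooth bumps on boxes\<close>

text \<open>The polynomial parameter makes the class of these flat germs closed under
  differentiation, so that smoothness of exp(-1/s), extended by zero, follows by an induction that
  varies \<open>p\<close>.\<close>

definition exp_germ :: "real poly \<Rightarrow> real \<Rightarrow> real" where
  "exp_germ p s = (if s > 0 then poly p (1 / s) * exp (- (1 / s)) else 0)"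

lemma poly_exp_decay: "((\<lambda>y::real. poly p y * exp (- y)) \<longlongrightarrow> 0) at_top"
proof -
  have "((\<lambda>y. \<Sum>i\<le>degree p. coeff p i * (y ^ i / exp y)) \<longlongrightarrow> (\<Sum>i\<le>degree p. coeff p i * 0)) at_top"
    by (intro tendsto_intros tendsto_power_div_exp_0)
  then show ?thesis
    by (simp add: poly_altdef exp_minus sum_distrib_right divide_inverse mult.assoc)
qed

text \<open>With y = 1/s the derivative for positive s is y^2 (p(y) - p'(y)) exp(-y); the polynomial
  \<open>[:0, 0, 1:]\<close> is the factor y^2 from the chain rule.\<close>

lemma exp_germ_has_derivative:
  "(exp_germ p has_real_derivative exp_germ ([:0, 0, 1:] * (p - pderiv p)) s) (at s)"
proof -
  consider "s > 0" | "s < 0" | "s = 0" by linarith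
  then show ?thesis
  proof cases
    case 1
    have "((\<lambda>s. poly p (1 / s) * exp (- (1 / s))) has_real_derivative
        exp_germ ([:0, 0, 1:] * (p - pderiv p)) s) (at s)"
      using 1
      by (auto intro!: derivative_eq_intros DERIV_chain2[OF poly_DERIV] simp: exp_germ_def field_simps power2_eq_square)
    then show ?thesis
      by (rule has_field_derivative_transform_within_open[where S = "{0<..}"])
         (use 1 in \<open>auto simp: exp_germ_def\<close>)
  next
    case 2
    have "((\<lambda>s. 0) has_real_derivative exp_germ ([:0, 0, 1:] * (p - pderiv p)) s) (at s)"
      using 2 by (simp add: exp_germ_def)
    then show ?thesis
      by (rule has_field_derivative_transform_within_open[where S = "{..<0}"])
         (use 2 in \<open>auto simp: exp_germ_def\<close>)
  next
    case 3
    \<comment> \<open>The difference quotient at 0 is again of this type: division by h multiplies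
      the polynomial by y = 1/h, and the exponential wins.\<close>
    have "((\<lambda>h. poly (p * [:0, 1:]) (inverse h) * exp (- inverse h)) \<longlongrightarrow> 0) (at_right (0::real))"
      by (rule filterlim_compose[OF poly_exp_decay filterlim_inverse_at_top_right])
    then have r: "((\<lambda>h. exp_germ p h / h) \<longlongrightarrow> 0) (at_right 0)"
      by (rule Lim_transform_eventually)
         (auto simp: eventually_at_right_field exp_germ_def field_simps intro!: exI[of _ 1])
    have l: "((\<lambda>h. exp_germ p h / h) \<longlongrightarrow> 0) (at_left 0)"
      by (rule Lim_transform_eventually[OF tendsto_const])
         (auto simp: eventually_at_left_field exp_germ_def intro!: exI[of _ "- 1"])
    have "((\<lambda>h. exp_germ p h / h) \<longlongrightarrow> 0) (at 0)"
      using l r by (simp add: filterlim_split_at)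
    then show ?thesis
      using 3 by (simp add: DERIV_def exp_germ_def)
  qed
qed

lemma k_times_cont_diff_exp_germ:
  fixes i :: 3
  shows "k_times_cont_diff k (\<lambda>x. exp_germ p (c * x $ i + d))"
proof (induction k arbitrary: p)
  case 0
  have "continuous_on UNIV (exp_germ p)"
    by (meson DERIV_continuous_on exp_germ_has_derivative has_field_derivative_at_within)
  then have "continuous_on UNIV (exp_germ p \<circ> (\<lambda>x :: real^3. c * x $ i + d))"
    by (intro continuous_on_compose continuous_intros) (auto intro: continuous_on_subset)
  then show ?case by (simp add: o_def)
next
  case (Suc k)
  define q where "q = [:0, 0, 1:] * (p - pderiv p)"
  have d: "((\<lambda>x. exp_germ p (c * x $ i + d)) has_derivative
      (\<lambda>v. exp_germ q (c * x $ i + d) * (c * v $ i))) (at x)" for x :: "real^3"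
  proof (rule has_derivative_compose[where f = "\<lambda>x. c * x $ i + d" and g = "exp_germ p"
        and f' = "\<lambda>v. c * v $ i" and g' = "(*) (exp_germ q (c * x $ i + d))"])
    have "((\<lambda>x :: real^3. x $ i) has_derivative (\<lambda>v. v $ i)) (at x)"
      by (rule bounded_linear_imp_has_derivative[OF bounded_linear_vec_nth])
    then show "((\<lambda>x. c * x $ i + d) has_derivative (\<lambda>v. c * v $ i)) (at x)"
      by (auto intro!: derivative_eq_intros)
    show "(exp_germ p has_derivative (*) (exp_germ q (c * x $ i + d))) (at (c * x $ i + d))"
      using exp_germ_has_derivative unfolding has_field_derivative_def q_def .
  qed
  have "k_times_cont_diff k (\<lambda>x. exp_germ q (c * x $ i + d) * (c * axis j 1 $ i))" for j
    by (rule k_times_cont_diff_bounded_linear[OF bounded_linear_mult_left Suc])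
  then show ?case
    using d by (auto simp: frechet_derivative_eqI[OF d] differentiable_def)
qed

text \<open>Each face of the box contributes one flat germ of the distance to it, steepened by
  \<open>Suc n\<close>, so the bumps tend pointwise to the indicator of the open box. Arguments are
  written as slope times coordinate plus constant to fit
  \<open>k_times_cont_diff_exp_germ\<close>.\<close>

definition box_bump :: "real^3 \<Rightarrow> real^3 \<Rightarrow> nat \<Rightarrow> real^3 \<Rightarrow> real" where
  "box_bump a b n x = (\<Prod>i\<in>UNIV. exp_germ 1 (real (Suc n) * x $ i + (- real (Suc n) * a $ i)) *
                               exp_germ 1 ((- real (Suc n)) * x $ i + real (Suc n) * b $ i))"

lemma exp_germ_1_bounds: "0 \<le> exp_germ 1 s" "exp_germ 1 s \<le> 1"
  by (auto simp: exp_germ_def)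

lemma box_bump_bounds: "0 \<le> box_bump a b n x" "box_bump a b n x \<le> 1"
  unfolding box_bump_def
  by (auto intro!: prod_nonneg prod_le_1 mult_nonneg_nonneg mult_le_one simp: exp_germ_1_bounds)

lemma box_bump_outside:
  assumes "x \<notin> box a b"
  shows "box_bump a b n x = 0"
proof -
  obtain i where "\<not> (a $ i < x $ i \<and> x $ i < b $ i)"
    using assms by (auto simp: mem_box_cart)
  then have "real (Suc n) * (x $ i - a $ i) \<le> 0 \<or> real (Suc n) * (b $ i - x $ i) \<le> 0"
    by (auto simp: mult_le_0_iff not_less)
  then have "exp_germ 1 (real (Suc n) * x $ i + (- real (Suc n) * a $ i)) *
             exp_germ 1 ((- real (Suc n)) * x $ i + real (Suc n) * b $ i) = 0"
    by (auto simp: exp_germ_def right_diff_distrib simp del: of_nat_Suc)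
  then show ?thesis unfolding box_bump_def by (auto simp del: of_nat_Suc intro: prod_zero)
qed

lemma exp_germ_1_scaled_limit:
  assumes "s > 0"
  shows "(\<lambda>n. exp_germ 1 (real (Suc n) * s)) \<longlonglongrightarrow> 1"
proof -
  have "(\<lambda>n. exp (- (1 / s * inverse (real (Suc n))))) \<longlonglongrightarrow> exp (- (1 / s * 0))"
    by (intro tendsto_intros LIMSEQ_inverse_real_of_nat)
  then show ?thesis using assms by (simp add: exp_germ_def field_simps del: of_nat_Suc)
qed

lemma box_bump_limit: "(\<lambda>n. box_bump a b n x) \<longlonglongrightarrow> indicator (box a b) x"
proof (cases "x \<in> box a b")
  case True
  have "(\<lambda>n. \<Prod>i\<in>UNIV. exp_germ 1 (real (Suc n) * (x $ i - a $ i)) * exp_germ 1 (real (Suc n) * (b $ i - x $ i)))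
     \<longlonglongrightarrow> (\<Prod>i\<in>(UNIV::3 set). 1 * 1)"
    using True by (intro tendsto_prod tendsto_mult exp_germ_1_scaled_limit) (auto simp: mem_box_cart)
  then show ?thesis using True by (simp add: box_bump_def algebra_simps del: of_nat_Suc)
qed (simp add: box_bump_outside)

lemma test_fun_box_bump:
  assumes "cbox a b \<subseteq> U"
  shows "test_fun U (box_bump a b n)"
  unfolding test_fun_def
proof (intro conjI allI exI[of _ "cbox a b"] impI)
  show "k_times_cont_diff k (box_bump a b n)" for k
    unfolding box_bump_def[abs_def]
    by (intro k_times_cont_diff_prod k_times_cont_diff_mult k_times_cont_diff_exp_germ)
  show "box_bump a b n x = 0" if "x \<notin> cbox a b" for x
    using that box_subset_cbox by (blast intro: box_bump_outside)
qed (use assms in auto)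

section \<open>The fundamental lemma of the calculus of variations\<close>

text \<open>The set where the function is positive is itself an admissible test set; the same
  argument is then applied to the negative.\<close>

lemma AE_eq_0_if_set_integrals_0:
  fixes g :: "'a \<Rightarrow> real"
  assumes g: "integrable M g"
    and zero: "\<And>A. A \<in> sets M \<Longrightarrow> (\<integral>x. indicator A x * g x \<partial>M) = 0"
  shows "AE x in M. g x = 0"
proof -
  have pos: "AE x in M. h x \<le> 0"
    if h: "integrable M h" and 0: "\<And>A. A \<in> sets M \<Longrightarrow> (\<integral>x. indicator A x * h x \<partial>M) = 0" for h :: "'a \<Rightarrow> real"
  proof -
    define A where "A = {x \<in> space M. h x > 0}"
    have [measurable]: "h \<in> borel_measurable M" using h by auto
    have A: "A \<in> sets M" unfolding A_def by measurable
    have "integrable M (\<lambda>x. indicator A x * h x)"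
      using integrable_mult_indicator[OF A h] by simp
    then have "AE x in M. indicator A x * h x = 0"
      using 0[OF A] integral_nonneg_eq_0_iff_AE[of M "\<lambda>x. indicator A x * h x"]
      by (auto simp: A_def indicator_def)
    then show ?thesis
      using AE_space by eventually_elim (auto simp: A_def indicator_def split: if_splits)
  qed
  have "AE x in M. g x \<le> 0" using assms by (rule pos)
  moreover have "AE x in M. - g x \<le> 0"
    using assms by (intro pos) auto
  ultimately show ?thesis by eventually_elim simp
qed

text \<open>Open boxes generate the Borel sets and are stable under intersection, and the sets over
  which \<open>g\<close> integrates to zero form a Dynkin system. The assumption
  \<open>total\<close> serves the step to complements.\<close>

lemma AE_eq_0_if_box_integrals_0:
  fixes g :: "'a::euclidean_space \<Rightarrow> real"
  assumes g: "integrable lborel g"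
    and zero: "\<And>a b. (\<integral>x. indicator (box a b) x * g x \<partial>lborel) = 0"
    and total: "(\<integral>x. g x \<partial>lborel) = 0"
  shows "AE x in lborel. g x = 0"
proof (rule AE_eq_0_if_set_integrals_0[OF g])
  fix A :: "'a set" assume "A \<in> sets lborel"
  then have A: "A \<in> sigma_sets UNIV (range (\<lambda>(a, b). box a b :: 'a set))"
    unfolding sets_lborel borel_eq_box by simp
  have meas: "B \<in> sets lborel" if "B \<in> sigma_sets UNIV (range (\<lambda>(a, b). box a b :: 'a set))" for B
    using that unfolding sets_lborel borel_eq_box by simp
  have int: "integrable lborel (\<lambda>x. indicator B x * g x)" if "B \<in> sets lborel" for B
    using integrable_mult_indicator[OF that g] by simp
  have "Int_stable (range (\<lambda>(a, b). box a b :: 'a set))"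
    by (auto simp: Int_stable_def box_Int_box)
  moreover have "range (\<lambda>(a, b). box a b :: 'a set) \<subseteq> Pow UNIV" by auto
  ultimately show "(\<integral>x. indicator A x * g x \<partial>lborel) = 0"
    using A
  proof (induction rule: sigma_sets_induct_disjoint)
    case (basic A)
    then show ?case using zero by auto
  next
    case (compl A)
    have "(\<integral>x. indicator (UNIV - A) x * g x \<partial>lborel) = (\<integral>x. g x - indicator A x * g x \<partial>lborel)"
      by (intro Bochner_Integration.integral_cong) (auto simp: indicator_def)
    also have "\<dots> = 0"
      using int[OF meas[OF compl(1)]] g total compl(2) by simp
    finally show ?case .
  next
    case (union A)
    have A: "A i \<in> sets lborel" for i using union(2) by (intro meas) auto
    then have U: "(\<Union>i. A i) \<in> sets lborel" by auto
    have "(\<integral>x. indicator (\<Union>i. A i) x *\<^sub>R g x \<partial>lborel) = (\<Sum>i. (\<integral>x. indicator (A i) x *\<^sub>R g x \<partial>lborel))"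
      using lebesgue_integral_countable_add[of A lborel g] union(1) A int[OF U]
      by (auto simp: set_lebesgue_integral_def set_integrable_def disjoint_family_on_def)
    then show ?case using union(3) by simp
  qed simp
qed

lemma integral_lebesgue_on:
  fixes f :: "'a::euclidean_space \<Rightarrow> real"
  assumes "U \<in> sets lebesgue"
  shows "integral\<^sup>L (lebesgue_on U) f = integral\<^sup>L lebesgue (\<lambda>x. indicator U x * f x)"
  using assms by (simp add: integral_restrict_space)

lemma integrable_lebesgue_on:
  fixes f :: "'a::euclidean_space \<Rightarrow> real"
  assumes "U \<in> sets lebesgue"
  shows "integrable (lebesgue_on U) f \<longleftrightarrow> integrable lebesgue (\<lambda>x. indicator U x * f x)"
  using assms by (simp add: integrable_restrict_space)

lemma AE_lebesgue_on_iff: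
  assumes "U \<in> sets lebesgue"
  shows "(AE x in lebesgue_on U. P x) \<longleftrightarrow> (AE x in lebesgue. x \<in> U \<longrightarrow> P x)"
  using assms by (simp add: AE_restrict_space_iff)

text \<open>Smooth bumps converge boundedly to the indicator of a box, so dominated convergence
  extends the hypothesis from test functions to boxes with closure in \<open>U\<close>. Inside one
  such box the function vanishes almost everywhere, and countably many of them exhaust
  \<open>U\<close> up to faces of measure zero.\<close>

theorem fundamental_lemma:
  fixes g :: "real^3 \<Rightarrow> real"
  assumes U: "open U" and g: "integrable (lebesgue_on U) g"
    and zero: "\<And>\<phi>. test_fun U \<phi> \<Longrightarrow> (\<integral>x. g x * \<phi> x \<partial>lebesgue_on U) = 0"
  shows "AE x in lebesgue_on U. g x = 0"
proof -
  have UM [simp]: "U \<in> sets lebesgue" using U by (simp add: borel_open)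
  define h where "h x = indicator U x * g x" for x
  have h: "integrable lebesgue h" using g by (simp add: integrable_lebesgue_on h_def[abs_def])
  then have hm: "h \<in> borel_measurable lebesgue" by auto
  \<comment> \<open>The generator argument runs over Borel sets, so \<open>h\<close> is replaced by
    a Borel function that agrees with it almost everywhere.\<close>
  then obtain h' where h'm [measurable]: "h' \<in> borel_measurable lborel" and hh': "AE x in lborel. h x = h' x"
    using completion_ex_borel_measurable_real by blast
  have hh'c: "AE x in lebesgue. h x = h' x" using hh' by (rule AE_completion)
  have h': "integrable lborel h'"
  proof -
    have "integrable lebesgue h'"
      using h hh'c by (subst integrable_cong_AE[of h' lebesgue h]) (auto simp: measurable_completion)
    then show ?thesis by (simp add: integrable_completion)
  qed
  have box0: "(\<integral>x. indicator (box a b) x * h' x \<partial>lborel) = 0" if ab: "cbox a b \<subseteq> U" for a b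
  proof -
    have "(\<lambda>n. \<integral>x. h' x * box_bump a b n x \<partial>lborel) \<longlonglongrightarrow> (\<integral>x. h' x * indicator (box a b) x \<partial>lborel)"
    proof (rule integral_dominated_convergence[where w = "\<lambda>x. \<bar>h' x\<bar>"])
      have "continuous_on UNIV (box_bump a b n)" for n
        using test_fun_box_bump[OF ab, of n] unfolding test_fun_def by (metis k_times_cont_diff.simps(1))
      then have [measurable]: "box_bump a b n \<in> borel_measurable borel" for n
        by (simp add: borel_measurable_continuous_onI)
      show "(\<lambda>x. h' x * box_bump a b n x) \<in> borel_measurable lborel" for n by simp
      show "integrable lborel (\<lambda>x. \<bar>h' x\<bar>)" using h' by auto
      show "AE x in lborel. (\<lambda>n. h' x * box_bump a b n x) \<longlonglongrightarrow> h' x * indicator (box a b) x"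
        by (intro AE_I2 tendsto_intros box_bump_limit)
      show "AE x in lborel. norm (h' x * box_bump a b n x) \<le> \<bar>h' x\<bar>" for n
        by (intro AE_I2) (auto simp: abs_mult box_bump_bounds intro: mult_left_le)
    qed simp
    moreover have "(\<integral>x. h' x * box_bump a b n x \<partial>lborel) = 0" for n
    proof -
      have "continuous_on UNIV (box_bump a b n)"
        using test_fun_box_bump[OF ab, of n] unfolding test_fun_def by (metis k_times_cont_diff.simps(1))
      then have [measurable]: "box_bump a b n \<in> borel_measurable lborel"
        by (simp add: borel_measurable_continuous_onI)
      have bump_m [measurable]: "box_bump a b n \<in> borel_measurable lebesgue"
        and [measurable]: "h' \<in> borel_measurable lebesgue"
        by (simp_all add: measurable_completion)
      note hm [measurable]
      have "(\<integral>x. h' x * box_bump a b n x \<partial>lborel) = (\<integral>x. h' x * box_bump a b n x \<partial>lebesgue)"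
        by (rule integral_completion[symmetric]) simp
      also have "\<dots> = (\<integral>x. h x * box_bump a b n x \<partial>lebesgue)"
      proof (rule integral_cong_AE)
        show "AE x in lebesgue. h' x * box_bump a b n x = h x * box_bump a b n x"
          using hh'c by eventually_elim simp
      qed measurable
      also have "\<dots> = (\<integral>x. g x * box_bump a b n x \<partial>lebesgue_on U)"
        by (simp add: integral_lebesgue_on h_def mult.assoc)
      also have "\<dots> = 0" by (rule zero[OF test_fun_box_bump[OF ab]])
      finally show ?thesis .
    qed
    ultimately show ?thesis by (simp add: LIMSEQ_const_iff mult.commute)
  qed
  have local0: "AE x in lborel. x \<in> box a b \<longrightarrow> h' x = 0" if ab: "cbox a b \<subseteq> U" for a b
  proof -
    have "AE x in lborel. indicator (box a b) x * h' x = 0"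
    proof (rule AE_eq_0_if_box_integrals_0)
      show "integrable lborel (\<lambda>x. indicator (box a b) x * h' x)"
        using integrable_mult_indicator[OF _ h', of "box a b"] by simp
      show "(\<integral>x. indicator (box a b) x * h' x \<partial>lborel) = 0" by (rule box0[OF ab])
      fix c d
      \<comment> \<open>Cutting off to \<open>box a b\<close> leaves an integral over an
        intersection of boxes, again a box. If it is empty its corners carry no information, so this
        case is separated before its closure is placed inside \<open>cbox a b\<close>.\<close>
      obtain u v where uv: "box a b \<inter> box c d = box u v" by (auto simp: box_Int_box)
      show "(\<integral>x. indicator (box c d) x * (indicator (box a b) x * h' x) \<partial>lborel) = 0"
      proof (cases "box u v = {}")
        case True
        then have "indicator (box c d) x * (indicator (box a b) x * h' x) = 0" for x
          using uv by (auto simp: indicator_def)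
        then show ?thesis by (simp only: integral_zero)
      next
        case False
        have "cbox u v \<subseteq> cbox a b"
        proof -
          have "closure (box u v) \<subseteq> closure (box a b)" unfolding uv[symmetric] by (intro closure_mono) auto
          moreover have "box a b \<noteq> {}" using False uv by auto
          ultimately show ?thesis using False by (simp add: closure_box)
        qed
        then have "(\<integral>x. indicator (box u v) x * h' x \<partial>lborel) = 0" using ab by (intro box0) auto
        moreover have "indicator (box u v) x * h' x = indicator (box c d) x * (indicator (box a b) x * h' x)" for x
          unfolding uv[symmetric] by (auto simp: indicator_def)
        ultimately show ?thesis by simp
      qed
    qed
    then show ?thesis by eventually_elim (auto simp: indicator_def)
  qed
  have "AE x in lebesgue. x \<in> U \<longrightarrow> h' x = 0"
  proof -
    obtain D where D: "countable D" "D \<subseteq> Pow U" "\<And>X. X \<in> D \<Longrightarrow> \<exists>a b. X = cbox a b" "\<Union>D = U"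
      using open_countable_Union_open_cbox[OF U] by blast
    have "AE x in lebesgue. x \<in> X \<longrightarrow> h' x = 0" if X: "X \<in> D" for X
    proof -
      obtain a b where ab: "X = cbox a b" "cbox a b \<subseteq> U" using D(2,3) X by blast
      \<comment> \<open>The cover consists of closed boxes, but vanishing is known on the open
        ones.\<close>
      have "cbox a b - box a b \<in> null_sets lebesgue"
        using negligible_frontier_interval negligible_iff_null_sets by blast
      then have "AE x in lebesgue. x \<notin> cbox a b - box a b" by (rule AE_not_in)
      then show ?thesis using AE_completion[OF local0[OF ab(2)]] by eventually_elim (auto simp: ab)
    qed
    then have "AE x in lebesgue. \<forall>X\<in>D. x \<in> X \<longrightarrow> h' x = 0"
      using D(1) by (subst AE_ball_countable) auto
    then show ?thesis
    proof eventually_elim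
      case (elim x)
      then show ?case using D(4) by (metis UnionE)
    qed
  qed
  then show ?thesis
    unfolding AE_lebesgue_on_iff[OF UM] using hh'c
    by eventually_elim (auto simp: h_def)
qed

section \<open>Partial derivatives of test functions\<close>

definition pd :: "3 \<Rightarrow> (real^3 \<Rightarrow> real) \<Rightarrow> real^3 \<Rightarrow> real" where
  "pd j f x = frechet_derivative f (at x) (axis j 1)"

definition dquot :: "real \<Rightarrow> 3 \<Rightarrow> (real^3 \<Rightarrow> real) \<Rightarrow> real^3 \<Rightarrow> real" where
  "dquot h j f x = (f (x + h *\<^sub>R axis j 1) - f x) / h"

lemma test_fun_continuous: "test_fun U f \<Longrightarrow> continuous_on UNIV f"
  unfolding test_fun_def by (metis k_times_cont_diff.simps(1))

lemma test_fun_differentiable: "test_fun U f \<Longrightarrow> f differentiable (at x)"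
  unfolding test_fun_def by (metis k_times_cont_diff.simps(2))

lemma test_fun_pd_continuous: "test_fun U f \<Longrightarrow> continuous_on UNIV (pd j f)"
  unfolding test_fun_def pd_def[abs_def] by (metis k_times_cont_diff.simps)

lemma test_fun_mono: "test_fun U f \<Longrightarrow> U \<subseteq> U' \<Longrightarrow> test_fun U' f"
  unfolding test_fun_def by blast

lemma pd_outside_support:
  assumes "compact C" "\<And>x. x \<notin> C \<Longrightarrow> f x = 0" "x \<notin> C"
  shows "pd j f x = 0"
proof -
  have "((\<lambda>x. 0) has_derivative (\<lambda>v. 0)) (at x)" by simp
  then have "(f has_derivative (\<lambda>v. 0)) (at x)"
    by (rule has_derivative_transform_within_open[of _ _ _ _ "- C"])
       (use assms in \<open>auto simp: compact_imp_closed open_Compl\<close>)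
  then show ?thesis by (simp add: pd_def frechet_derivative_eqI)
qed

lemma pd_line_derivative:
  assumes "\<And>x. f differentiable (at x)"
  shows "((\<lambda>s. f (x + s *\<^sub>R axis j 1)) has_real_derivative pd j f (x + s *\<^sub>R axis j 1)) (at s)"
proof -
  let ?y = "x + s *\<^sub>R axis j 1"
  have f: "(f has_derivative frechet_derivative f (at ?y)) (at ?y)"
    using assms frechet_derivative_works by blast
  have "((\<lambda>s. f (x + s *\<^sub>R axis j 1)) has_derivative (\<lambda>h. frechet_derivative f (at ?y) (h *\<^sub>R axis j 1))) (at s)"
    by (rule has_derivative_compose[where f = "\<lambda>s. x + s *\<^sub>R axis j 1", OF _ f])
       (auto intro!: derivative_eq_intros)
  moreover have "frechet_derivative f (at ?y) (h *\<^sub>R axis j 1) = pd j f ?y * h" for h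
    using linear_frechet_derivative[OF assms] by (simp add: pd_def linear_scale mult.commute)
  ultimately show ?thesis by (simp add: has_field_derivative_def)
qed

lemma dquot_tendsto:
  assumes "\<And>x. f differentiable (at x)" "h \<longlonglongrightarrow> 0" "\<And>n. h n \<noteq> 0"
  shows "(\<lambda>n. dquot (h n) j f x) \<longlonglongrightarrow> pd j f x"
proof -
  have "((\<lambda>h. dquot h j f x) \<longlongrightarrow> pd j f x) (at 0)"
    using pd_line_derivative[OF assms(1), of x j 0] by (simp add: DERIV_def dquot_def)
  moreover have "filterlim h (at 0) sequentially"
    using assms(2,3) by (auto simp: filterlim_at)
  ultimately show ?thesis by (rule filterlim_compose)
qed

lemma dquot_bound:
  assumes f: "\<And>x. f differentiable (at x)" and M: "\<And>x. \<bar>pd j f x\<bar> \<le> M" and "h \<noteq> 0"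
  shows "\<bar>dquot h j f x\<bar> \<le> M"
proof -
  let ?g = "\<lambda>s. f (x + s *\<^sub>R axis j 1)"
  have D: "(?g has_real_derivative pd j f (x + s *\<^sub>R axis j 1)) (at s)" for s
    by (rule pd_line_derivative[OF f])
  have "norm (?g h - ?g 0) \<le> M * norm (h - 0)"
    by (rule field_differentiable_bound[of UNIV, OF convex_UNIV])
       (use D M in \<open>auto intro: has_field_derivative_at_within\<close>)
  then show ?thesis using assms(3) by (simp add: dquot_def abs_divide divide_le_eq)
qed

lemma test_fun_bounds:
  fixes f :: "real^3 \<Rightarrow> real"
  assumes "test_fun U f"
  obtains C M where "compact C" "C \<subseteq> U" "\<And>x. x \<notin> C \<Longrightarrow> f x = 0" "\<And>j x. x \<notin> C \<Longrightarrow> pd j f x = 0"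
    "\<And>x. \<bar>f x\<bar> \<le> M" "\<And>j x. \<bar>pd j f x\<bar> \<le> M" "M \<ge> 0"
proof -
  obtain C where C: "compact C" "C \<subseteq> U" "\<And>x. x \<notin> C \<Longrightarrow> f x = 0"
    using assms unfolding test_fun_def by auto
  have bd: "\<exists>M. \<forall>x. \<bar>g x\<bar> \<le> M"
    if "continuous_on UNIV g" "\<And>x. x \<notin> C \<Longrightarrow> g x = 0" for g :: "real^3 \<Rightarrow> real"
  proof -
    have "bounded (g ` C)"
      using that C by (intro compact_imp_bounded compact_continuous_image) (auto intro: continuous_on_subset)
    then obtain M where "\<And>x. x \<in> C \<Longrightarrow> \<bar>g x\<bar> \<le> M" unfolding bounded_iff by auto
    then have "\<bar>g x\<bar> \<le> \<bar>M\<bar>" for x by (cases "x \<in> C") (force simp: that(2))+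
    then show ?thesis by blast
  qed
  have pd0: "pd j f x = 0" if "x \<notin> C" for j x using C that by (intro pd_outside_support) auto
  obtain M0 where M0: "\<And>x. \<bar>f x\<bar> \<le> M0" using bd[OF test_fun_continuous[OF assms] C(3)] by auto
  have "\<forall>j. \<exists>M. \<forall>x. \<bar>pd j f x\<bar> \<le> M" using bd[OF test_fun_pd_continuous[OF assms] pd0] by auto
  then obtain M1 where M1: "\<And>j x. \<bar>pd j f x\<bar> \<le> M1 j" by metis
  define M where "M = \<bar>M0\<bar> + (\<Sum>j\<in>UNIV. \<bar>M1 j\<bar>)"
  have "M1 j \<le> (\<Sum>j\<in>UNIV. \<bar>M1 j\<bar>)" for j
    using member_le_sum[of j UNIV "\<lambda>j. \<bar>M1 j\<bar>"] by auto
  then have "\<bar>pd j f x\<bar> \<le> M" for j x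
    using M1[of j x] unfolding M_def by (smt (verit))
  moreover have "\<bar>f x\<bar> \<le> M" for x
  proof -
    have "0 \<le> (\<Sum>j\<in>UNIV. \<bar>M1 j\<bar>)" by (intro sum_nonneg) simp
    then show ?thesis using M0[of x] unfolding M_def by linarith
  qed
  moreover have "M \<ge> 0" by (auto simp: M_def intro!: add_nonneg_nonneg sum_nonneg)
  ultimately show ?thesis using that C pd0 by blast
qed

lemma lborel_integral_translate:
  fixes F :: "'a::euclidean_space \<Rightarrow> real"
  assumes "F \<in> borel_measurable borel"
  shows "(\<integral>x. F (x + c) \<partial>lborel) = (\<integral>x. F x \<partial>lborel)"
proof -
  have "(\<integral>x. F x \<partial>lborel) = (\<integral>x. F x \<partial>distr lborel borel ((+) c))" by (simp add: lborel_distr_plus)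
  also have "\<dots> = (\<integral>x. F (c + x) \<partial>lborel)" using assms by (intro integral_distr) auto
  finally show ?thesis by (simp add: add.commute)
qed

lemma emeasure_lborel_compact_finite: "compact K \<Longrightarrow> emeasure lborel K < top"
  using emeasure_bounded_finite[OF compact_imp_bounded] by simp

lemma integrable_bounded_support:
  fixes F :: "'a::euclidean_space \<Rightarrow> real"
  assumes "F \<in> borel_measurable borel" "\<And>x. \<bar>F x\<bar> \<le> M" "compact K" "\<And>x. x \<notin> K \<Longrightarrow> F x = 0"
  shows "integrable lborel F"
proof (rule Bochner_Integration.integrable_bound)
  show "integrable lborel (\<lambda>x. M * indicator K x)"
    using assms(3) by (intro integrable_mult_right integrable_real_indicator)
      (auto simp: emeasure_lborel_compact_finite compact_imp_closed borel_closed)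
  show "AE x in lborel. norm (F x) \<le> norm (M * indicator K x)"
  proof (intro AE_I2)
    fix x show "norm (F x) \<le> norm (M * indicator K x)"
      using assms(2)[of x] assms(4)[of x] by (cases "x \<in> K") auto
  qed
qed (use assms in simp)

text \<open>For steps of length at most 1 all difference quotients vanish outside the closed
  1-neighbourhood of \<open>C\<close>. This compact set does not depend on \<open>h\<close> and
  serves in the integrable majorant.\<close>

lemma dquot_support:
  assumes "\<And>x. x \<notin> C \<Longrightarrow> f x = 0" "\<bar>h\<bar> \<le> 1" "x \<notin> (\<Union>c\<in>C. \<Union>y\<in>cball 0 1. {c + y})"
  shows "dquot h j f x = 0"
proof -
  have "x \<notin> C"
  proof
    assume "x \<in> C"
    moreover have "(0 :: real^3) \<in> cball 0 1" by simp
    ultimately show False using assms(3) by fastforce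
  qed
  moreover have "x + h *\<^sub>R axis j 1 \<notin> C"
  proof
    assume "x + h *\<^sub>R axis j 1 \<in> C"
    moreover have "- (h *\<^sub>R axis j 1) \<in> cball (0 :: real^3) 1"
      using assms(2) unfolding mem_cball_0 by (simp add: norm_axis_1)
    ultimately show False using assms(3) by fastforce
  qed
  ultimately show ?thesis using assms(1) by (simp add: dquot_def)
qed

lemma test_fun_measurable:
  fixes f :: "real^3 \<Rightarrow> real"
  assumes "test_fun U f"
  shows "f \<in> borel_measurable borel" "pd j f \<in> borel_measurable borel" "dquot h j f \<in> borel_measurable borel"
proof -
  show [measurable]: "f \<in> borel_measurable borel" and "pd j f \<in> borel_measurable borel"
    using assms by (auto intro: borel_measurable_continuous_onI test_fun_continuous test_fun_pd_continuous)
  show "dquot h j f \<in> borel_measurable borel" unfolding dquot_def[abs_def] by measurable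
qed

text \<open>The second factor is left general: it is a difference quotient of another test function
  or the constant 1.\<close>

lemma integral_dquot_tendsto:
  assumes f: "test_fun UNIV f" and h: "h \<longlonglongrightarrow> 0" "\<And>n. h n \<noteq> 0" "\<And>n. \<bar>h n\<bar> \<le> 1"
    and u [measurable]: "\<And>n. u n \<in> borel_measurable borel" "v \<in> borel_measurable borel"
    and ub: "\<And>n x. \<bar>u n x\<bar> \<le> M'" and uv: "\<And>x. (\<lambda>n. u n x) \<longlonglongrightarrow> v x"
  shows "(\<lambda>n. \<integral>x. dquot (h n) j f x * u n x \<partial>lborel) \<longlonglongrightarrow> (\<integral>x. pd j f x * v x \<partial>lborel)"
proof -
  obtain C M where C: "compact C" "\<And>x. x \<notin> C \<Longrightarrow> f x = 0" and M: "\<And>j x. \<bar>pd j f x\<bar> \<le> M" "M \<ge> 0"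
    using f by (rule test_fun_bounds) blast
  note df = test_fun_differentiable[OF f]
  note [measurable] = test_fun_measurable[OF f]
  define K where "K = (\<Union>c\<in>C. \<Union>y\<in>cball 0 1. {c + y})"
  have K: "compact K" unfolding K_def using C(1) by (intro compact_sums') auto
  show ?thesis
  proof (rule integral_dominated_convergence[where w = "\<lambda>x. M * M' * indicator K x"])
    show "integrable lborel (\<lambda>x. M * M' * indicator K x)"
      using K by (intro integrable_mult_right integrable_real_indicator)
        (auto simp: emeasure_lborel_compact_finite compact_imp_closed borel_closed)
    show "AE x in lborel. (\<lambda>n. dquot (h n) j f x * u n x) \<longlonglongrightarrow> pd j f x * v x"
      using h by (intro AE_I2 tendsto_mult dquot_tendsto df uv)
    show "AE x in lborel. norm (dquot (h n) j f x * u n x) \<le> M * M' * indicator K x" for n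
    proof (intro AE_I2)
      fix x
      show "norm (dquot (h n) j f x * u n x) \<le> M * M' * indicator K x"
      proof (cases "x \<in> K")
        case True
        then show ?thesis
          using dquot_bound[OF df M(1) h(2)] ub[of n x] M(2) by (simp add: abs_mult mult_mono)
      next
        case False
        then show ?thesis using dquot_support[of C f "h n" x j] C(2) h(3)[of n] by (simp add: K_def)
      qed
    qed
  qed simp_all
qed

lemma null_sequence:
  obtains h :: "nat \<Rightarrow> real" where "h \<longlonglongrightarrow> 0" "\<And>n. h n \<noteq> 0" "\<And>n. \<bar>h n\<bar> \<le> 1"
  by (rule that[of "\<lambda>n. inverse (real (Suc n))"])
     (use LIMSEQ_inverse_real_of_nat in \<open>auto simp: inverse_le_1_iff\<close>)

text \<open>With difference quotients of step \<open>h\<close> on the left and \<open>- h\<close> on the right the identity is exact,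
  by translation invariance of the measure; so no second derivatives are needed.\<close>
lemma integral_pd_mult_swap:
  assumes f: "test_fun UNIV f" and g: "test_fun UNIV g"
  shows "(\<integral>x. pd j f x * pd i g x \<partial>lborel) = (\<integral>x. pd i f x * pd j g x \<partial>lborel)"
proof -
  obtain C M where C: "compact C" "\<And>x. x \<notin> C \<Longrightarrow> f x = 0"
    and M: "\<And>x. \<bar>f x\<bar> \<le> M" "M \<ge> 0"
    using f by (rule test_fun_bounds) blast
  obtain M' where M': "\<And>x. \<bar>g x\<bar> \<le> M'" "\<And>j x. \<bar>pd j g x\<bar> \<le> M'"
    using g by (rule test_fun_bounds) blast
  note [measurable] = test_fun_measurable[OF f] test_fun_measurable[OF g]
  \<comment> \<open>A correlation integral: by translation invariance it depends on the difference
    of the two shifts alone.\<close>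
  define I where "I a b = (\<integral>x. f (x + a) * g (x + b) \<partial>lborel)" for a b
  have I_int: "integrable lborel (\<lambda>x. f (x + a) * g (x + b))" for a b
  proof (rule integrable_bounded_support[where K = "(+) (- a) ` C" and M = "M * M'"])
    show "\<bar>f (x + a) * g (x + b)\<bar> \<le> M * M'" for x
      using M M' by (simp add: abs_mult mult_mono)
    show "compact ((+) (- a) ` C)" using C(1) by (rule compact_translation)
    show "f (x + a) * g (x + b) = 0" if "x \<notin> (+) (- a) ` C" for x
    proof -
      have "x + a \<notin> C" using that by (auto simp: image_iff)
      then show ?thesis by (simp add: C)
    qed
  qed simp
  have I_shift: "I (a + c) (b + c) = I a b" for a b c
    using lborel_integral_translate[of "\<lambda>x. f (x + a) * g (x + b)" c] by (simp add: I_def algebra_simps)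
  have dq: "(\<integral>x. dquot h i f x * dquot h j g x \<partial>lborel) =
      (I (h *\<^sub>R axis i 1) (h *\<^sub>R axis j 1) - I (h *\<^sub>R axis i 1) 0 - I 0 (h *\<^sub>R axis j 1) + I 0 0) / h\<^sup>2"
    if "h \<noteq> 0" for h i j
  proof -
    have "dquot h i f x * dquot h j g x = (f (x + h *\<^sub>R axis i 1) * g (x + h *\<^sub>R axis j 1) - f (x + h *\<^sub>R axis i 1) * g (x + 0)
      - f (x + 0) * g (x + h *\<^sub>R axis j 1) + f (x + 0) * g (x + 0)) / h\<^sup>2" for x
      by (simp add: dquot_def field_simps power2_eq_square)
    then show ?thesis
      unfolding I_def using I_int by (simp del: add_0_right)
  qed
  have sym: "(\<integral>x. dquot h j f x * dquot h i g x \<partial>lborel) = (\<integral>x. dquot (- h) i f x * dquot (- h) j g x \<partial>lborel)"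
    if "h \<noteq> 0" for h
  proof -
    have "I ((- h) *\<^sub>R axis i 1) ((- h) *\<^sub>R axis j 1) = I (h *\<^sub>R axis j 1) (h *\<^sub>R axis i 1)"
      using I_shift[of "(- h) *\<^sub>R axis i 1" "h *\<^sub>R axis i 1 + h *\<^sub>R axis j 1" "(- h) *\<^sub>R axis j 1"] by simp
    moreover have "I ((- h) *\<^sub>R axis i 1) 0 = I 0 (h *\<^sub>R axis i 1)"
      using I_shift[of "(- h) *\<^sub>R axis i 1" "h *\<^sub>R axis i 1" 0] by simp
    moreover have "I 0 ((- h) *\<^sub>R axis j 1) = I (h *\<^sub>R axis j 1) 0"
      using I_shift[of 0 "h *\<^sub>R axis j 1" "(- h) *\<^sub>R axis j 1"] by simp
    ultimately show ?thesis using that by (simp add: dq)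
  qed
  obtain h :: "nat \<Rightarrow> real" where h: "h \<longlonglongrightarrow> 0" "\<And>n. h n \<noteq> 0" "\<And>n. \<bar>h n\<bar> \<le> 1"
    by (rule null_sequence) blast
  have lim: "(\<lambda>n. \<integral>x. dquot (h n) j f x * dquot (h n) i g x \<partial>lborel) \<longlonglongrightarrow> (\<integral>x. pd j f x * pd i g x \<partial>lborel)"
    if "h \<longlonglongrightarrow> 0" "\<And>n. h n \<noteq> 0" "\<And>n. \<bar>h n\<bar> \<le> 1" for h i j
    using that test_fun_differentiable[OF g] M'(2)
    by (intro integral_dquot_tendsto f dquot_tendsto test_fun_measurable[OF g]) (auto intro!: dquot_bound)
  have "(\<lambda>n. \<integral>x. dquot (- h n) i f x * dquot (- h n) j g x \<partial>lborel) \<longlonglongrightarrow> (\<integral>x. pd i f x * pd j g x \<partial>lborel)"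
    using tendsto_minus[OF h(1)] h by (intro lim) auto
  then show ?thesis using lim[OF h, of j i] sym[OF h(2)] LIMSEQ_unique by auto
qed

text \<open>Every difference quotient has integral zero by translation invariance, and the limit
  inherits it; no integration along lines is involved.\<close>

lemma integral_pd:
  assumes f: "test_fun UNIV f"
  shows "(\<integral>x. pd j f x \<partial>lborel) = 0"
proof -
  obtain C M where C: "compact C" "\<And>x. x \<notin> C \<Longrightarrow> f x = 0" and M: "\<And>x. \<bar>f x\<bar> \<le> M"
    using f by (rule test_fun_bounds) blast
  note [measurable] = test_fun_measurable[OF f]
  have int_f: "integrable lborel (\<lambda>x. f (x + a))" for a
  proof (rule integrable_bounded_support[where K = "(+) (- a) ` C" and M = M])
    show "compact ((+) (- a) ` C)" using C(1) by (rule compact_translation)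
    show "f (x + a) = 0" if "x \<notin> (+) (- a) ` C" for x
    proof -
      have "x + a \<notin> C" using that by (auto simp: image_iff)
      then show ?thesis by (simp add: C)
    qed
  qed (simp_all add: M)
  have 0: "(\<integral>x. dquot h j f x \<partial>lborel) = 0" for h
    using int_f[of 0] int_f[of "h *\<^sub>R axis j 1"] lborel_integral_translate[of f "h *\<^sub>R axis j 1"]
    by (simp add: dquot_def)
  obtain h :: "nat \<Rightarrow> real" where h: "h \<longlonglongrightarrow> 0" "\<And>n. h n \<noteq> 0" "\<And>n. \<bar>h n\<bar> \<le> 1"
    by (rule null_sequence) blast
  have "(\<lambda>n. \<integral>x. dquot (h n) j f x * 1 \<partial>lborel) \<longlonglongrightarrow> (\<integral>x. pd j f x * 1 \<partial>lborel)"
    by (rule integral_dquot_tendsto[OF f h, of _ _ 1]) auto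
  then show ?thesis by (simp add: 0 LIMSEQ_const_iff)
qed

section \<open>Square-integrable fields\<close>

lemma L2_measurable: "L2 U f \<Longrightarrow> f \<in> borel_measurable (lebesgue_on U)"
  by (simp add: L2_def)

lemma L2_0 [simp]: "L2 U (\<lambda>x. 0)"
  by (simp add: L2_def)

lemma L2_dominated:
  fixes f :: "real^3 \<Rightarrow> 'b::euclidean_space" and h :: "real^3 \<Rightarrow> 'c::euclidean_space"
  assumes "f \<in> borel_measurable (lebesgue_on U)" "L2 U h" "\<And>x. norm (f x) \<le> C * norm (h x)"
  shows "L2 U f"
  unfolding L2_def
proof
  have "integrable (lebesgue_on U) (\<lambda>x. C\<^sup>2 * (norm (h x))\<^sup>2)" using assms(2) by (simp add: L2_def)
  then show "integrable (lebesgue_on U) (\<lambda>x. (norm (f x))\<^sup>2)"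
  proof (rule Bochner_Integration.integrable_bound)
    show "(\<lambda>x. (norm (f x))\<^sup>2) \<in> borel_measurable (lebesgue_on U)" using assms(1) by simp
    show "AE x in lebesgue_on U. norm ((norm (f x))\<^sup>2) \<le> norm (C\<^sup>2 * (norm (h x))\<^sup>2)"
    proof (intro AE_I2)
      fix x
      have "(norm (f x))\<^sup>2 \<le> (C * norm (h x))\<^sup>2" using assms(3) by (intro power_mono) auto
      then show "norm ((norm (f x))\<^sup>2) \<le> norm (C\<^sup>2 * (norm (h x))\<^sup>2)" by (simp add: power_mult_distrib)
    qed
  qed
qed (fact assms(1))

lemma L2_scaleR: "L2 U f \<Longrightarrow> L2 U (\<lambda>x. r *\<^sub>R f x)"
  by (rule L2_dominated[where C = "\<bar>r\<bar>" and h = f])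
     (auto intro: borel_measurable_scaleR[OF borel_measurable_const L2_measurable])

lemma L2_bounded_linear:
  fixes L :: "'b::euclidean_space \<Rightarrow> 'c::euclidean_space"
  assumes L: "linear L" and f: "L2 U f"
  shows "L2 U (\<lambda>x. L (f x))"
proof -
  have b: "bounded_linear L" using L by (simp add: linear_conv_bounded_linear)
  obtain K where K: "\<And>x. norm (L x) \<le> norm x * K" using bounded_linear.bounded[OF b] by auto
  have "L \<in> borel_measurable borel"
    using b by (intro borel_measurable_continuous_onI) (simp add: linear_continuous_on)
  from measurable_compose[OF L2_measurable[OF f] this]
  show ?thesis using f by (rule L2_dominated[where C = K]) (use K in \<open>simp add: mult.commute\<close>)
qed

lemma L2_add:
  assumes "L2 U f" "L2 U g"
  shows "L2 U (\<lambda>x. f x + g x)"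
  unfolding L2_def
proof
  note [measurable] = L2_measurable[OF assms(1)] L2_measurable[OF assms(2)]
  show "(\<lambda>x. f x + g x) \<in> borel_measurable (lebesgue_on U)" by measurable
  have "integrable (lebesgue_on U) (\<lambda>x. 2 * (norm (f x))\<^sup>2 + 2 * (norm (g x))\<^sup>2)"
    using assms by (simp add: L2_def)
  then show "integrable (lebesgue_on U) (\<lambda>x. (norm (f x + g x))\<^sup>2)"
  proof (rule Bochner_Integration.integrable_bound)
    show "AE x in lebesgue_on U. norm ((norm (f x + g x))\<^sup>2) \<le> norm (2 * (norm (f x))\<^sup>2 + 2 * (norm (g x))\<^sup>2)"
    proof (intro AE_I2)
      fix x
      have "(norm (f x + g x))\<^sup>2 \<le> (norm (f x) + norm (g x))\<^sup>2" by (intro power_mono norm_triangle_ineq) auto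
      also have "\<dots> \<le> 2 * (norm (f x))\<^sup>2 + 2 * (norm (g x))\<^sup>2"
        using sum_squares_bound[of "norm (f x)" "norm (g x)"] by (simp add: power2_sum)
      finally show "norm ((norm (f x + g x))\<^sup>2) \<le> norm (2 * (norm (f x))\<^sup>2 + 2 * (norm (g x))\<^sup>2)" by simp
    qed
  qed measurable
qed

lemma L2_diff: "L2 U f \<Longrightarrow> L2 U g \<Longrightarrow> L2 U (\<lambda>x. f x - g x)"
  using L2_add[of U f "\<lambda>x. (- 1) *\<^sub>R g x"] L2_scaleR[of U g "- 1"] by simp

lemma L2_integrable_inner:
  assumes "L2 U f" "L2 U g"
  shows "integrable (lebesgue_on U) (\<lambda>x. f x \<bullet> g x)"
proof (rule Bochner_Integration.integrable_bound)
  note [measurable] = L2_measurable[OF assms(1)] L2_measurable[OF assms(2)]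
  show "integrable (lebesgue_on U) (\<lambda>x. (norm (f x))\<^sup>2 + (norm (g x))\<^sup>2)"
    using assms by (simp add: L2_def)
  show "(\<lambda>x. f x \<bullet> g x) \<in> borel_measurable (lebesgue_on U)" by measurable
  show "AE x in lebesgue_on U. norm (f x \<bullet> g x) \<le> norm ((norm (f x))\<^sup>2 + (norm (g x))\<^sup>2)"
  proof (intro AE_I2)
    fix x
    have "\<bar>f x \<bullet> g x\<bar> \<le> norm (f x) * norm (g x)" by (rule Cauchy_Schwarz_ineq2)
    also have "\<dots> \<le> (norm (f x))\<^sup>2 + (norm (g x))\<^sup>2"
      using sum_squares_bound[of "norm (f x)" "norm (g x)"] zero_le_power2[of "norm (f x)"]
        zero_le_power2[of "norm (g x)"] by linarith
    finally show "norm (f x \<bullet> g x) \<le> norm ((norm (f x))\<^sup>2 + (norm (g x))\<^sup>2)" by simp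
  qed
qed

text \<open>Nothing is known about \<open>f\<close> on the exceptional set; measurability comes from
  completeness of Lebesgue measure.\<close>

lemma L2_AE_zero:
  assumes "AE x in lebesgue_on U. f x = 0" "U \<in> sets lebesgue"
  shows "L2 U f"
proof -
  define N where "N = {x \<in> U. f x \<noteq> 0}"
  have "AE x in lebesgue. x \<notin> N"
    using assms by (simp add: AE_lebesgue_on_iff) (auto simp: N_def elim: eventually_mono)
  then have "N \<in> null_sets lebesgue"
    by (simp add: completion.AE_iff_null_sets)
  then have "negligible N" by (simp add: negligible_iff_null_sets)
  then have "f measurable_on U"
    by (rule measurable_on_spike[of "\<lambda>x. 0" U N, rotated]) (auto simp: N_def measurable_on_const)
  then have m: "f \<in> borel_measurable (lebesgue_on U)"
    using assms(2) by (simp add: measurable_on_iff_borel_measurable)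
  moreover have "integrable (lebesgue_on U) (\<lambda>x. (norm (f x))\<^sup>2)"
    using assms m by (subst integrable_cong_AE[where g = "\<lambda>x. 0"]) auto
  ultimately show ?thesis by (simp add: L2_def)
qed

interpretation l2: semi_inner "{f :: real^3 \<Rightarrow> 'b::euclidean_space. L2 U f}" "l2_inner U" for U
proof
  show "subspace {f :: real^3 \<Rightarrow> 'b. L2 U f}"
    by (auto simp: subspace_def zero_fun_def plus_fun_def scaleR_fun_def intro: L2_add L2_scaleR)
  fix f g h :: "real^3 \<Rightarrow> 'b"
  assume "f \<in> {f. L2 U f}" "g \<in> {f. L2 U f}" "h \<in> {f. L2 U f}"
  then show "l2_inner U (f + g) h = l2_inner U f h + l2_inner U g h"
    by (simp add: l2_inner_def inner_add_left L2_integrable_inner)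
qed (auto simp: l2_inner_def inner_commute)

lemma l2_nrm_eq [simp]: "l2.nrm U f = l2_norm U f"
  by (simp add: l2.nrm_def l2_norm_def)

lemma l2_inner_AE_cong:
  assumes "AE x in lebesgue_on U. f x = f' x" "AE x in lebesgue_on U. g x = g' x"
    "L2 U f" "L2 U f'" "L2 U g" "L2 U g'"
  shows "l2_inner U f g = l2_inner U f' g'"
proof -
  note [measurable] = assms(3-6)[THEN L2_measurable]
  show ?thesis unfolding l2_inner_def
    by (rule integral_cong_AE; (measurable)?) (use assms(1,2) in eventually_elim, simp)
qed

lemma l2_norm_eq_0_iff:
  assumes "L2 U f"
  shows "l2_norm U f = 0 \<longleftrightarrow> (AE x in lebesgue_on U. f x = 0)"
  using assms integral_nonneg_eq_0_iff_AE[of "lebesgue_on U" "\<lambda>x. f x \<bullet> f x"] L2_integrable_inner[OF assms assms]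
  by (simp add: l2_norm_def l2_inner_def)

lemma nn_integral_norm_sq:
  assumes "L2 U f"
  shows "(\<integral>\<^sup>+x. ennreal ((norm (f x))\<^sup>2) \<partial>lebesgue_on U) = ennreal ((l2_norm U f)\<^sup>2)"
proof -
  have "(l2_norm U f)\<^sup>2 = (\<integral>x. (norm (f x))\<^sup>2 \<partial>lebesgue_on U)"
    using l2.nrm_sq[of f U] assms by (simp add: l2_inner_def power2_norm_eq_inner)
  then show ?thesis using assms by (simp add: L2_def nn_integral_eq_integral)
qed



lemma L2_const:
  assumes "bounded U" "U \<in> sets lebesgue"
  shows "L2 U (\<lambda>x. c)"
  using finite_measure.integrable_const[OF finite_measure_lebesgue_on] bounded_set_imp_lmeasurable[OF assms]
  by (simp add: L2_def)

lemma L2_integrable: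
  assumes "bounded U" "U \<in> sets lebesgue" "L2 U f"
  shows "integrable (lebesgue_on U) f"
proof -
  have "integrable (lebesgue_on U) (\<lambda>x. norm (f x))"
  proof -
    note [measurable] = L2_measurable[OF assms(3)]
    have "L2 U (\<lambda>x. norm (f x))" using assms(3) by (rule L2_dominated[where C = 1, rotated]) auto
    then show ?thesis using L2_integrable_inner[OF _ L2_const[OF assms(1,2), of "1::real"]] by fastforce
  qed
  then show ?thesis using L2_measurable[OF assms(3)] by (simp add: integrable_norm_iff)
qed

text \<open>Riesz-Fischer: along a rapidly converging subsequence the norms of successive
  differences are summable almost everywhere, which gives a pointwise limit. Fatou's lemma then
  turns the Cauchy property of the whole sequence into convergence in L^2.\<close>

theorem L2_complete:
  fixes f :: "nat \<Rightarrow> real^3 \<Rightarrow> 'b::euclidean_space"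
  assumes U: "bounded U" "U \<in> sets lebesgue" and f: "\<And>n. L2 U (f n)"
    and Cauchy: "\<And>\<epsilon>. \<epsilon> > 0 \<Longrightarrow> \<exists>N. \<forall>m\<ge>N. \<forall>n\<ge>N. l2_norm U (\<lambda>x. f m x - f n x) < \<epsilon>"
  obtains g where "L2 U g" "(\<lambda>n. l2_norm U (\<lambda>x. f n x - g x)) \<longlonglongrightarrow> 0"
proof -
  note [measurable] = L2_measurable[OF f]
  have "\<exists>N. \<forall>k. \<forall>m\<ge>N k. \<forall>n\<ge>N k. l2_norm U (\<lambda>x. f m x - f n x) < (1/2) ^ k"
    using Cauchy[of "(1/2) ^ k" for k] by (intro choice allI) simp
  then obtain N where N: "\<And>k m n. m \<ge> N k \<Longrightarrow> n \<ge> N k \<Longrightarrow> l2_norm U (\<lambda>x. f m x - f n x) < (1/2) ^ k"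
    by blast
  \<comment> \<open>\<open>N\<close> need not be monotone. Summing it up makes \<open>r\<close>
    increasing and at least \<open>N k\<close>; the extra \<open>k\<close> makes it also at least
    \<open>k\<close>.\<close>
  define r where "r k = (\<Sum>i\<le>k. N i) + k" for k
  have r: "r k \<ge> N k" "r k \<ge> k" "r k \<le> r (Suc k)" for k
    using member_le_sum[of k "{..k}" N] by (auto simp: r_def)
  define h where "h k = f (r k)" for k
  have hL2: "L2 U (\<lambda>x. h (Suc k) x - h k x)" for k unfolding h_def by (intro L2_diff f)
  have hm [measurable]: "h k \<in> borel_measurable (lebesgue_on U)" for k by (simp add: h_def)
  \<comment> \<open>Boundedness of \<open>U\<close> puts the constant 1 into L^2, and Cauchy-Schwarz
    against it turns L^2 estimates into L^1 estimates.\<close>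
  define c where "c = l2_norm U (\<lambda>x. 1 :: real)"
  have L1: "(\<integral>x. norm (h (Suc k) x - h k x) \<partial>lebesgue_on U) \<le> c * (1/2) ^ k" for k
  proof -
    have n: "L2 U (\<lambda>x. norm (h (Suc k) x - h k x))"
      using hL2 by (rule L2_dominated[where C = 1, rotated]) auto
    have "(\<integral>x. norm (h (Suc k) x - h k x) \<partial>lebesgue_on U) = l2_inner U (\<lambda>x. 1) (\<lambda>x. norm (h (Suc k) x - h k x))"
      by (simp add: l2_inner_def)
    also have "\<dots> \<le> c * l2_norm U (\<lambda>x. norm (h (Suc k) x - h k x))"
      using l2.Cauchy_Schwarz[of "\<lambda>x. 1 :: real" U "\<lambda>x. norm (h (Suc k) x - h k x)"] n L2_const[OF U, of "1::real"]
      by (simp add: c_def abs_le_iff)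
    also have "l2_norm U (\<lambda>x. norm (h (Suc k) x - h k x)) = l2_norm U (\<lambda>x. h (Suc k) x - h k x)"
      by (simp add: l2_norm_def l2_inner_def flip: power2_eq_square power2_norm_eq_inner)
    also have "c * \<dots> \<le> c * (1/2) ^ k"
      using N[of k "r (Suc k)" "r k"] r(1)[of k] r(3)[of k] l2.nrm_nonneg[of "\<lambda>x. 1 :: real" U] L2_const[OF U, of "1::real"]
      by (intro mult_left_mono) (auto simp: h_def c_def)
    finally show ?thesis .
  qed
  have "(\<integral>\<^sup>+x. (\<Sum>k. ennreal (norm (h (Suc k) x - h k x))) \<partial>lebesgue_on U) < \<infinity>"
  proof -
    have "(\<integral>\<^sup>+x. (\<Sum>k. ennreal (norm (h (Suc k) x - h k x))) \<partial>lebesgue_on U)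
        = (\<Sum>k. \<integral>\<^sup>+x. ennreal (norm (h (Suc k) x - h k x)) \<partial>lebesgue_on U)"
      by (rule nn_integral_suminf) measurable
    also have "\<dots> \<le> (\<Sum>k. ennreal (c * (1/2) ^ k))"
    proof (rule suminf_le)
      show "(\<integral>\<^sup>+x. ennreal (norm (h (Suc k) x - h k x)) \<partial>lebesgue_on U) \<le> ennreal (c * (1/2) ^ k)" for k
        using L2_integrable[OF U hL2] L1[of k] by (subst nn_integral_eq_integral) (auto intro: ennreal_leI)
    qed auto
    also have "\<dots> = ennreal (\<Sum>k. c * (1/2) ^ k)"
      using l2.nrm_nonneg[of "\<lambda>x. 1 :: real" U] L2_const[OF U, of "1::real"]
      by (intro suminf_ennreal2) (auto simp: c_def intro!: summable_mult)
    finally show ?thesis by (simp add: order_le_less_trans)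
  qed
  then have "AE x in lebesgue_on U. (\<Sum>k. ennreal (norm (h (Suc k) x - h k x))) \<noteq> \<infinity>"
    by (intro nn_integral_noteq_infinite) auto
  then have conv: "AE x in lebesgue_on U. convergent (\<lambda>n. h n x)"
  proof eventually_elim
    case (elim x)
    then have "summable (\<lambda>k. norm (h (Suc k) x - h k x))"
      by (intro summable_suminf_not_top) auto
    then have "summable (\<lambda>k. h (Suc k) x - h k x)" by (rule summable_norm_cancel)
    then have "convergent (\<lambda>n. \<Sum>k<n. h (Suc k) x - h k x)"
      by (simp add: summable_iff_convergent)
    then have "convergent (\<lambda>n. h n x - h 0 x)" by (simp add: sum_lessThan_telescope[of "\<lambda>k. h k x"])
    then have "convergent (\<lambda>n. (h n x - h 0 x) + h 0 x)" by (intro convergent_add convergent_const)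
    then show ?case by simp
  qed
  define g where "g x = lim (\<lambda>n. h n x)" for x
  have g_lim: "AE x in lebesgue_on U. (\<lambda>n. h n x) \<longlonglongrightarrow> g x"
    using conv by eventually_elim (simp add: g_def convergent_LIMSEQ_iff)
  have [measurable]: "g \<in> borel_measurable (lebesgue_on U)"
    unfolding g_def[abs_def] by measurable
  \<comment> \<open>Here \<open>m\<close> is fixed while \<open>h n\<close> runs to
    \<open>g\<close>. Since \<open>r n \<ge> n\<close>, the function \<open>h n\<close> is an
    \<open>f\<close> with index beyond \<open>N k\<close> as soon as \<open>n\<close> is.\<close>
  have fg: "(\<integral>\<^sup>+x. ennreal ((norm (f m x - g x))\<^sup>2) \<partial>lebesgue_on U) \<le> ennreal (((1/2) ^ k)\<^sup>2)"
    if m: "m \<ge> N k" for m k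
  proof -
    have "(\<integral>\<^sup>+x. ennreal ((norm (f m x - g x))\<^sup>2) \<partial>lebesgue_on U)
        = (\<integral>\<^sup>+x. liminf (\<lambda>n. ennreal ((norm (f m x - h n x))\<^sup>2)) \<partial>lebesgue_on U)"
    proof (rule nn_integral_cong_AE)
      show "AE x in lebesgue_on U. ennreal ((norm (f m x - g x))\<^sup>2) = liminf (\<lambda>n. ennreal ((norm (f m x - h n x))\<^sup>2))"
        using g_lim
      proof eventually_elim
        case (elim x)
        then have "(\<lambda>n. ennreal ((norm (f m x - h n x))\<^sup>2)) \<longlonglongrightarrow> ennreal ((norm (f m x - g x))\<^sup>2)"
          by (intro tendsto_ennrealI tendsto_intros)
        then show ?case by (intro lim_imp_Liminf[symmetric]) auto
      qed
    qed
    also have "\<dots> \<le> liminf (\<lambda>n. \<integral>\<^sup>+x. ennreal ((norm (f m x - h n x))\<^sup>2) \<partial>lebesgue_on U)"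
      by (rule nn_integral_liminf) measurable
    also have "\<dots> \<le> liminf (\<lambda>n. ennreal (((1/2) ^ k)\<^sup>2))"
    proof (rule Liminf_mono)
      have "(\<integral>\<^sup>+x. ennreal ((norm (f m x - h n x))\<^sup>2) \<partial>lebesgue_on U) \<le> ennreal (((1/2) ^ k)\<^sup>2)" if n: "n \<ge> N k" for n
      proof -
        have "L2 U (\<lambda>x. f m x - h n x)" unfolding h_def by (intro L2_diff f)
        moreover have "l2_norm U (\<lambda>x. f m x - h n x) < (1/2) ^ k"
          using N[OF m, of "r n"] r(2)[of n] n by (auto simp: h_def)
        ultimately show ?thesis
          using l2.nrm_nonneg[of "\<lambda>x. f m x - h n x" U]
          by (simp add: nn_integral_norm_sq del: power_divide)
      qed
      then show "\<forall>\<^sub>F n in sequentially. (\<integral>\<^sup>+x. ennreal ((norm (f m x - h n x))\<^sup>2) \<partial>lebesgue_on U) \<le> ennreal (((1/2) ^ k)\<^sup>2)"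
        unfolding eventually_sequentially by blast
    qed
    also have "\<dots> = ennreal (((1/2) ^ k)\<^sup>2)" by (simp add: Liminf_const)
    finally show ?thesis .
  qed
  have fgL2: "L2 U (\<lambda>x. f m x - g x)" if m: "m \<ge> N k" for m k
    unfolding L2_def
    using fg[OF m] by (intro conjI integrableI_bounded) (auto intro: order_le_less_trans)
  have gL2: "L2 U g"
    using L2_diff[OF f fgL2[of 0 "N 0"], of "N 0"] by simp
  moreover have "(\<lambda>n. l2_norm U (\<lambda>x. f n x - g x)) \<longlonglongrightarrow> 0"
  proof (rule LIMSEQ_I)
    fix e :: real assume "e > 0"
    then obtain k where k: "(1/2) ^ k < e" using real_arch_pow_inv[of e "1/2"] by auto
    have "norm (l2_norm U (\<lambda>x. f n x - g x) - 0) < e" if n: "n \<ge> N k" for n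
    proof -
      have 1: "L2 U (\<lambda>x. f n x - g x)" using f gL2 by (rule L2_diff)
      have "ennreal ((l2_norm U (\<lambda>x. f n x - g x))\<^sup>2) \<le> ennreal (((1/2) ^ k)\<^sup>2)"
        using fg[OF n] nn_integral_norm_sq[OF 1] by simp
      then have "(l2_norm U (\<lambda>x. f n x - g x))\<^sup>2 \<le> ((1/2) ^ k)\<^sup>2" by (subst (asm) ennreal_le_iff) auto
      then have "l2_norm U (\<lambda>x. f n x - g x) \<le> (1/2) ^ k" by (rule power2_le_imp_le) simp
      then show ?thesis using k l2.nrm_nonneg[of "\<lambda>x. f n x - g x" U] 1 by simp
    qed
    then show "\<exists>no. \<forall>n\<ge>no. norm (l2_norm U (\<lambda>x. f n x - g x) - 0) < e" by blast
  qed
  ultimately show ?thesis by (rule that)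
qed

lemma l2_inner_lincomb:
  assumes "L2 U f" "L2 U g" "L2 U h"
  shows "l2_inner U (\<lambda>x. a *\<^sub>R f x + b *\<^sub>R g x) h = a * l2_inner U f h + b * l2_inner U g h"
proof -
  have "(\<lambda>x. a *\<^sub>R f x + b *\<^sub>R g x) = a *\<^sub>R f + b *\<^sub>R g" by (simp add: fun_eq_iff)
  then show ?thesis using assms l2.add_left[of "a *\<^sub>R f" U "b *\<^sub>R g" h] l2.scale_left[of f U h a] l2.scale_left[of g U h b]
    l2.V_scale[of f U a] l2.V_scale[of g U b]
    by simp
qed

lemma L2_lincomb: "L2 U f \<Longrightarrow> L2 U g \<Longrightarrow> L2 U (\<lambda>x. a *\<^sub>R f x + b *\<^sub>R g x)"
  by (intro L2_add L2_scaleR)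

lemma l2_norm_nonneg [simp]: "l2_norm U f \<ge> 0"
  by (simp add: l2_norm_def l2_inner_def)

lemma l2_norm_sq: "(l2_norm U f)\<^sup>2 = l2_inner U f f"
  by (simp add: l2_norm_def l2_inner_def)

lemma l2_norm_triangle:
  assumes "L2 U f" "L2 U g"
  shows "l2_norm U (\<lambda>x. f x + g x) \<le> l2_norm U f + l2_norm U g"
  using l2.nrm_triangle[of f U g] assms by (simp add: plus_fun_def)

lemma l2_norm_triangle_diff:
  assumes "L2 U f" "L2 U g"
  shows "l2_norm U f \<le> l2_norm U (\<lambda>x. f x - g x) + l2_norm U g"
  using l2_norm_triangle[OF L2_diff[OF assms] assms(2)] by simp

lemma l2_norm_diff_commute: "l2_norm U (\<lambda>x. f x - g x) = l2_norm U (\<lambda>x. g x - f x)"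
  by (simp add: l2_norm_def l2_inner_def inner_diff_left inner_diff_right algebra_simps)

lemma l2_norm_scaleR: "l2_norm U (\<lambda>x. r *\<^sub>R f x) = \<bar>r\<bar> * l2_norm U f"
  by (simp add: l2_norm_def l2_inner_def real_sqrt_mult flip: mult.assoc power2_eq_square)

lemma l2_norm_mono:
  assumes "L2 U f" "L2 U g" "\<And>x. norm (f x) \<le> C * norm (g x)" "C \<ge> 0"
  shows "l2_norm U f \<le> C * l2_norm U g"
proof (rule power2_le_imp_le)
  have "l2_inner U f f \<le> C\<^sup>2 * l2_inner U g g"
  proof -
    have "l2_inner U f f \<le> (\<integral>x. C\<^sup>2 * (g x \<bullet> g x) \<partial>lebesgue_on U)"
      unfolding l2_inner_def
    proof (rule integral_mono)
      show "f x \<bullet> f x \<le> C\<^sup>2 * (g x \<bullet> g x)" for x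
        using power_mono[OF assms(3)[of x], of 2] by (simp add: power_mult_distrib power2_norm_eq_inner)
    qed (use assms in \<open>auto intro: L2_integrable_inner\<close>)
    then show ?thesis by (simp add: l2_inner_def)
  qed
  then show "(l2_norm U f)\<^sup>2 \<le> (C * l2_norm U g)\<^sup>2"
    by (simp add: power_mult_distrib l2_norm_sq)
qed (use assms in simp)

lemma l2_Cauchy_Schwarz:
  assumes "L2 U f" "L2 U g"
  shows "\<bar>l2_inner U f g\<bar> \<le> l2_norm U f * l2_norm U g"
  using l2.Cauchy_Schwarz[of f U g] assms by simp

lemma l2_inner_tendsto:
  assumes "\<And>n. L2 U (f n)" "L2 U g" "L2 U h" "(\<lambda>n. l2_norm U (\<lambda>x. f n x - g x)) \<longlonglongrightarrow> 0"
  shows "(\<lambda>n. l2_inner U (f n) h) \<longlonglongrightarrow> l2_inner U g h"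
proof -
  have "(\<lambda>n. l2_inner U (f n) h - l2_inner U g h) \<longlonglongrightarrow> 0"
  proof (rule Lim_null_comparison)
    show "(\<lambda>n. l2_norm U (\<lambda>x. f n x - g x) * l2_norm U h) \<longlonglongrightarrow> 0"
      using tendsto_mult_right[OF assms(4), of "l2_norm U h"] by simp
    show "\<forall>\<^sub>F n in sequentially. norm (l2_inner U (f n) h - l2_inner U g h) \<le> l2_norm U (\<lambda>x. f n x - g x) * l2_norm U h"
      using l2_Cauchy_Schwarz[OF L2_diff[OF assms(1,2)] assms(3)]
        l2_inner_lincomb[OF assms(1,2,3), where a = 1 and b = "- 1"]
      by (intro always_eventually allI) simp
  qed
  then show ?thesis by (simp add: LIM_zero_iff)
qed

lemma L2_subset:
  assumes "L2 U f" "V \<subseteq> U" "V \<in> sets lebesgue" "U \<in> sets lebesgue"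
  shows "L2 V f"
proof -
  have eq: "lebesgue_on V = restrict_space (lebesgue_on U) V"
    using assms(2-4) by (subst restrict_restrict_space) (auto simp: Int_absorb1)
  have V: "V \<inter> space (lebesgue_on U) \<in> sets (lebesgue_on U)"
    using assms by (auto simp: sets_restrict_space_iff Int_absorb2)
  have m: "f \<in> borel_measurable (lebesgue_on V)"
    unfolding eq by (rule measurable_restrict_space1[OF L2_measurable[OF assms(1)]])
  have "integrable (lebesgue_on U) (\<lambda>x. indicator V x *\<^sub>R (norm (f x))\<^sup>2)"
    using assms V by (intro integrable_mult_indicator) (auto simp: L2_def Int_absorb2)
  then show ?thesis
    using m V by (simp add: L2_def eq integrable_restrict_space)
qed

lemma integral_lebesgue_on_mono_support:
  fixes F :: "real^3 \<Rightarrow> real"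
  assumes "V \<subseteq> U" "V \<in> sets lebesgue" "U \<in> sets lebesgue" "\<And>x. x \<notin> V \<Longrightarrow> F x = 0"
  shows "(\<integral>x. F x \<partial>lebesgue_on V) = (\<integral>x. F x \<partial>lebesgue_on U)"
proof -
  have "indicator V x * F x = indicator U x * F x" for x
    using assms(1,4) by (cases "x \<in> V") (auto simp: indicator_def)
  then show ?thesis unfolding integral_lebesgue_on[OF assms(2)] integral_lebesgue_on[OF assms(3)] by presburger
qed

lemma integral_lebesgue_on_lborel:
  fixes F :: "real^3 \<Rightarrow> real"
  assumes "U \<in> sets lebesgue" "F \<in> borel_measurable borel" "\<And>x. x \<notin> U \<Longrightarrow> F x = 0"
  shows "(\<integral>x. F x \<partial>lebesgue_on U) = (\<integral>x. F x \<partial>lborel)"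
proof -
  have "(\<integral>x. F x \<partial>lebesgue_on U) = (\<integral>x. F x \<partial>lebesgue)"
    using integral_lebesgue_on_mono_support[of U UNIV F] assms by (simp add: lebesgue_on_UNIV_eq)
  also have "\<dots> = (\<integral>x. F x \<partial>lborel)" using assms(2) by (simp add: integral_completion)
  finally show ?thesis .
qed

section \<open>Test fields\<close>

lemma L2_bounded_continuous:
  fixes f :: "real^3 \<Rightarrow> 'b::euclidean_space"
  assumes "bounded U" "U \<in> sets lebesgue" "continuous_on UNIV f" "\<And>x. norm (f x) \<le> M"
  shows "L2 U f"
proof (rule L2_dominated)
  show "f \<in> borel_measurable (lebesgue_on U)"
    using assms(3) by (intro measurable_restrict_space1 measurable_completion) (simp add: borel_measurable_continuous_onI)
  show "L2 U (\<lambda>x. 1 :: real)" using assms by (intro L2_const)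
  show "norm (f x) \<le> M * norm (1 :: real)" for x using assms(4) by simp
qed

lemma test_fun_L2:
  fixes f :: "real^3 \<Rightarrow> real"
  assumes "bounded U" "U \<in> sets lebesgue" "test_fun V f"
  shows "L2 U f" "L2 U (pd j f)"
proof -
  obtain M where "\<And>x. \<bar>f x\<bar> \<le> M" "\<And>j x. \<bar>pd j f x\<bar> \<le> M"
    using assms(3) by (rule test_fun_bounds) blast
  then show "L2 U f" "L2 U (pd j f)"
    using assms by (auto intro!: L2_bounded_continuous[of _ _ M] test_fun_continuous test_fun_pd_continuous)
qed

lemma test_fun_bounded_linear: 
  assumes "bounded_linear L" "test_fun U f"
  shows "test_fun U (\<lambda>x. L (f x))"
proof -
  obtain C where C: "compact C" "C \<subseteq> U" "\<And>x. x \<notin> C \<Longrightarrow> f x = 0"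
    using assms(2) unfolding test_fun_def by auto
  then have "L (f x) = 0" if "x \<notin> C" for x
    using that linear_0[OF bounded_linear.linear[OF assms(1)]] by simp
  then show ?thesis
    using assms C unfolding test_fun_def by (blast intro: k_times_cont_diff_bounded_linear)
qed

lemma test_fun_add: 
  assumes "test_fun U f" "test_fun U g"
  shows "test_fun U (\<lambda>x. f x + g x)"
proof -
  obtain C where C: "compact C" "C \<subseteq> U" "\<And>x. x \<notin> C \<Longrightarrow> f x = 0"
    using assms(1) unfolding test_fun_def by auto
  obtain D where D: "compact D" "D \<subseteq> U" "\<And>x. x \<notin> D \<Longrightarrow> g x = 0"
    using assms(2) unfolding test_fun_def by auto
  show ?thesis
    unfolding test_fun_def
  proof (intro conjI allI exI[of _ "C \<union> D"] impI)
    show "k_times_cont_diff k (\<lambda>x. f x + g x)" for k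
      using assms by (intro k_times_cont_diff_add) (auto simp: test_fun_def)
  qed (use C D in auto)
qed

lemma test_fun_zero [simp]: "test_fun U (\<lambda>x. 0)"
  unfolding test_fun_def by (auto intro!: k_times_cont_diff_const exI[of _ "{}"])

lemma test_fun_lincomb:
  assumes "test_fun U f" "test_fun U g"
  shows "test_fun U (\<lambda>x. a *\<^sub>R f x + b *\<^sub>R g x)"
  using assms by (intro test_fun_add test_fun_bounded_linear[OF bounded_linear_scaleR_right])

lemma test_fun_component: "test_fun U (\<phi> :: real^3 \<Rightarrow> real^3) \<Longrightarrow> test_fun U (\<lambda>x. \<phi> x $ i)"
  by (rule test_fun_bounded_linear[OF bounded_linear_vec_nth])

lemma jac_component:
  assumes "test_fun U \<phi>"
  shows "jac \<phi> x $ i $ j = pd j (\<lambda>x. \<phi> x $ i) x"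
proof -
  have "(\<phi> has_derivative frechet_derivative \<phi> (at x)) (at x)"
    using test_fun_differentiable[OF assms] frechet_derivative_works by blast
  then have "((\<lambda>x. \<phi> x $ i) has_derivative (\<lambda>v. frechet_derivative \<phi> (at x) v $ i)) (at x)"
    by (rule bounded_linear.has_derivative[OF bounded_linear_vec_nth])
  then show ?thesis by (simp add: pd_def frechet_derivative_eqI jac_def jacobian_def matrix_def)
qed

lemma pd_lincomb:
  assumes "test_fun U f" "test_fun U g"
  shows "pd j (\<lambda>x. a * f x + b * g x) x = a * pd j f x + b * pd j g x"
proof -
  have "((\<lambda>x. a * f x + b * g x) has_derivative
     (\<lambda>v. a * frechet_derivative f (at x) v + b * frechet_derivative g (at x) v)) (at x)"
    using test_fun_differentiable[OF assms(1)] test_fun_differentiable[OF assms(2)] frechet_derivative_works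
    by (intro has_derivative_add has_derivative_mult_right) blast+
  then show ?thesis by (simp add: pd_def frechet_derivative_eqI)
qed

lemma jac_lincomb:
  assumes "test_fun U \<phi>" "test_fun U \<psi>"
  shows "jac (\<lambda>x. a *\<^sub>R \<phi> x + b *\<^sub>R \<psi> x) x = a *\<^sub>R jac \<phi> x + b *\<^sub>R jac \<psi> x"
  using assms
  by (simp add: vec_eq_iff jac_component[OF test_fun_lincomb[OF assms]] jac_component[OF assms(1)]
      jac_component[OF assms(2)] pd_lincomb[OF test_fun_component test_fun_component])

lemma L2_vec:
  fixes f :: "real^3 \<Rightarrow> ('b::euclidean_space)^3"
  assumes "\<And>i. L2 U (\<lambda>x. f x $ i)"
  shows "L2 U f"
proof -
  have "L2 U (\<lambda>x. axis i (f x $ i) :: 'b^3)" for i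
    by (rule L2_bounded_linear[OF _ assms])
       (simp add: linear_iff axis_def vec_eq_iff)
  then have "L2 U (\<lambda>x. axis 1 (f x $ 1) + axis 2 (f x $ 2) + axis 3 (f x $ 3) :: 'b^3)"
    by (intro L2_add)
  moreover have "axis 1 (f x $ 1) + axis 2 (f x $ 2) + axis 3 (f x $ 3) = f x" for x
    by (simp add: vec_eq_iff forall_3 axis_def)
  ultimately show ?thesis by simp
qed

lemma test_field_L2:
  assumes "bounded U" "U \<in> sets lebesgue" "test_fun V \<phi>"
  shows "L2 U (\<phi> :: vfield)" "L2 U (jac \<phi>)"
  using test_fun_L2[OF assms(1,2) test_fun_component[OF assms(3)]]
  by (auto intro!: L2_vec simp: jac_component[OF assms(3)])

section \<open>Symmetric part and trace\<close>

definition symm :: "real^3^3 \<Rightarrow> real^3^3" where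
  "symm A = (1/2) *\<^sub>R (A + transpose A)"

lemma linear_symm: "linear symm"
  by (simp add: linear_iff symm_def transpose_def vec_eq_iff algebra_simps)

lemma linear_trace: "linear (trace :: real^3^3 \<Rightarrow> real)"
  by (simp add: linear_iff trace_add trace_def sum_distrib_left sum.distrib)

lemma inner_transpose: "transpose A \<bullet> B = A \<bullet> transpose (B :: real^3^3)"
  unfolding inner_vec_def transpose_def by (simp add: sum_3)

lemma inner_mat_1: "mat 1 \<bullet> (A :: real^3^3) = trace A"
  by (simp add: inner_vec_def trace_def mat_def sum_3)

lemma trace_symm [simp]: "trace (symm A) = trace A"
  by (simp add: trace_def symm_def transpose_def)

text \<open>A symmetric matrix is orthogonal to the antisymmetric part of \<open>B\<close>; this
  lets L(\<xi>) : D(\<eta>) and L(\<xi>) : \<nabla>\<eta> be exchanged.\<close>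

lemma symm_inner:
  assumes "transpose A = A"
  shows "A \<bullet> symm B = A \<bullet> B"
  using inner_transpose[of A B] assms by (simp add: symm_def inner_add_right)

lemma norm_transpose: "norm (transpose A) = norm (A :: real^3^3)"
  using inner_transpose[of A "transpose A"] by (simp add: norm_eq_sqrt_inner)

lemma norm_symm_le: "norm (symm A) \<le> 1 * norm A"
  using norm_triangle_ineq[of A "transpose A"] by (simp add: symm_def norm_transpose)

text \<open>The trace is the inner product with the identity, whose norm, the square root of 3, is
  rounded up to 2.\<close>

lemma norm_trace_le: "norm (trace A) \<le> 2 * norm (A :: real^3^3)"
proof -
  have "\<bar>trace A\<bar> \<le> norm (mat 1 :: real^3^3) * norm A"
    using Cauchy_Schwarz_ineq2[of "mat 1" A] by (simp add: inner_mat_1)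
  also have "norm (mat 1 :: real^3^3) \<le> 2"
    by (simp add: norm_eq_sqrt_inner inner_mat_1 trace_I real_le_lsqrt)
  finally show ?thesis by (simp add: mult_right_mono)
qed

text \<open>The pointwise identity behind Korn's inequality: after integration the last term has a
  sign for test fields.\<close>

lemma symm_norm_sq: "2 * (symm A \<bullet> symm A) = A \<bullet> A + A \<bullet> transpose A"
  using inner_transpose[of A A] inner_transpose[of A "transpose A"]
  by (simp add: symm_def inner_add_left inner_add_right add_divide_distrib)

section \<open>Weak gradients\<close>

text \<open>Written as inner products with fixed fields, the definition becomes accessible to the
  linearity and limit lemmas for \<open>l2_inner\<close>.\<close>

lemma has_weak_grad_iff:
  "has_weak_grad U f G \<longleftrightarrow> L2 U f \<and> L2 U G \<and> (\<forall>\<phi>. test_fun U \<phi> \<longrightarrow>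
     (\<forall>i j. l2_inner U f (\<lambda>x. pd j \<phi> x *\<^sub>R axis i 1) = - l2_inner U G (\<lambda>x. \<phi> x *\<^sub>R axis i (axis j 1))))"
  unfolding has_weak_grad_def l2_inner_def
  by (simp add: inner_axis grad_def pd_def mult.commute)

locale bounded_open =
  fixes U :: "(real^3) set"
  assumes open_U: "open U" and bounded_U: "bounded U"
begin

lemma sets_U [simp]: "U \<in> sets lebesgue"
  using open_U by (simp add: borel_open)

lemma test_L2_axis:
  assumes "test_fun V \<phi>"
  shows "L2 U (\<lambda>x. pd j \<phi> x *\<^sub>R (c :: 'b::euclidean_space))" "L2 U (\<lambda>x. \<phi> x *\<^sub>R c)"
  using test_fun_L2[OF bounded_U sets_U assms]
  by (auto intro!: L2_bounded_linear[where L = "\<lambda>r. r *\<^sub>R c"] simp: linear_iff algebra_simps)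

lemma has_weak_grad_lincomb:
  assumes "has_weak_grad U f F" "has_weak_grad U g G"
  shows "has_weak_grad U (\<lambda>x. a *\<^sub>R f x + b *\<^sub>R g x) (\<lambda>x. a *\<^sub>R F x + b *\<^sub>R G x)"
  using assms unfolding has_weak_grad_iff
  by (auto simp: l2_inner_lincomb test_L2_axis[where V = U] intro!: L2_lincomb)

lemma has_weak_grad_AE_zero:
  assumes "AE x in lebesgue_on U. f x = 0"
  shows "has_weak_grad U f (\<lambda>x. 0)"
  unfolding has_weak_grad_iff
proof (intro conjI allI impI)
  show "L2 U f" using assms sets_U by (rule L2_AE_zero)
  fix \<phi> :: "real^3 \<Rightarrow> real" and i j assume "test_fun U \<phi>"
  have "l2_inner U f (\<lambda>x. pd j \<phi> x *\<^sub>R axis i 1) = l2_inner U (\<lambda>x. 0 :: real^3) (\<lambda>x. pd j \<phi> x *\<^sub>R axis i 1)"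
    by (rule l2_inner_AE_cong[OF _ _ \<open>L2 U f\<close> L2_0])
       (use assms test_L2_axis(1)[OF \<open>test_fun U \<phi>\<close>] in auto)
  then show "l2_inner U f (\<lambda>x. pd j \<phi> x *\<^sub>R axis i 1) = - l2_inner U (\<lambda>x. 0) (\<lambda>x. \<phi> x *\<^sub>R axis i (axis j 1))"
    by (simp add: l2_inner_def)
qed simp

lemma has_weak_grad_zero: "has_weak_grad U (\<lambda>x. 0) G \<Longrightarrow> AE x in lebesgue_on U. G x = 0"
proof -
  assume G: "has_weak_grad U (\<lambda>x. 0) G"
  then have GL: "L2 U G" by (simp add: has_weak_grad_iff)
  have "AE x in lebesgue_on U. G x $ i $ j = 0" for i j
  proof (rule fundamental_lemma[OF open_U])
    have "L2 U (\<lambda>x. G x $ i $ j)"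
      by (rule L2_bounded_linear[OF _ GL]) (simp add: linear_iff)
    then show "integrable (lebesgue_on U) (\<lambda>x. G x $ i $ j)" by (rule L2_integrable[OF bounded_U sets_U])
    fix \<phi> :: "real^3 \<Rightarrow> real" assume "test_fun U \<phi>"
    then show "(\<integral>x. G x $ i $ j * \<phi> x \<partial>lebesgue_on U) = 0" using G by (simp add: has_weak_grad_def)
  qed
  then have "AE x in lebesgue_on U. \<forall>i\<in>UNIV. \<forall>j\<in>UNIV. G x $ i $ j = 0"
    by (intro eventually_ball_finite ballI) auto
  then show ?thesis by eventually_elim (simp add: vec_eq_iff)
qed

text \<open>\<open>wgrad\<close> is an arbitrary choice among weak gradients; this lemma is what
  allows computing with it, always up to null sets.\<close>

lemma has_weak_grad_unique:
  assumes "has_weak_grad U f F" "has_weak_grad U f G"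
  shows "AE x in lebesgue_on U. F x = G x"
proof -
  have "has_weak_grad U (\<lambda>x. 0) (\<lambda>x. F x - G x)"
    using has_weak_grad_lincomb[OF assms, of 1 "- 1"] by simp
  from has_weak_grad_zero[OF this] show ?thesis by eventually_elim simp
qed

lemma has_weak_grad_wgrad: "H1 U f \<Longrightarrow> has_weak_grad U f (wgrad U f)"
  unfolding H1_def wgrad_def using someI_ex[of "has_weak_grad U f"] by simp

lemma wgrad_AE_eq: "has_weak_grad U f G \<Longrightarrow> AE x in lebesgue_on U. wgrad U f x = G x"
  by (rule has_weak_grad_unique[OF has_weak_grad_wgrad]) (auto simp: H1_def)

lemma H1_L2: "H1 U f \<Longrightarrow> L2 U f" and wgrad_L2: "H1 U f \<Longrightarrow> L2 U (wgrad U f)"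
  using has_weak_grad_wgrad by (auto simp: has_weak_grad_def)

lemma H1_lincomb: "H1 U f \<Longrightarrow> H1 U g \<Longrightarrow> H1 U (\<lambda>x. a *\<^sub>R f x + b *\<^sub>R g x)"
  unfolding H1_def by (blast intro: has_weak_grad_lincomb)

lemma wgrad_lincomb:
  assumes "H1 U f" "H1 U g"
  shows "AE x in lebesgue_on U. wgrad U (\<lambda>x. a *\<^sub>R f x + b *\<^sub>R g x) x = a *\<^sub>R wgrad U f x + b *\<^sub>R wgrad U g x"
  using assms by (intro wgrad_AE_eq has_weak_grad_lincomb has_weak_grad_wgrad)

lemma H1_AE_zero: "AE x in lebesgue_on U. f x = 0 \<Longrightarrow> H1 U f"
  unfolding H1_def using has_weak_grad_AE_zero by blast

lemma wgrad_AE_zero: "AE x in lebesgue_on U. f x = 0 \<Longrightarrow> AE x in lebesgue_on U. wgrad U f x = 0"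
  by (rule wgrad_AE_eq[OF has_weak_grad_AE_zero])

lemma sgrad_eq: "sgrad U f x = symm (wgrad U f x)"
  by (simp add: sgrad_def symm_def)

lemma sgrad_L2: "H1 U f \<Longrightarrow> L2 U (sgrad U f)"
  unfolding sgrad_eq[abs_def] by (intro L2_bounded_linear[OF linear_symm] wgrad_L2)

lemma wdiv_L2: "H1 U f \<Longrightarrow> L2 U (wdiv U f)"
  unfolding wdiv_def[abs_def] by (intro L2_bounded_linear[OF linear_trace] wgrad_L2)

lemma sgrad_lincomb:
  assumes "H1 U f" "H1 U g"
  shows "AE x in lebesgue_on U. sgrad U (\<lambda>x. a *\<^sub>R f x + b *\<^sub>R g x) x = a *\<^sub>R sgrad U f x + b *\<^sub>R sgrad U g x"
  using wgrad_lincomb[OF assms, of a b] by eventually_elim (simp add: sgrad_eq linear_add[OF linear_symm] linear_scale[OF linear_symm])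

lemma wdiv_lincomb:
  assumes "H1 U f" "H1 U g"
  shows "AE x in lebesgue_on U. wdiv U (\<lambda>x. a *\<^sub>R f x + b *\<^sub>R g x) x = a *\<^sub>R wdiv U f x + b *\<^sub>R wdiv U g x"
  using wgrad_lincomb[OF assms, of a b] by eventually_elim (simp only: wdiv_def linear_add[OF linear_trace] linear_scale[OF linear_trace])

text \<open>Test functions on the smaller set are already defined everywhere and vanish off a
  compact subset, so they are test functions on \<open>U\<close> with the same integrals. This
  passes from \<Omega> to its solid and fluid parts.\<close>

lemma has_weak_grad_restrict:
  assumes f: "has_weak_grad U f G" and V: "V \<subseteq> U" "open V"
  shows "has_weak_grad V f G"
  unfolding has_weak_grad_def
proof (intro conjI allI impI)
  have VM: "V \<in> sets lebesgue" using V(2) by (simp add: borel_open)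
  show "L2 V f" "L2 V G" using f V VM by (auto simp: has_weak_grad_def intro: L2_subset)
  fix \<phi> :: "real^3 \<Rightarrow> real" and i j assume \<phi>: "test_fun V \<phi>"
  obtain C where C: "compact C" "C \<subseteq> V" "\<And>x. x \<notin> C \<Longrightarrow> \<phi> x = 0" "\<And>j x. x \<notin> C \<Longrightarrow> pd j \<phi> x = 0"
    using \<phi> by (rule test_fun_bounds) blast
  have g: "grad \<phi> x $ j = pd j \<phi> x" for x by (simp add: grad_def pd_def)
  have "(\<integral>x. f x $ i * grad \<phi> x $ j \<partial>lebesgue_on V) = (\<integral>x. f x $ i * grad \<phi> x $ j \<partial>lebesgue_on U)"
    using C V VM by (intro integral_lebesgue_on_mono_support) (auto simp: g subset_iff)
  moreover have "(\<integral>x. G x $ i $ j * \<phi> x \<partial>lebesgue_on V) = (\<integral>x. G x $ i $ j * \<phi> x \<partial>lebesgue_on U)"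
    using C V VM by (intro integral_lebesgue_on_mono_support) (auto simp: subset_iff)
  ultimately show "(\<integral>x. f x $ i * grad \<phi> x $ j \<partial>lebesgue_on V) = - (\<integral>x. G x $ i $ j * \<phi> x \<partial>lebesgue_on V)"
    using f test_fun_mono[OF \<phi> V(1)] by (simp add: has_weak_grad_def)
qed

text \<open>The weak gradient is a closed operator: its defining identities are inner products with
  fixed L^2 fields and pass to the limit.\<close>

lemma has_weak_grad_limit:
  assumes fn: "\<And>n. has_weak_grad U (f n) (F n)" and L: "L2 U g" "L2 U G"
    and lim: "(\<lambda>n. l2_norm U (\<lambda>x. f n x - g x)) \<longlonglongrightarrow> 0" "(\<lambda>n. l2_norm U (\<lambda>x. F n x - G x)) \<longlonglongrightarrow> 0"
  shows "has_weak_grad U g G"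
  unfolding has_weak_grad_iff
proof (intro conjI allI impI L)
  fix \<phi> :: "real^3 \<Rightarrow> real" and i j assume \<phi>: "test_fun U \<phi>"
  have "(\<lambda>n. l2_inner U (f n) (\<lambda>x. pd j \<phi> x *\<^sub>R axis i 1)) \<longlonglongrightarrow> l2_inner U g (\<lambda>x. pd j \<phi> x *\<^sub>R axis i 1)"
    using fn L lim \<phi> by (intro l2_inner_tendsto test_L2_axis) (auto simp: has_weak_grad_iff)
  moreover have "(\<lambda>n. - l2_inner U (F n) (\<lambda>x. \<phi> x *\<^sub>R axis i (axis j 1))) \<longlonglongrightarrow> - l2_inner U G (\<lambda>x. \<phi> x *\<^sub>R axis i (axis j 1))"
    using fn L lim \<phi> by (intro tendsto_minus l2_inner_tendsto test_L2_axis) (auto simp: has_weak_grad_iff)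
  moreover have "l2_inner U (f n) (\<lambda>x. pd j \<phi> x *\<^sub>R axis i 1) = - l2_inner U (F n) (\<lambda>x. \<phi> x *\<^sub>R axis i (axis j 1))" for n
    using fn \<phi> by (simp add: has_weak_grad_iff)
  ultimately show "l2_inner U g (\<lambda>x. pd j \<phi> x *\<^sub>R axis i 1) = - l2_inner U G (\<lambda>x. \<phi> x *\<^sub>R axis i (axis j 1))"
    using LIMSEQ_unique by simp
qed

section \<open>Fields vanishing on the boundary\<close>

text \<open>Exchanging the two partial derivatives, one on each factor, turns the integral of
  \<nabla>\<phi> : \<nabla>\<phi>^T into that of (div \<phi>)^2, which explains the sign.\<close>

lemma test_field_integrals:
  assumes \<phi>: "test_fun U \<phi>"
  shows "(\<integral>x. trace (jac \<phi> x) \<partial>lebesgue_on U) = 0"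
    and "l2_inner U (jac \<phi>) (\<lambda>x. transpose (jac \<phi> x)) \<ge> 0"
proof -
  let ?f = "\<lambda>i x. \<phi> x $ i"
  have f: "test_fun U (?f i)" for i using \<phi> by (rule test_fun_component)
  have fU: "test_fun UNIV (?f i)" for i using f by (rule test_fun_mono) simp
  have [measurable]: "pd j (?f i) \<in> borel_measurable borel" for i j
    using test_fun_pd_continuous[OF f] by (rule borel_measurable_continuous_onI)
  have L: "L2 U (pd j (?f i))" for i j using test_fun_L2(2)[OF bounded_U sets_U f] .
  have int1: "integrable (lebesgue_on U) (pd j (?f i))" for i j by (rule L2_integrable[OF bounded_U sets_U L])
  have int2: "integrable (lebesgue_on U) (\<lambda>x. pd j (?f i) x * pd k (?f l) x)" for i j k l
    using L2_integrable_inner[OF L L] by simp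
  have out: "pd j (?f i) x = 0" if "x \<notin> U" for i j x
    using f[of i] by (rule test_fun_bounds) (use that in blast)
  show "(\<integral>x. trace (jac \<phi> x) \<partial>lebesgue_on U) = 0"
  proof -
    have "(\<integral>x. trace (jac \<phi> x) \<partial>lebesgue_on U) = (\<Sum>i\<in>UNIV. \<integral>x. pd i (?f i) x \<partial>lebesgue_on U)"
      using int1 by (simp add: trace_def jac_component[OF \<phi>])
    also have "\<dots> = (\<Sum>i\<in>UNIV. \<integral>x. pd i (?f i) x \<partial>lborel)"
      by (intro sum.cong refl integral_lebesgue_on_lborel out) auto
    finally show ?thesis using integral_pd[OF fU] by simp
  qed
  have sw: "(\<integral>x. pd j (?f i) x * pd i (?f j) x \<partial>lebesgue_on U) = (\<integral>x. pd i (?f i) x * pd j (?f j) x \<partial>lebesgue_on U)" for i j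
    using integral_pd_mult_swap[OF fU[of i] fU[of j], of j i]
    by (subst (1 2) integral_lebesgue_on_lborel) (auto simp: out)
  have "l2_inner U (jac \<phi>) (\<lambda>x. transpose (jac \<phi> x)) = (\<integral>x. (\<Sum>i\<in>UNIV. \<Sum>j\<in>UNIV. pd j (?f i) x * pd i (?f j) x) \<partial>lebesgue_on U)"
    by (simp add: l2_inner_def inner_vec_def transpose_def jac_component[OF \<phi>])
  also have "\<dots> = (\<Sum>i\<in>UNIV. \<Sum>j\<in>UNIV. \<integral>x. pd j (?f i) x * pd i (?f j) x \<partial>lebesgue_on U)"
    using int2 by simp
  also have "\<dots> = (\<Sum>i\<in>UNIV. \<Sum>j\<in>UNIV. \<integral>x. pd i (?f i) x * pd j (?f j) x \<partial>lebesgue_on U)"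
    by (simp only: sw)
  also have "\<dots> = (\<integral>x. (\<Sum>i\<in>UNIV. \<Sum>j\<in>UNIV. pd i (?f i) x * pd j (?f j) x) \<partial>lebesgue_on U)"
    using int2 by simp
  also have "\<dots> = (\<integral>x. (trace (jac \<phi> x))\<^sup>2 \<partial>lebesgue_on U)"
    by (simp add: trace_def jac_component[OF \<phi>] power2_eq_square sum_product)
  also have "\<dots> \<ge> 0" by simp
  finally show "l2_inner U (jac \<phi>) (\<lambda>x. transpose (jac \<phi> x)) \<ge> 0" .
qed

text \<open>Integrating \<open>symm_norm_sq\<close> and dropping the nonnegative term gives the
  factor 2 for the squares; the constant 2 for the norms is a convenient enlargement of its square
  root.\<close>

lemma Korn_test_field:
  assumes \<phi>: "test_fun U \<phi>"
  shows "l2_norm U (jac \<phi>) \<le> 2 * l2_norm U (\<lambda>x. symm (jac \<phi> x))"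
proof (rule power2_le_imp_le)
  have L: "L2 U (jac \<phi>)" using test_field_L2(2)[OF bounded_U sets_U \<phi>] .
  have Ls: "L2 U (\<lambda>x. symm (jac \<phi> x))" by (rule L2_bounded_linear[OF linear_symm L])
  have Lt: "L2 U (\<lambda>x. transpose (jac \<phi> x))"
    by (rule L2_bounded_linear[OF _ L]) (simp add: linear_iff transpose_def vec_eq_iff)
  have "2 * l2_inner U (\<lambda>x. symm (jac \<phi> x)) (\<lambda>x. symm (jac \<phi> x)) =
      (\<integral>x. 2 * (symm (jac \<phi> x) \<bullet> symm (jac \<phi> x)) \<partial>lebesgue_on U)"
    by (simp add: l2_inner_def)
  also have "\<dots> = l2_inner U (jac \<phi>) (jac \<phi>) + l2_inner U (jac \<phi>) (\<lambda>x. transpose (jac \<phi> x))"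
    unfolding symm_norm_sq l2_inner_def
    by (intro Bochner_Integration.integral_add L2_integrable_inner L Lt)
  finally have "l2_inner U (jac \<phi>) (jac \<phi>) \<le> 2 * l2_inner U (\<lambda>x. symm (jac \<phi> x)) (\<lambda>x. symm (jac \<phi> x))"
    using test_field_integrals(2)[OF \<phi>] by linarith
  moreover have "l2_inner U (\<lambda>x. symm (jac \<phi> x)) (\<lambda>x. symm (jac \<phi> x)) \<ge> 0"
    by (simp add: l2_inner_def)
  ultimately show "(l2_norm U (jac \<phi>))\<^sup>2 \<le> (2 * l2_norm U (\<lambda>x. symm (jac \<phi> x)))\<^sup>2"
    by (simp add: power_mult_distrib l2_norm_sq)
qed simp

lemma H10_H1: "H10 U f \<Longrightarrow> H1 U f"
  by (simp add: H10_def)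

theorem Korn_H10:
  assumes "H10 U f"
  shows "l2_norm U (wgrad U f) \<le> 2 * l2_norm U (sgrad U f)"
proof -
  obtain \<phi> where \<phi>: "\<And>n. test_fun U (\<phi> n)" "h1_converges U \<phi> f" using assms by (auto simp: H10_def)
  note H = H10_H1[OF assms]
  note Lw = wgrad_L2[OF H] and Ls = sgrad_L2[OF H]
  define d where "d n = l2_norm U (\<lambda>x. jac (\<phi> n) x - wgrad U f x)" for n
  have d: "d \<longlonglongrightarrow> 0" using \<phi>(2) by (simp add: h1_converges_def d_def[abs_def])
  \<comment> \<open>One \<open>d n\<close> is the price of replacing \<open>wgrad\<close> by the
    Jacobian of a test field, two more that of going back on the symmetric parts, where Korn's
    factor 2 enters.\<close>
  have le: "l2_norm U (wgrad U f) \<le> 3 * d n + 2 * l2_norm U (sgrad U f)" for n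
  proof -
    have Lj: "L2 U (jac (\<phi> n))" using test_field_L2(2)[OF bounded_U sets_U \<phi>(1)] .
    have Lsj: "L2 U (\<lambda>x. symm (jac (\<phi> n) x))" by (rule L2_bounded_linear[OF linear_symm Lj])
    have "l2_norm U (\<lambda>x. symm (jac (\<phi> n) x) - sgrad U f x) \<le> 1 * d n"
      unfolding d_def
    proof (rule l2_norm_mono)
      show "norm (symm (jac (\<phi> n) x) - sgrad U f x) \<le> 1 * norm (jac (\<phi> n) x - wgrad U f x)" for x
        unfolding sgrad_eq linear_diff[OF linear_symm, symmetric] by (rule norm_symm_le)
    qed (auto intro: L2_diff Lsj Ls Lj Lw)
    moreover have "l2_norm U (\<lambda>x. symm (jac (\<phi> n) x)) \<le> l2_norm U (\<lambda>x. symm (jac (\<phi> n) x) - sgrad U f x) + l2_norm U (sgrad U f)"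
      by (rule l2_norm_triangle_diff[OF Lsj Ls])
    moreover have "l2_norm U (wgrad U f) \<le> l2_norm U (\<lambda>x. wgrad U f x - jac (\<phi> n) x) + l2_norm U (jac (\<phi> n))"
      by (rule l2_norm_triangle_diff[OF Lw Lj])
    moreover have "l2_norm U (\<lambda>x. wgrad U f x - jac (\<phi> n) x) = d n"
      unfolding d_def by (rule l2_norm_diff_commute)
    ultimately show ?thesis using Korn_test_field[OF \<phi>(1), of n] by linarith
  qed
  have "(\<lambda>n. 3 * d n + 2 * l2_norm U (sgrad U f)) \<longlonglongrightarrow> 3 * 0 + 2 * l2_norm U (sgrad U f)"
    by (intro tendsto_intros d)
  then show ?thesis using le by (intro LIMSEQ_le_const[of "\<lambda>n. 3 * d n + 2 * l2_norm U (sgrad U f)"]) auto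
qed

lemma integral_wdiv_eq:
  shows "(\<integral>x. wdiv U f x \<partial>lebesgue_on U) = l2_inner U (wgrad U f) (\<lambda>x. mat 1)"
  by (simp add: l2_inner_def wdiv_def inner_mat_1 inner_commute[of _ "mat 1"])

text \<open>As an inner product of the gradient with the constant identity matrix, the integral is
  continuous in H^1, and it vanishes on test fields.\<close>

lemma integral_wdiv_H10:
  assumes "H10 U f"
  shows "(\<integral>x. wdiv U f x \<partial>lebesgue_on U) = 0"
proof -
  obtain \<phi> where \<phi>: "\<And>n. test_fun U (\<phi> n)" "h1_converges U \<phi> f" using assms by (auto simp: H10_def)
  have "(\<lambda>n. l2_inner U (jac (\<phi> n)) (\<lambda>x. mat 1)) \<longlonglongrightarrow> l2_inner U (wgrad U f) (\<lambda>x. mat 1)"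
    using \<phi> by (intro l2_inner_tendsto test_field_L2(2)[OF bounded_U sets_U] wgrad_L2 H10_H1 assms L2_const bounded_U sets_U)
      (auto simp: h1_converges_def)
  moreover have "l2_inner U (jac (\<phi> n)) (\<lambda>x. mat 1) = 0" for n
    using test_field_integrals(1)[OF \<phi>(1)] by (simp add: l2_inner_def inner_mat_1 inner_commute[of _ "mat 1"])
  ultimately show ?thesis by (simp add: integral_wdiv_eq LIMSEQ_const_iff)
qed

lemma H10_lincomb:
  assumes f: "H10 U f" and g: "H10 U g"
  shows "H10 U (\<lambda>x. a *\<^sub>R f x + b *\<^sub>R g x)"
proof -
  obtain \<phi> where \<phi>: "\<And>n. test_fun U (\<phi> n)" "h1_converges U \<phi> f" using f by (auto simp: H10_def)
  obtain \<psi> where \<psi>: "\<And>n. test_fun U (\<psi> n)" "h1_converges U \<psi> g" using g by (auto simp: H10_def)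
  note H = H10_H1[OF f] H10_H1[OF g]
  have comb: "(\<lambda>n. l2_norm U (\<lambda>x. (a *\<^sub>R p n x + b *\<^sub>R q n x) - (a *\<^sub>R p' x + b *\<^sub>R q' x))) \<longlonglongrightarrow> 0"
    if "\<And>n. L2 U (p n)" "\<And>n. L2 U (q n)" "L2 U p'" "L2 U q'"
      "(\<lambda>n. l2_norm U (\<lambda>x. p n x - p' x)) \<longlonglongrightarrow> 0" "(\<lambda>n. l2_norm U (\<lambda>x. q n x - q' x)) \<longlonglongrightarrow> 0"
    for p q :: "nat \<Rightarrow> real^3 \<Rightarrow> 'b::euclidean_space" and p' q'
  proof (rule Lim_null_comparison)
    have "(\<lambda>n. \<bar>a\<bar> * l2_norm U (\<lambda>x. p n x - p' x) + \<bar>b\<bar> * l2_norm U (\<lambda>x. q n x - q' x)) \<longlonglongrightarrow> \<bar>a\<bar> * 0 + \<bar>b\<bar> * 0"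
      by (intro tendsto_intros that)
    then show "(\<lambda>n. \<bar>a\<bar> * l2_norm U (\<lambda>x. p n x - p' x) + \<bar>b\<bar> * l2_norm U (\<lambda>x. q n x - q' x)) \<longlonglongrightarrow> 0" by simp
    show "\<forall>\<^sub>F n in sequentially. norm (l2_norm U (\<lambda>x. (a *\<^sub>R p n x + b *\<^sub>R q n x) - (a *\<^sub>R p' x + b *\<^sub>R q' x)))
       \<le> \<bar>a\<bar> * l2_norm U (\<lambda>x. p n x - p' x) + \<bar>b\<bar> * l2_norm U (\<lambda>x. q n x - q' x)"
    proof (intro always_eventually allI)
      fix n
      have eq: "(\<lambda>x. (a *\<^sub>R p n x + b *\<^sub>R q n x) - (a *\<^sub>R p' x + b *\<^sub>R q' x)) = (\<lambda>x. a *\<^sub>R (p n x - p' x) + b *\<^sub>R (q n x - q' x))"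
        by (simp add: fun_eq_iff algebra_simps)
      show "norm (l2_norm U (\<lambda>x. (a *\<^sub>R p n x + b *\<^sub>R q n x) - (a *\<^sub>R p' x + b *\<^sub>R q' x)))
       \<le> \<bar>a\<bar> * l2_norm U (\<lambda>x. p n x - p' x) + \<bar>b\<bar> * l2_norm U (\<lambda>x. q n x - q' x)"
        unfolding eq
        using l2_norm_triangle[OF L2_scaleR[OF L2_diff[OF that(1,3)]] L2_scaleR[OF L2_diff[OF that(2,4)]], of a n b n]
        by (simp add: l2_norm_scaleR)
    qed
  qed
  let ?\<chi> = "\<lambda>n x. a *\<^sub>R \<phi> n x + b *\<^sub>R \<psi> n x"
  have "test_fun U (?\<chi> n)" for n using \<phi> \<psi> by (intro test_fun_lincomb)
  moreover have "h1_converges U ?\<chi> (\<lambda>x. a *\<^sub>R f x + b *\<^sub>R g x)"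
    unfolding h1_converges_def
  proof
    show "(\<lambda>n. l2_norm U (\<lambda>x. ?\<chi> n x - (a *\<^sub>R f x + b *\<^sub>R g x))) \<longlonglongrightarrow> 0"
      using \<phi> \<psi> H by (intro comb test_field_L2[OF bounded_U sets_U] H1_L2) (auto simp: h1_converges_def)
    have "l2_norm U (\<lambda>x. jac (?\<chi> n) x - wgrad U (\<lambda>x. a *\<^sub>R f x + b *\<^sub>R g x) x) =
        l2_norm U (\<lambda>x. (a *\<^sub>R jac (\<phi> n) x + b *\<^sub>R jac (\<psi> n) x) - (a *\<^sub>R wgrad U f x + b *\<^sub>R wgrad U g x))" for n
    proof -
      have Lj: "L2 U (jac (\<phi> n))" "L2 U (jac (\<psi> n))" "L2 U (jac (?\<chi> n))"
        using \<phi> \<psi> by (auto intro!: test_field_L2[OF bounded_U sets_U] test_fun_lincomb)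
      have AE: "AE x in lebesgue_on U. jac (?\<chi> n) x - wgrad U (\<lambda>x. a *\<^sub>R f x + b *\<^sub>R g x) x =
         (a *\<^sub>R jac (\<phi> n) x + b *\<^sub>R jac (\<psi> n) x) - (a *\<^sub>R wgrad U f x + b *\<^sub>R wgrad U g x)"
        using wgrad_lincomb[OF H, of a b] by eventually_elim (simp add: jac_lincomb[OF \<phi>(1) \<psi>(1)])
      show ?thesis
        unfolding l2_norm_def
        by (intro arg_cong[where f = sqrt] l2_inner_AE_cong AE L2_diff L2_lincomb Lj wgrad_L2 H H1_lincomb)
    qed
    then show "(\<lambda>n. l2_norm U (\<lambda>x. jac (?\<chi> n) x - wgrad U (\<lambda>x. a *\<^sub>R f x + b *\<^sub>R g x) x)) \<longlonglongrightarrow> 0"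
      using \<phi> \<psi> H by (simp only:) (intro comb test_field_L2[OF bounded_U sets_U] wgrad_L2, auto simp: h1_converges_def)
  qed
  ultimately show ?thesis
    using H1_lincomb[OF H] unfolding H10_def by (intro conjI exI[of _ ?\<chi>]) auto
qed

end

section \<open>Lipschitz boundaries are null sets\<close>

lemma vector_2_eq: "(vector [a, b] :: real^2) = a *\<^sub>R axis 1 1 + b *\<^sub>R axis 2 1"
  by (simp add: vec_eq_iff forall_2 axis_def)

text \<open>The graph lies in the image of a coordinate plane under the map \<open>h\<close> that
  inserts the height \<open>g\<close> and undoes the rigid motion. Lipschitz maps of the space into
  itself preserve null sets.\<close>

lemma negligible_lipschitz_graph:
  assumes T: "orthogonal_transformation (T :: real^3 \<Rightarrow> real^3)" and g: "C-lipschitz_on UNIV (g :: real^2 \<Rightarrow> real)"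
  shows "negligible {z. g (vector [T (z - x) $ 1, T (z - x) $ 2]) = T (z - x) $ 3}"
proof -
  define T' where "T' = inv T"
  have T': "orthogonal_transformation T'" using T by (simp add: T'_def orthogonal_transformation_inv)
  have lin: "linear T'" using T' by (rule orthogonal_transformation_linear)
  have TT: "T' (T y) = y" for y
    unfolding T'_def using T by (simp add: inv_f_f orthogonal_transformation_inj)
  define p :: "real^3 \<Rightarrow> real^2" where "p y = vector [y $ 1, y $ 2]" for y
  define h where "h y = x + T' (vector [y $ 1, y $ 2, g (p y)])" for y :: "real^3"
  have C: "C \<ge> 0" using g by (rule lipschitz_on_nonneg)
  have "negligible (h ` {y. y $ 3 = 0})"
  proof (rule negligible_locally_Lipschitz_image)
    show "negligible {y :: real^3. y $ 3 = 0}" by (rule negligible_standard_hyperplane_cart)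
    fix y :: "real^3"
    \<comment> \<open>Estimating by the sum of coordinates: 2 comes from the two horizontal ones,
      and \<open>2 * C\<close> from the height, as the planar projection \<open>p\<close> is
      Lipschitz with constant 2.\<close>
    have "norm (h z - h y) \<le> (2 + 2 * C) * norm (z - y)" for z
    proof -
      define d :: "real^3" where "d = vector [z $ 1, z $ 2, g (p z)] - vector [y $ 1, y $ 2, g (p y)]"
      have "norm (p z - p y) \<le> \<bar>(z - y) $ 1\<bar> + \<bar>(z - y) $ 2\<bar>"
        using norm_le_l1_cart[of "p z - p y"] by (simp add: sum_2 p_def)
      also have "\<dots> \<le> norm (z - y) + norm (z - y)" by (intro add_mono component_le_norm_cart)
      finally have p: "C * norm (p z - p y) \<le> C * (2 * norm (z - y))" using C by (intro mult_left_mono) auto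
      have "h z - h y = T' d" by (simp add: h_def linear_diff[OF lin] d_def)
      then have "norm (h z - h y) = norm d" using T' by (simp add: orthogonal_transformation)
      also have "\<dots> \<le> \<bar>d $ 1\<bar> + \<bar>d $ 2\<bar> + \<bar>d $ 3\<bar>"
        using norm_le_l1_cart[of d] by (simp add: sum_3)
      also have "\<dots> = \<bar>(z - y) $ 1\<bar> + \<bar>(z - y) $ 2\<bar> + \<bar>g (p z) - g (p y)\<bar>" by (simp add: d_def)
      also have "\<dots> \<le> norm (z - y) + norm (z - y) + C * norm (p z - p y)"
        using lipschitz_onD[OF g, of "p z" "p y"]
        by (intro add_mono component_le_norm_cart) (auto simp: dist_norm)
      finally show ?thesis using p by (simp add: algebra_simps)
    qed
    then show "\<exists>T B. open T \<and> y \<in> T \<and> (\<forall>z\<in>{y. y $ 3 = 0} \<inter> T. norm (h z - h y) \<le> B * norm (z - y))"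
      by (intro exI[of _ UNIV] exI[of _ "2 + 2 * C"]) auto
  qed simp
  moreover have "{z. g (vector [T (z - x) $ 1, T (z - x) $ 2]) = T (z - x) $ 3} \<subseteq> h ` {y. y $ 3 = 0}"
  proof
    fix z assume z: "z \<in> {z. g (vector [T (z - x) $ 1, T (z - x) $ 2]) = T (z - x) $ 3}"
    define y :: "real^3" where "y = vector [T (z - x) $ 1, T (z - x) $ 2, 0]"
    have "vector [y $ 1, y $ 2, g (p y)] = T (z - x)"
      using z by (simp add: y_def p_def vec_eq_iff forall_3)
    then have "z = h y" by (simp add: h_def TT)
    then show "z \<in> h ` {y. y $ 3 = 0}" by (simp add: y_def)
  qed
  ultimately show ?thesis by (rule negligible_subset)
qed

text \<open>Negligibility is local, and near a frontier point the frontier lies on the graph: points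
  above it belong to the open set \<open>U\<close>, points below have a neighbourhood that misses
  \<open>U\<close>.\<close>

lemma negligible_frontier_lipschitz:
  assumes "bounded_lipschitz_domain U"
  shows "negligible (frontier U)"
proof (rule iffD2[OF locally_negligible_alt], rule ballI)
  have U: "open U" using assms unfolding bounded_lipschitz_domain_def by (rule conjunct1)
  fix x assume x: "x \<in> frontier U"
  obtain r T C g where r: "r > 0" and T: "orthogonal_transformation (T :: real^3 \<Rightarrow> real^3)"
    and g: "C-lipschitz_on UNIV (g :: real^2 \<Rightarrow> real)"
    and loc': "\<forall>z\<in>ball x r. z \<in> U \<longleftrightarrow> g (vector [T (z - x) $ 1, T (z - x) $ 2]) < T (z - x) $ 3"
  proof -
    have "\<forall>x\<in>frontier U. \<exists>r>0. \<exists>T :: real^3 \<Rightarrow> real^3. \<exists>C. \<exists>g :: real^2 \<Rightarrow> real.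
        orthogonal_transformation T \<and> C-lipschitz_on UNIV g \<and>
        (\<forall>z\<in>ball x r. z \<in> U \<longleftrightarrow> g (vector [T (z - x) $ 1, T (z - x) $ 2]) < T (z - x) $ 3)"
      using assms unfolding bounded_lipschitz_domain_def by (elim conjE)
    from bspec[OF this x] show ?thesis by (elim exE conjE) (rule that)
  qed
  note loc = bspec[OF loc']
  define p :: "real^3 \<Rightarrow> real^2" where "p z = vector [T (z - x) $ 1, T (z - x) $ 2]" for z
  define q where "q z = T (z - x) $ 3" for z
  have linT: "linear T" using T by (rule orthogonal_transformation_linear)
  have contT: "continuous_on UNIV (\<lambda>z. T (z - x))"
    by (intro linear_continuous_on_compose[OF _ linT] continuous_intros)
  have contp: "continuous_on UNIV p"
    unfolding p_def[abs_def] vector_2_eq using contT by (intro continuous_intros) auto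
  have contgp: "continuous_on UNIV (\<lambda>z. g (p z))"
    using continuous_on_compose2[OF lipschitz_on_continuous_on[OF g] contp] by simp
  have contq: "continuous_on UNIV q"
    unfolding q_def[abs_def] using contT by (intro continuous_intros) auto
  have "frontier U \<inter> ball x r \<subseteq> {z. g (p z) = q z}"
  proof
    fix z assume z: "z \<in> frontier U \<inter> ball x r"
    have "\<not> g (p z) < q z"
      using z loc[of z] U by (auto simp: frontier_def interior_open p_def q_def)
    moreover have "\<not> q z < g (p z)"
    proof
      assume lt: "q z < g (p z)"
      let ?A = "{z. q z < g (p z)} \<inter> ball x r"
      have "open ?A" by (intro open_Int open_Collect_less contq contgp open_ball)
      moreover have "?A \<inter> U = {}" using loc by (auto simp: p_def q_def) 
      ultimately have "?A \<inter> closure U = {}" by (simp add: open_Int_closure_eq_empty)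
      then show False using lt z by (auto simp: frontier_def)
    qed
    ultimately show "z \<in> {z. g (p z) = q z}" by simp
  qed
  moreover have "negligible {z. g (p z) = q z}"
    unfolding p_def q_def by (rule negligible_lipschitz_graph[OF T g])
  ultimately have "negligible (frontier U \<inter> ball x r)" by (rule negligible_subset[rotated])
  then show "\<exists>V. openin (top_of_set (frontier U)) V \<and> x \<in> V \<and> negligible V"
    using x r by (intro exI[of _ "frontier U \<inter> ball x r"]) auto
qed

section \<open>The elastic energy\<close>

locale elastic_body = bounded_open +
  fixes l0 l1 :: real
  assumes l0: "l0 > 0" and l1: "l1 > 0"
begin

lemma lame_stress_eq: "lame_stress l0 l1 U f x = l0 *\<^sub>R sgrad U f x + (l1 * wdiv U f x) *\<^sub>R mat 1"
  by (simp add: lame_stress_def)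

lemma transpose_lame_stress: "transpose (lame_stress l0 l1 U f x) = lame_stress l0 l1 U f x"
  by (simp add: lame_stress_eq sgrad_eq transpose_def mat_def symm_def vec_eq_iff)

lemma lame_stress_L2: "H1 U f \<Longrightarrow> L2 U (lame_stress l0 l1 U f)"
proof -
  assume f: "H1 U f"
  have "L2 U (\<lambda>x. wdiv U f x *\<^sub>R (mat 1 :: real^3^3))"
    by (rule L2_bounded_linear[OF _ wdiv_L2[OF f]]) (simp add: linear_iff algebra_simps)
  from L2_lincomb[OF sgrad_L2[OF f] this, of l0 l1] show ?thesis by (simp add: lame_stress_eq[abs_def])
qed

lemma lame_stress_lincomb:
  assumes "H1 U f" "H1 U g"
  shows "AE x in lebesgue_on U. lame_stress l0 l1 U (\<lambda>x. a *\<^sub>R f x + b *\<^sub>R g x) x =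
     a *\<^sub>R lame_stress l0 l1 U f x + b *\<^sub>R lame_stress l0 l1 U g x"
  using sgrad_lincomb[OF assms, of a b] wdiv_lincomb[OF assms, of a b]
  by eventually_elim (simp add: lame_stress_eq algebra_simps)

lemma lame_stress_AE_zero:
  assumes "AE x in lebesgue_on U. f x = 0"
  shows "AE x in lebesgue_on U. lame_stress l0 l1 U f x = 0"
  using wgrad_AE_zero[OF assms]
  by eventually_elim (simp add: lame_stress_eq sgrad_eq wdiv_def linear_0[OF linear_symm] linear_0[OF linear_trace])

text \<open>Connects the energy form, written with the symmetric gradient, to the weak eigenvalue
  problem, written with the full one.\<close>

lemma lame_inner_sgrad: "l2_inner U (lame_stress l0 l1 U f) (sgrad U g) = l2_inner U (lame_stress l0 l1 U f) (wgrad U g)"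
  by (simp add: l2_inner_def sgrad_eq symm_inner transpose_lame_stress)

text \<open>In this form symmetry and positivity of the energy product are visible, and everything
  reduces to L^2 products.\<close>

lemma h1_inner_eq:
  assumes "H1 U f" "H1 U g"
  shows "h1_inner l0 l1 U f g =
    l2_inner U f g + l0 * l2_inner U (sgrad U f) (sgrad U g) + l1 * l2_inner U (wdiv U f) (wdiv U g)"
proof -
  have "l2_inner U (lame_stress l0 l1 U f) (sgrad U g) =
      (\<integral>x. l0 * (sgrad U f x \<bullet> sgrad U g x) + l1 * (wdiv U f x \<bullet> wdiv U g x) \<partial>lebesgue_on U)"
    unfolding l2_inner_def
    by (simp add: lame_stress_eq inner_add_left sgrad_eq inner_mat_1 wdiv_def mult.assoc)
  also have "\<dots> = l0 * l2_inner U (sgrad U f) (sgrad U g) + l1 * l2_inner U (wdiv U f) (wdiv U g)"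
    unfolding l2_inner_def
    using L2_integrable_inner[OF sgrad_L2 sgrad_L2, OF assms] L2_integrable_inner[OF wdiv_L2 wdiv_L2, OF assms]
    by (simp del: inner_real_def)
  finally show ?thesis by (simp add: h1_inner_def)
qed

lemma h1_inner_lincomb:
  assumes "H1 U f" "H1 U g" "H1 U h"
  shows "h1_inner l0 l1 U (\<lambda>x. a *\<^sub>R f x + b *\<^sub>R g x) h = a * h1_inner l0 l1 U f h + b * h1_inner l0 l1 U g h"
proof -
  note L = H1_L2 sgrad_L2 wdiv_L2
  have "l2_inner U (sgrad U (\<lambda>x. a *\<^sub>R f x + b *\<^sub>R g x)) (sgrad U h) =
      l2_inner U (\<lambda>x. a *\<^sub>R sgrad U f x + b *\<^sub>R sgrad U g x) (sgrad U h)"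
    using assms by (intro l2_inner_AE_cong sgrad_lincomb AE_I2 refl L2_lincomb L H1_lincomb)
  moreover have "l2_inner U (wdiv U (\<lambda>x. a *\<^sub>R f x + b *\<^sub>R g x)) (wdiv U h) =
      l2_inner U (\<lambda>x. a *\<^sub>R wdiv U f x + b *\<^sub>R wdiv U g x) (wdiv U h)"
    using assms by (intro l2_inner_AE_cong wdiv_lincomb AE_I2 refl L2_lincomb L H1_lincomb)
  ultimately show ?thesis
    using assms by (simp only: h1_inner_eq H1_lincomb l2_inner_lincomb L) (simp add: algebra_simps)
qed

lemma h1_inner_self: "H1 U f \<Longrightarrow> h1_inner l0 l1 U f f =
    (l2_norm U f)\<^sup>2 + l0 * (l2_norm U (sgrad U f))\<^sup>2 + l1 * (l2_norm U (wdiv U f))\<^sup>2"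
  by (simp add: h1_inner_eq l2_norm_sq)

sublocale h1: semi_inner "{f. H1 U f}" "h1_inner l0 l1 U"
proof
  have z: "H1 U (\<lambda>x. 0)" by (rule H1_AE_zero) simp
  show "subspace {f. H1 U f}"
    unfolding subspace_def
  proof (intro conjI ballI allI)
    fix f g and c :: real assume f: "f \<in> {f. H1 U f}"
    show "c *\<^sub>R f \<in> {f. H1 U f}" using H1_lincomb[of f "\<lambda>x. 0" c 0] f z by (simp add: scaleR_fun_def)
    assume g: "g \<in> {f. H1 U f}"
    show "f + g \<in> {f. H1 U f}" using H1_lincomb[of f g 1 1] f g by (simp add: plus_fun_def)
  qed (use z in \<open>simp add: zero_fun_def\<close>)
  fix f g h assume f: "f \<in> {f. H1 U f}" and g: "g \<in> {f. H1 U f}"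
  show "h1_inner l0 l1 U f g = h1_inner l0 l1 U g f"
    using f g by (simp add: h1_inner_eq l2_inner_def inner_commute mult.commute)
  show "h1_inner l0 l1 U (r *\<^sub>R f) g = r * h1_inner l0 l1 U f g" for r
    using h1_inner_lincomb[of f "\<lambda>x. 0" g r 0] f g z by (simp add: scaleR_fun_def)
  show "h1_inner l0 l1 U f f \<ge> 0"
    using f l0 l1 by (simp add: h1_inner_self)
  assume h: "h \<in> {f. H1 U f}"
  show "h1_inner l0 l1 U (f + g) h = h1_inner l0 l1 U f h + h1_inner l0 l1 U g h"
    using h1_inner_lincomb[of f g h 1 1] f g h by (simp add: plus_fun_def)
qed

lemma h1_nrm_eq: "h1.nrm f = h1_norm l0 l1 U f"
  by (simp add: h1.nrm_def h1_norm_def)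

lemma l2_norm_le_h1_norm: "H1 U f \<Longrightarrow> l2_norm U f \<le> h1_norm l0 l1 U f"
  unfolding h1_norm_def using l0 l1 by (intro real_le_rsqrt) (simp add: h1_inner_self)

lemma sgrad_norm_le_h1_norm: 
  assumes "H1 U f" shows "sqrt l0 * l2_norm U (sgrad U f) \<le> h1_norm l0 l1 U f"
  unfolding h1_norm_def using l0 l1 assms by (intro real_le_rsqrt) (simp add: h1_inner_self power_mult_distrib)

lemma h1_inner_AE_zero:
  assumes "AE x in lebesgue_on U. f x = 0"
  shows "h1_norm l0 l1 U f = 0"
proof -
  have H: "H1 U f" using assms by (rule H1_AE_zero)
  have "AE x in lebesgue_on U. sgrad U f x = 0" "AE x in lebesgue_on U. wdiv U f x = 0"
    using wgrad_AE_zero[OF assms] by (auto elim!: eventually_mono simp: sgrad_eq wdiv_def linear_0[OF linear_symm] linear_0[OF linear_trace])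
  then show ?thesis
    using assms H l2_norm_eq_0_iff[OF H1_L2[OF H]] l2_norm_eq_0_iff[OF sgrad_L2[OF H]] l2_norm_eq_0_iff[OF wdiv_L2[OF H]]
    by (simp add: h1_norm_def h1_inner_self)
qed

lemma h1_norm_eq_0_iff:
  assumes "H1 U f"
  shows "h1_norm l0 l1 U f = 0 \<longleftrightarrow> (AE x in lebesgue_on U. f x = 0)"
  using h1_inner_AE_zero[of f] l2_norm_le_h1_norm[OF assms] l2_norm_eq_0_iff[OF H1_L2[OF assms]]
  by (metis antisym l2_norm_nonneg)

lemma wgrad_norm_le_H10:
  assumes "H10 U f"
  shows "l2_norm U (wgrad U f) \<le> 2 / sqrt l0 * h1_norm l0 l1 U f"
proof -
  have "l2_norm U (wgrad U f) \<le> 2 * l2_norm U (sgrad U f)" using assms by (rule Korn_H10)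
  also have "l2_norm U (sgrad U f) \<le> h1_norm l0 l1 U f / sqrt l0"
    using sgrad_norm_le_h1_norm[OF H10_H1[OF assms]] l0 by (simp add: field_simps)
  finally show ?thesis by simp
qed

text \<open>The converse of Korn's bound, valid on all of H^1. The 4 is the square of the constant
  in \<open>norm_trace_le\<close>.\<close>

lemma h1_norm_le:
  assumes "H1 U f"
  shows "(h1_norm l0 l1 U f)\<^sup>2 \<le> (l2_norm U f)\<^sup>2 + (l0 + 4 * l1) * (l2_norm U (wgrad U f))\<^sup>2"
proof -
  have s: "l2_norm U (sgrad U f) \<le> 1 * l2_norm U (wgrad U f)"
    using assms by (intro l2_norm_mono sgrad_L2 wgrad_L2) (auto simp: sgrad_eq norm_symm_le[simplified])
  have d: "l2_norm U (wdiv U f) \<le> 2 * l2_norm U (wgrad U f)"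
    using assms by (intro l2_norm_mono wdiv_L2 wgrad_L2) (auto simp: wdiv_def norm_trace_le[simplified])
  have "l0 * (l2_norm U (sgrad U f))\<^sup>2 \<le> l0 * (1 * l2_norm U (wgrad U f))\<^sup>2"
    using s l0 by (intro mult_left_mono power_mono) auto
  moreover have "l1 * (l2_norm U (wdiv U f))\<^sup>2 \<le> l1 * (2 * l2_norm U (wgrad U f))\<^sup>2"
    using d l1 by (intro mult_left_mono power_mono) auto
  moreover have "(h1_norm l0 l1 U f)\<^sup>2 = h1_inner l0 l1 U f f"
    using h1.nrm_sq[of f] assms by (simp add: h1_nrm_eq)
  ultimately show ?thesis
    using assms by (simp add: h1_inner_self algebra_simps power_mult_distrib)
qed

text \<open>By Korn's inequality the energy norm controls the full gradient on fields vanishing on the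
  boundary, so Cauchy sequences of such fields converge in the energy norm.\<close>
lemma H10_complete:
  assumes s: "\<And>n. H10 U (s n)"
    and Cauchy: "\<And>\<epsilon>. \<epsilon> > 0 \<Longrightarrow> \<exists>N. \<forall>m\<ge>N. \<forall>n\<ge>N. h1_norm l0 l1 U (\<lambda>x. s m x - s n x) < \<epsilon>"
  obtains \<eta> where "H1 U \<eta>" "(\<lambda>n. h1_norm l0 l1 U (\<lambda>x. s n x - \<eta> x)) \<longlonglongrightarrow> 0"
proof -
  have diff0: "H10 U (\<lambda>x. s m x - s n x)" for m n
    using H10_lincomb[OF s[of m] s[of n], of 1 "- 1"] by simp
  note H = H10_H1[OF s] and Hd = H10_H1[OF diff0]
  have wd: "AE x in lebesgue_on U. wgrad U (\<lambda>x. f x - g x) x = wgrad U f x - wgrad U g x" if "H1 U f" "H1 U g" for f g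
    using wgrad_lincomb[OF that, of 1 "- 1"] by simp
  have wnorm: "l2_norm U (wgrad U (\<lambda>x. f x - g x)) = l2_norm U (\<lambda>x. wgrad U f x - wgrad U g x)" if "H1 U f" "H1 U g" for f g
  proof -
    have "H1 U (\<lambda>x. f x - g x)" using H1_lincomb[OF that, of 1 "- 1"] by simp
    then show ?thesis
      unfolding l2_norm_def using wd[OF that] that
      by (intro arg_cong[where f = sqrt] l2_inner_AE_cong L2_diff wgrad_L2) auto
  qed
  obtain \<eta> where \<eta>: "L2 U \<eta>" "(\<lambda>n. l2_norm U (\<lambda>x. s n x - \<eta> x)) \<longlonglongrightarrow> 0"
  proof (rule L2_complete[OF bounded_U sets_U H1_L2[OF H]])
    fix \<epsilon> :: real assume "\<epsilon> > 0"
    then show "\<exists>N. \<forall>m\<ge>N. \<forall>n\<ge>N. l2_norm U (\<lambda>x. s m x - s n x) < \<epsilon>"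
      using Cauchy[of \<epsilon>] l2_norm_le_h1_norm[OF Hd] by (meson order_le_less_trans)
  qed
  obtain G where G: "L2 U G" "(\<lambda>n. l2_norm U (\<lambda>x. wgrad U (s n) x - G x)) \<longlonglongrightarrow> 0"
  proof (rule L2_complete[OF bounded_U sets_U wgrad_L2[OF H]])
    fix \<epsilon> :: real assume "\<epsilon> > 0"
    \<comment> \<open>The factor \<open>sqrt l0 / 2\<close> is the inverse of the constant in
      \<open>wgrad_norm_le_H10\<close>.\<close>
    then obtain N where N: "\<And>m n. m \<ge> N \<Longrightarrow> n \<ge> N \<Longrightarrow> h1_norm l0 l1 U (\<lambda>x. s m x - s n x) < \<epsilon> * sqrt l0 / 2"
      using Cauchy[of "\<epsilon> * sqrt l0 / 2"] l0 by (meson half_gt_zero mult_pos_pos real_sqrt_gt_zero)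
    have "l2_norm U (\<lambda>x. wgrad U (s m) x - wgrad U (s n) x) < \<epsilon>" if "m \<ge> N" "n \<ge> N" for m n
    proof -
      have "l2_norm U (\<lambda>x. wgrad U (s m) x - wgrad U (s n) x) \<le> 2 / sqrt l0 * h1_norm l0 l1 U (\<lambda>x. s m x - s n x)"
        using wgrad_norm_le_H10[OF diff0[of m n]] by (simp add: wnorm H)
      also have "\<dots> < 2 / sqrt l0 * (\<epsilon> * sqrt l0 / 2)"
        using N[OF that] l0 by (intro mult_strict_left_mono) auto
      also have "\<dots> = \<epsilon>" using l0 by simp
      finally show ?thesis .
    qed
    then show "\<exists>N. \<forall>m\<ge>N. \<forall>n\<ge>N. l2_norm U (\<lambda>x. wgrad U (s m) x - wgrad U (s n) x) < \<epsilon>" by blast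
  qed
  have \<eta>G: "has_weak_grad U \<eta> G"
    by (rule has_weak_grad_limit[OF has_weak_grad_wgrad[OF H] \<eta>(1) G(1) \<eta>(2) G(2)])
  then have H\<eta>: "H1 U \<eta>" by (auto simp: H1_def)
  \<comment> \<open>Korn's inequality has served for the gradients of the sequence. Back in the
    energy norm the elementary bound \<open>h1_norm_le\<close> suffices, which asks of
    \<open>s n - \<eta>\<close> only to lie in H^1.\<close>
  have "(\<lambda>n. h1_norm l0 l1 U (\<lambda>x. s n x - \<eta> x)) \<longlonglongrightarrow> 0"
  proof (rule Lim_null_comparison)
    have eqG: "l2_norm U (wgrad U (\<lambda>x. s n x - \<eta> x)) = l2_norm U (\<lambda>x. wgrad U (s n) x - G x)" for n
    proof -
      have "AE x in lebesgue_on U. wgrad U (s n) x - wgrad U \<eta> x = wgrad U (s n) x - G x"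
        using wgrad_AE_eq[OF \<eta>G] by eventually_elim simp
      then have "l2_norm U (\<lambda>x. wgrad U (s n) x - wgrad U \<eta> x) = l2_norm U (\<lambda>x. wgrad U (s n) x - G x)"
        unfolding l2_norm_def using H H\<eta> G(1)
        by (intro arg_cong[where f = sqrt] l2_inner_AE_cong L2_diff wgrad_L2) auto
      then show ?thesis by (simp add: wnorm H H\<eta>)
    qed
    have "(\<lambda>n. sqrt ((l2_norm U (\<lambda>x. s n x - \<eta> x))\<^sup>2 + (l0 + 4 * l1) * (l2_norm U (\<lambda>x. wgrad U (s n) x - G x))\<^sup>2))
       \<longlonglongrightarrow> sqrt (0\<^sup>2 + (l0 + 4 * l1) * 0\<^sup>2)"
      by (intro tendsto_intros \<eta> G)
    then show "(\<lambda>n. sqrt ((l2_norm U (\<lambda>x. s n x - \<eta> x))\<^sup>2 + (l0 + 4 * l1) * (l2_norm U (\<lambda>x. wgrad U (s n) x - G x))\<^sup>2)) \<longlonglongrightarrow> 0"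
      by simp
    show "\<forall>\<^sub>F n in sequentially. norm (h1_norm l0 l1 U (\<lambda>x. s n x - \<eta> x)) \<le>
       sqrt ((l2_norm U (\<lambda>x. s n x - \<eta> x))\<^sup>2 + (l0 + 4 * l1) * (l2_norm U (\<lambda>x. wgrad U (s n) x - G x))\<^sup>2)"
    proof (intro always_eventually allI)
      fix n
      have "H1 U (\<lambda>x. s n x - \<eta> x)" using H1_lincomb[OF H[of n] H\<eta>, of 1 "- 1"] by simp
      from h1_norm_le[OF this]
      show "norm (h1_norm l0 l1 U (\<lambda>x. s n x - \<eta> x)) \<le>
       sqrt ((l2_norm U (\<lambda>x. s n x - \<eta> x))\<^sup>2 + (l0 + 4 * l1) * (l2_norm U (\<lambda>x. wgrad U (s n) x - G x))\<^sup>2)"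
        unfolding eqG by (intro real_le_rsqrt) (simp add: power2_abs)
    qed
  qed
  with H\<eta> show ?thesis by (rule that)
qed

end

section \<open>The coupled system\<close>

lemma bounded_lipschitz_domain_bounded_open:
  assumes "bounded_lipschitz_domain U"
  shows "bounded_open U"
proof
  show "open U" using assms unfolding bounded_lipschitz_domain_def by (rule conjunct1)
  show "bounded U" using assms unfolding bounded_lipschitz_domain_def by (elim conjE)
qed

locale fsi =
  fixes \<Omega> \<Omega>S :: "(real^3) set" and \<nu> l0 l1 :: real
  assumes geometry: "fsi_geometry \<Omega> \<Omega>S" and l0_pos: "l0 > 0" and l1_pos: "l1 > 0"
begin

abbreviation \<Omega>F :: "(real^3) set" where "\<Omega>F \<equiv> fluid_domain \<Omega> \<Omega>S"

end

sublocale fsi \<subseteq> whole: bounded_open \<Omega>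
  using geometry unfolding fsi_geometry_def by (blast intro: bounded_lipschitz_domain_bounded_open)

sublocale fsi \<subseteq> fluid: bounded_open "fluid_domain \<Omega> \<Omega>S"
  using geometry unfolding fsi_geometry_def by (blast intro: bounded_lipschitz_domain_bounded_open)

sublocale fsi \<subseteq> solid: elastic_body \<Omega>S l0 l1
proof (intro elastic_body.intro elastic_body_axioms.intro)
  show "bounded_open \<Omega>S"
    using geometry unfolding fsi_geometry_def by (blast intro: bounded_lipschitz_domain_bounded_open)
qed (fact l0_pos l1_pos)+

context fsi
begin

lemma solid_subset: "\<Omega>S \<subseteq> \<Omega>" and fluid_subset: "\<Omega>F \<subseteq> \<Omega>" and disjoint: "\<Omega>S \<inter> \<Omega>F = {}"
  using geometry closure_subset[of \<Omega>S] by (auto simp: fsi_geometry_def fluid_domain_def)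

text \<open>The fluid domain omits the closure of the solid; what is lost between the two is the
  frontier, a null set for Lipschitz domains.\<close>

lemma AE_solid_or_fluid: "AE x in lebesgue. x \<in> \<Omega> \<longrightarrow> x \<in> \<Omega>S \<or> x \<in> \<Omega>F"
proof -
  have "bounded_lipschitz_domain \<Omega>S" using geometry unfolding fsi_geometry_def by blast
  then have "frontier \<Omega>S \<in> null_sets lebesgue"
    by (intro iffD1[OF negligible_iff_null_sets] negligible_frontier_lipschitz)
  moreover have "frontier \<Omega>S = closure \<Omega>S - \<Omega>S"
    by (simp add: frontier_def interior_open[OF solid.open_U])
  ultimately have "AE x in lebesgue. x \<notin> closure \<Omega>S - \<Omega>S" by (metis AE_not_in)
  then show ?thesis
    by eventually_elim (unfold fluid_domain_def, blast)
qed

text \<open>A field vanishing on the boundary of \<Omega> has total divergence zero, so its fluxes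
  out of the solid and out of the fluid cancel. This is Green's formula across the interface without
  any trace.\<close>

lemma integral_wdiv_split:
  assumes "H10 \<Omega> \<phi>"
  shows "H1 \<Omega>S \<phi>" "H1 \<Omega>F \<phi>"
    "(\<integral>x. wdiv \<Omega>S \<phi> x \<partial>lebesgue_on \<Omega>S) + (\<integral>x. wdiv \<Omega>F \<phi> x \<partial>lebesgue_on \<Omega>F) = 0"
proof -
  note H = whole.H10_H1[OF assms]
  note gS = whole.has_weak_grad_restrict[OF whole.has_weak_grad_wgrad[OF H] solid_subset solid.open_U]
  note gF = whole.has_weak_grad_restrict[OF whole.has_weak_grad_wgrad[OF H] fluid_subset fluid.open_U]
  show HS: "H1 \<Omega>S \<phi>" and HF: "H1 \<Omega>F \<phi>" using gS gF by (auto simp: H1_def)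
  define d where "d = wdiv \<Omega> \<phi>"
  have dm: "integrable (lebesgue_on \<Omega>) d"
    unfolding d_def by (rule L2_integrable[OF whole.bounded_U whole.sets_U whole.wdiv_L2[OF H]])
  have dL: "L2 \<Omega>S d" "L2 \<Omega>F d"
    unfolding d_def
    by (intro L2_subset[OF whole.wdiv_L2[OF H]] solid_subset fluid_subset solid.sets_U fluid.sets_U whole.sets_U)+
  have int: "integrable (lebesgue_on \<Omega>S) d" "integrable (lebesgue_on \<Omega>F) d"
    using L2_integrable[OF solid.bounded_U solid.sets_U dL(1)] L2_integrable[OF fluid.bounded_U fluid.sets_U dL(2)] by auto
  have "(\<integral>x. wdiv \<Omega>S \<phi> x \<partial>lebesgue_on \<Omega>S) = (\<integral>x. d x \<partial>lebesgue_on \<Omega>S)"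
  proof (rule integral_cong_AE)
    show "AE x in lebesgue_on \<Omega>S. wdiv \<Omega>S \<phi> x = d x"
      using solid.wgrad_AE_eq[OF gS] by eventually_elim (simp add: wdiv_def d_def)
  qed (rule L2_measurable[OF solid.wdiv_L2[OF HS]] L2_measurable[OF dL(1)])+
  moreover have "(\<integral>x. wdiv \<Omega>F \<phi> x \<partial>lebesgue_on \<Omega>F) = (\<integral>x. d x \<partial>lebesgue_on \<Omega>F)"
  proof (rule integral_cong_AE)
    show "AE x in lebesgue_on \<Omega>F. wdiv \<Omega>F \<phi> x = d x"
      using fluid.wgrad_AE_eq[OF gF] by eventually_elim (simp add: wdiv_def d_def)
  qed (rule L2_measurable[OF fluid.wdiv_L2[OF HF]] L2_measurable[OF dL(2)])+
  moreover have "(\<integral>x. d x \<partial>lebesgue_on \<Omega>S) + (\<integral>x. d x \<partial>lebesgue_on \<Omega>F) = (\<integral>x. d x \<partial>lebesgue_on \<Omega>)"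
  proof -
    have i: "integrable lebesgue (\<lambda>x. indicator \<Omega>S x * d x)" "integrable lebesgue (\<lambda>x. indicator \<Omega>F x * d x)"
      "integrable lebesgue (\<lambda>x. indicator \<Omega> x * d x)"
      using int dm by (simp_all add: integrable_lebesgue_on)
    have "(\<integral>x. d x \<partial>lebesgue_on \<Omega>S) + (\<integral>x. d x \<partial>lebesgue_on \<Omega>F) =
        (\<integral>x. indicator \<Omega>S x * d x + indicator \<Omega>F x * d x \<partial>lebesgue)"
      using i by (simp add: integral_lebesgue_on)
    also have "\<dots> = (\<integral>x. indicator \<Omega> x * d x \<partial>lebesgue)"
    proof (rule integral_cong_AE)
      show "AE x in lebesgue. indicator \<Omega>S x * d x + indicator \<Omega>F x * d x = indicator \<Omega> x * d x"
        using AE_solid_or_fluid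
      proof eventually_elim
        case (elim x)
        then show ?case using solid_subset fluid_subset disjoint
          by (cases "x \<in> \<Omega>"; cases "x \<in> \<Omega>S"; cases "x \<in> \<Omega>F") auto
      qed
    qed (use i in auto)
    finally show ?thesis by (simp add: integral_lebesgue_on)
  qed
  moreover have "(\<integral>x. d x \<partial>lebesgue_on \<Omega>) = 0"
    unfolding d_def by (rule whole.integral_wdiv_H10[OF assms])
  ultimately show "(\<integral>x. wdiv \<Omega>S \<phi> x \<partial>lebesgue_on \<Omega>S) + (\<integral>x. wdiv \<Omega>F \<phi> x \<partial>lebesgue_on \<Omega>F) = 0" by simp
qed

lemma grad_L2: "test_fun V \<phi> \<Longrightarrow> L2 \<Omega>F (grad \<phi>)"
proof (rule L2_vec)
  fix i assume \<phi>: "test_fun V \<phi>"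
  have "(\<lambda>x. grad \<phi> x $ i) = pd i \<phi>" by (simp add: grad_def pd_def fun_eq_iff)
  then show "L2 \<Omega>F (\<lambda>x. grad \<phi> x $ i)" using test_fun_L2(2)[OF fluid.bounded_U fluid.sets_U \<phi>] by simp
qed

lemma L_S_L2: "L_S \<Omega> \<Omega>S u \<Longrightarrow> L2 \<Omega>F u"
  by (simp add: L_S_def)

lemma L_S_lincomb:
  assumes "L_S \<Omega> \<Omega>S u" "L_S \<Omega> \<Omega>S u'"
  shows "L_S \<Omega> \<Omega>S (\<lambda>x. a *\<^sub>R u x + b *\<^sub>R u' x)"
proof -
  note L = L_S_L2[OF assms(1)] L_S_L2[OF assms(2)]
  show ?thesis
    unfolding L_S_def
  proof (intro conjI allI impI)
    show "L2 \<Omega>F (\<lambda>x. a *\<^sub>R u x + b *\<^sub>R u' x)" using L by (rule L2_lincomb)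
    show "l2_inner \<Omega>F (\<lambda>x. a *\<^sub>R u x + b *\<^sub>R u' x) (grad \<phi>) = 0" if "test_fun \<Omega>F \<phi>" for \<phi>
      using assms that by (simp add: l2_inner_lincomb[OF L grad_L2[OF that]] L_S_def)
    show "l2_inner \<Omega>F (\<lambda>x. a *\<^sub>R u x + b *\<^sub>R u' x) (grad \<phi>) = 0" if "test_fun (- closure \<Omega>S) \<phi>" for \<phi>
      using assms that by (simp add: l2_inner_lincomb[OF L grad_L2[OF that]] L_S_def)
  qed
qed

lemma L_S_AE_zero:
  assumes "AE x in lebesgue_on \<Omega>F. u x = 0"
  shows "L_S \<Omega> \<Omega>S u"
proof -
  have L: "L2 \<Omega>F u" using assms fluid.sets_U by (rule L2_AE_zero)
  have "l2_inner \<Omega>F u g = 0" if "L2 \<Omega>F g" for g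
    using l2_inner_AE_cong[OF assms AE_I2 L L2_0 that that] by (simp add: l2_inner_def)
  then show ?thesis using L grad_L2 unfolding L_S_def by blast
qed

definition sinner :: "state \<Rightarrow> state \<Rightarrow> real" where
  "sinner x y = h1_inner l0 l1 \<Omega>S (fst x) (fst y) + l2_inner \<Omega>S (fst (snd x)) (fst (snd y)) +
     l2_inner \<Omega>F (snd (snd x)) (snd (snd y))"

lemma X_iff: "x \<in> X \<Omega> \<Omega>S \<longleftrightarrow> H1 \<Omega>S (fst x) \<and> L2 \<Omega>S (fst (snd x)) \<and> L_S \<Omega> \<Omega>S (snd (snd x))"
  by (cases x) (simp add: X_def)

end

sublocale fsi \<subseteq> energy: semi_inner "X \<Omega> \<Omega>S" sinner
proof
  have comb: "a *\<^sub>R x + b *\<^sub>R y \<in> X \<Omega> \<Omega>S" if "x \<in> X \<Omega> \<Omega>S" "y \<in> X \<Omega> \<Omega>S" for x y a b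
    using that L_S_lincomb[of "snd (snd x)" "snd (snd y)" a b]
    by (auto simp: X_iff plus_fun_def scaleR_fun_def intro!: solid.H1_lincomb L2_lincomb)
  have 0: "0 \<in> X \<Omega> \<Omega>S"
    using solid.H1_AE_zero[of "\<lambda>x. 0"] L_S_AE_zero[of "\<lambda>x. 0"] by (simp add: X_iff zero_fun_def)
  show "subspace (X \<Omega> \<Omega>S)"
    unfolding subspace_def
  proof (intro conjI ballI allI)
    fix x y and c :: real assume x: "x \<in> X \<Omega> \<Omega>S"
    show "c *\<^sub>R x \<in> X \<Omega> \<Omega>S" using comb[OF x x, of c 0] by simp
    assume "y \<in> X \<Omega> \<Omega>S"
    with comb[OF x, of y 1 1] show "x + y \<in> X \<Omega> \<Omega>S" by simp
  qed (fact 0)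
  fix x y z assume x: "x \<in> X \<Omega> \<Omega>S" and y: "y \<in> X \<Omega> \<Omega>S"
  show "sinner x y = sinner y x"
    using x y solid.h1.sym[of "fst x" "fst y"] l2.sym[of "fst (snd x)" \<Omega>S "fst (snd y)"]
      l2.sym[of "snd (snd x)" \<Omega>F "snd (snd y)"]
    by (simp add: sinner_def X_iff L_S_L2)
  show "sinner (r *\<^sub>R x) y = r * sinner x y" for r
    using x y solid.h1.scale_left[of "fst x" "fst y" r] l2.scale_left[of "fst (snd x)" \<Omega>S "fst (snd y)" r]
      l2.scale_left[of "snd (snd x)" \<Omega>F "snd (snd y)" r]
    by (simp add: sinner_def X_iff L_S_L2 algebra_simps)
  show "0 \<le> sinner x x"
    using x solid.h1.nonneg[of "fst x"] l2.nonneg[of "fst (snd x)" \<Omega>S] l2.nonneg[of "snd (snd x)" \<Omega>F]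
    by (simp add: sinner_def X_iff L_S_L2)
  assume z: "z \<in> X \<Omega> \<Omega>S"
  show "sinner (x + y) z = sinner x z + sinner y z"
    using x y z solid.h1.add_left[of "fst x" "fst y" "fst z"] l2.add_left[of "fst (snd x)" \<Omega>S "fst (snd y)" "fst (snd z)"]
      l2.add_left[of "snd (snd x)" \<Omega>F "snd (snd y)" "snd (snd z)"]
    by (simp add: sinner_def X_iff L_S_L2)
qed

context fsi
begin

lemma energy_nrm_eq: "energy.nrm x = state_norm l0 l1 \<Omega> \<Omega>S x"
  by (cases x) (simp add: energy.nrm_def sinner_def)

lemma energy_nrm_sq:
  assumes "x \<in> X \<Omega> \<Omega>S"
  shows "(energy.nrm x)\<^sup>2 =
    (h1_norm l0 l1 \<Omega>S (fst x))\<^sup>2 + (l2_norm \<Omega>S (fst (snd x)))\<^sup>2 + (l2_norm \<Omega>F (snd (snd x)))\<^sup>2"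
  using assms solid.h1.nrm_sq[of "fst x"]
  by (simp add: energy.nrm_sq sinner_def l2_norm_sq solid.h1_nrm_eq X_iff)

lemma component_norms_le:
  assumes "x \<in> X \<Omega> \<Omega>S"
  shows "h1_norm l0 l1 \<Omega>S (fst x) \<le> energy.nrm x" "l2_norm \<Omega>S (fst (snd x)) \<le> energy.nrm x"
    "l2_norm \<Omega>F (snd (snd x)) \<le> energy.nrm x"
  using energy_nrm_sq[OF assms] energy.nrm_nonneg[OF assms]
  by (auto intro: power2_le_imp_le[OF _ energy.nrm_nonneg[OF assms]])

lemma h1_norm_nonneg: "H1 \<Omega>S f \<Longrightarrow> h1_norm l0 l1 \<Omega>S f \<ge> 0"
  using solid.h1.nrm_nonneg[of f] by (simp add: solid.h1_nrm_eq)

lemma energy_nrm_le: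
  assumes "x \<in> X \<Omega> \<Omega>S"
  shows "energy.nrm x \<le> h1_norm l0 l1 \<Omega>S (fst x) + l2_norm \<Omega>S (fst (snd x)) + l2_norm \<Omega>F (snd (snd x))"
proof (rule power2_le_imp_le)
  have n: "h1_norm l0 l1 \<Omega>S (fst x) \<ge> 0" using assms by (intro h1_norm_nonneg) (simp add: X_iff)
  show "(energy.nrm x)\<^sup>2 \<le> (h1_norm l0 l1 \<Omega>S (fst x) + l2_norm \<Omega>S (fst (snd x)) + l2_norm \<Omega>F (snd (snd x)))\<^sup>2"
    unfolding energy_nrm_sq[OF assms] using n by (simp add: power2_sum)
  show "0 \<le> h1_norm l0 l1 \<Omega>S (fst x) + l2_norm \<Omega>S (fst (snd x)) + l2_norm \<Omega>F (snd (snd x))"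
    using n by simp
qed

text \<open>The squared energy norm is a sum of three squares, each of which detects functions that
  are nonzero on a set of positive measure. Statements about \<open>state_eq\<close> and null
  vectors are translated here.\<close>

lemma state_eq_iff_nrm:
  assumes "x \<in> X \<Omega> \<Omega>S" "y \<in> X \<Omega> \<Omega>S"
  shows "state_eq \<Omega> \<Omega>S x y \<longleftrightarrow> energy.nrm (x - y) = 0"
proof -
  have d: "x - y \<in> X \<Omega> \<Omega>S" using assms by (rule energy.V_diff)
  have "energy.nrm (x - y) = 0 \<longleftrightarrow> (energy.nrm (x - y))\<^sup>2 = 0" by simp
  also have "\<dots> \<longleftrightarrow> h1_norm l0 l1 \<Omega>S (fst (x - y)) = 0 \<and> l2_norm \<Omega>S (fst (snd (x - y))) = 0 \<and>
      l2_norm \<Omega>F (snd (snd (x - y))) = 0"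
    unfolding energy_nrm_sq[OF d] by (simp add: add_nonneg_eq_0_iff)
  also have "\<dots> \<longleftrightarrow> (AE z in lebesgue_on \<Omega>S. fst (x - y) z = 0) \<and> (AE z in lebesgue_on \<Omega>S. fst (snd (x - y)) z = 0) \<and>
      (AE z in lebesgue_on \<Omega>F. snd (snd (x - y)) z = 0)"
    using d by (simp only: X_iff solid.h1_norm_eq_0_iff l2_norm_eq_0_iff L_S_L2)
  also have "\<dots> \<longleftrightarrow> state_eq \<Omega> \<Omega>S x y"
    by (cases x; cases y) simp
  finally show ?thesis by simp
qed

end

locale fsi_semigroup = fsi +
  fixes S :: "real \<Rightarrow> state \<Rightarrow> state"
  assumes semigroup: "contraction_semigroup l0 l1 \<Omega> \<Omega>S S"
    and generator: "generates l0 l1 \<Omega> \<Omega>S (fsi_generator \<nu> l0 l1 \<Omega> \<Omega>S) S"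

sublocale fsi_semigroup \<subseteq> flow: contraction_semi_inner "X \<Omega> \<Omega>S" sinner S
proof
  note sg = semigroup[unfolded contraction_semigroup_def]
  note sg1 = sg[THEN conjunct1] and sg2 = sg[THEN conjunct2, THEN conjunct1]
    and sg3 = sg[THEN conjunct2, THEN conjunct2, THEN conjunct1]
    and sg4 = sg[THEN conjunct2, THEN conjunct2, THEN conjunct2, THEN conjunct1]
  show SV: "S t x \<in> X \<Omega> \<Omega>S" if "t > 0" "x \<in> X \<Omega> \<Omega>S" for t x
    using sg1 that by blast
  show "energy.nrm (S t (a *\<^sub>R x + b *\<^sub>R y) - (a *\<^sub>R S t x + b *\<^sub>R S t y)) = 0"
    if "t > 0" "x \<in> X \<Omega> \<Omega>S" "y \<in> X \<Omega> \<Omega>S" for t x y a b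
    using sg2 that by (subst state_eq_iff_nrm[symmetric])
      (auto simp: lincomb_eq intro!: energy.V_add energy.V_scale SV)
  show "energy.nrm (S (s + t) x - S s (S t x)) = 0" if "s > 0" "t > 0" "x \<in> X \<Omega> \<Omega>S" for s t x
    using sg3 that by (subst state_eq_iff_nrm[symmetric]) (auto intro!: SV)
  show "energy.nrm (S t x) \<le> energy.nrm x" if "t > 0" "x \<in> X \<Omega> \<Omega>S" for t x
    using sg4 that unfolding energy_nrm_eq by blast
qed

lemma (in fsi_semigroup) generator_limit:
  assumes "fsi_generator \<nu> l0 l1 \<Omega> \<Omega>S x y" "x \<in> X \<Omega> \<Omega>S" "y \<in> X \<Omega> \<Omega>S"
  shows "((\<lambda>t. energy.nrm ((1 / t) *\<^sub>R S t x - (1 / t) *\<^sub>R x - y)) \<longlongrightarrow> 0) (at_right 0)"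
proof -
  have "((\<lambda>t. state_norm l0 l1 \<Omega> \<Omega>S (state_diff (lincomb (1 / t) (S t x) (- 1 / t) x) y)) \<longlongrightarrow> 0) (at_right 0)"
    using generator assms unfolding generates_def by blast
  then show ?thesis by (simp add: energy_nrm_eq lincomb_eq)
qed

section \<open>Overdetermined eigenfunctions\<close>

locale fsi_eigenbasis = fsi_semigroup +
  fixes \<psi>t :: "nat \<Rightarrow> vfield" and \<mu> :: "nat \<Rightarrow> real"
  assumes eigenbasis: "adapted_eigenbasis l0 l1 \<Omega>S \<psi>t \<mu>"
begin

abbreviation K :: "nat set" where "K \<equiv> K_set l0 l1 \<Omega>S \<psi>t \<mu>"
abbreviation \<psi> :: "nat \<Rightarrow> vfield" where "\<psi> \<equiv> psi \<psi>t \<mu>"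
text \<open>The frequency of mode k: the generator sends (\<psi>, 0, 0) to (0, -(1 + \<mu>) \<psi>,
  0), and \<psi>t = \<omega> \<psi>, so the square of \<omega> has to be 1 + \<mu>.\<close>

definition \<omega> :: "nat \<Rightarrow> real" where "\<omega> k = sqrt (1 + \<mu> k)"
definition v :: "nat \<Rightarrow> state" where "v k = (\<psi> k, \<lambda>x. 0, \<lambda>x. 0)"
definition w :: "nat \<Rightarrow> state" where "w k = (\<lambda>x. 0, \<psi>t k, \<lambda>x. 0)"

lemma \<mu>_pos: "\<mu> k > 0" and H10_\<psi>t: "H10 \<Omega>S (\<psi>t k)"
  and weak_div_\<psi>t: "has_weak_tensor_div \<Omega>S (lame_stress l0 l1 \<Omega>S (\<psi>t k)) (\<lambda>x. - \<mu> k *\<^sub>R \<psi>t k x)"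
proof -
  have *: "\<mu> k > 0 \<and> dirichlet_lame_eigenfunction l0 l1 \<Omega>S (\<mu> k) (\<psi>t k)"
    using eigenbasis[unfolded adapted_eigenbasis_def, THEN conjunct2, THEN conjunct1] by (rule spec)
  show "\<mu> k > 0" using * by (rule conjunct1)
  note e = *[THEN conjunct2, unfolded dirichlet_lame_eigenfunction_def]
  show "H10 \<Omega>S (\<psi>t k)" using e by (rule conjunct1)
  show "has_weak_tensor_div \<Omega>S (lame_stress l0 l1 \<Omega>S (\<psi>t k)) (\<lambda>x. - \<mu> k *\<^sub>R \<psi>t k x)"
    using e[THEN conjunct2] by (rule conjunct2)
qed

lemma \<psi>t_orthonormal: "l2_inner \<Omega>S (\<psi>t k) (\<psi>t l) = (if k = l then 1 else 0)"
  using eigenbasis[unfolded adapted_eigenbasis_def l2_orthonormal_basis_def, THEN conjunct1, THEN conjunct2, THEN conjunct1]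
  by blast

lemma \<omega>_pos: "\<omega> k > 0" and \<omega>_sq: "\<omega> k * \<omega> k = 1 + \<mu> k"
  using \<mu>_pos[of k] by (simp_all add: \<omega>_def)

lemma \<psi>_eq: "\<psi> k x = (1 / \<omega> k) *\<^sub>R \<psi>t k x"
  by (simp add: psi_def \<omega>_def divide_inverse)

lemma \<psi>t_eq: "\<psi>t k x = \<omega> k *\<^sub>R \<psi> k x"
  using \<omega>_pos[of k] by (simp add: \<psi>_eq)

lemma H10_zero: "H10 \<Omega>S (\<lambda>x. 0)"
  using solid.H10_lincomb[OF H10_\<psi>t H10_\<psi>t, of 0 0 0 0] by simp

lemma H10_\<psi>: "H10 \<Omega>S (\<psi> k)"
proof -
  \<comment> \<open>A multiple, padded by a zero summand to match the lemma on linear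
    combinations.\<close>
  have "\<psi> k = (\<lambda>x. (1 / \<omega> k) *\<^sub>R \<psi>t k x + 0 *\<^sub>R \<psi>t k x)" by (simp add: fun_eq_iff \<psi>_eq)
  then show ?thesis using solid.H10_lincomb[OF H10_\<psi>t H10_\<psi>t, of "1 / \<omega> k" k 0 k] by simp
qed

lemma H1_\<psi>: "H1 \<Omega>S (\<psi> k)" and H1_\<psi>t: "H1 \<Omega>S (\<psi>t k)"
  and L2_\<psi>: "L2 \<Omega>S (\<psi> k)" and L2_\<psi>t: "L2 \<Omega>S (\<psi>t k)"
  using solid.H10_H1[OF H10_\<psi>] solid.H10_H1[OF H10_\<psi>t] by (auto intro: solid.H1_L2)

text \<open>The approximating test fields have compact support in the open solid, hence vanish
  identically on its frontier.\<close>

lemma trace_zero: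
  assumes "H10 \<Omega>S f"
  shows "has_trace \<Omega>S (frontier \<Omega>S) f (\<lambda>x. 0)"
proof -
  obtain \<phi> where \<phi>: "\<And>n. test_fun \<Omega>S (\<phi> n)" "h1_converges \<Omega>S \<phi> f" using assms by (auto simp: H10_def)
  have "\<phi> n x = 0" if "x \<in> frontier \<Omega>S" for n x
  proof -
    have "x \<notin> \<Omega>S" using that solid.open_U by (simp add: frontier_def interior_open)
    moreover obtain C where "C \<subseteq> \<Omega>S" "\<And>x. x \<notin> C \<Longrightarrow> \<phi> n x = 0"
      using \<phi>(1)[of n] unfolding test_fun_def by auto
    ultimately show ?thesis by blast
  qed
  then have "(\<lambda>x. ennreal ((norm (\<phi> n x - 0))\<^sup>2) * indicator (frontier \<Omega>S) x) = (\<lambda>x. 0)" for n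
    by (auto simp: fun_eq_iff indicator_def)
  then have "(\<integral>\<^sup>+x\<in>frontier \<Omega>S. ennreal ((norm (\<phi> n x - 0))\<^sup>2) \<partial>hausdorff2) = 0" for n
    by (simp only: nn_integral_const mult_zero_left)
  then show ?thesis
    unfolding has_trace_def using \<phi> solid.H10_H1[OF assms] test_fun_mono[OF \<phi>(1) subset_UNIV]
    by (intro conjI exI[of _ \<phi>]) auto
qed

lemma fluid_trace_zero: "has_trace \<Omega>F \<Gamma> (\<lambda>x. 0) (\<lambda>x. 0)"
proof -
  have H: "H1 \<Omega>F (\<lambda>x. 0)" by (rule fluid.H1_AE_zero) simp
  have j: "jac (\<lambda>x. 0) x = 0" for x
    by (simp add: vec_eq_iff jac_component[OF test_fun_zero] pd_def frechet_derivative_eqI[OF has_derivative_const])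
  have "AE x in lebesgue_on \<Omega>F. wgrad \<Omega>F (\<lambda>x. 0) x = 0" by (rule fluid.wgrad_AE_zero) simp
  then have "AE x in lebesgue_on \<Omega>F. jac (\<lambda>x. 0) x - wgrad \<Omega>F (\<lambda>x. 0) x = 0"
    by eventually_elim (simp add: j)
  moreover have "L2 \<Omega>F (\<lambda>x. jac (\<lambda>x. 0) x - wgrad \<Omega>F (\<lambda>x. 0) x)"
    using L2_diff[OF L2_0 fluid.wgrad_L2[OF H]] by (simp add: j)
  ultimately have "l2_norm \<Omega>F (\<lambda>x. jac (\<lambda>x. 0) x - wgrad \<Omega>F (\<lambda>x. 0) x) = 0"
    by (simp add: l2_norm_eq_0_iff)
  moreover have "l2_norm \<Omega>F (\<lambda>x. 0 - 0 :: real^3) = 0" by (simp add: l2_norm_def l2_inner_def)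
  ultimately have "h1_converges \<Omega>F (\<lambda>n x. 0) (\<lambda>x. 0)" by (simp add: h1_converges_def)
  then show ?thesis unfolding has_trace_def using H by (intro conjI exI[of _ "\<lambda>n x. 0"]) auto
qed

lemma L2_lame_\<psi>: "L2 \<Omega>S (lame_stress l0 l1 \<Omega>S (\<psi> k))"
  using solid.lame_stress_L2[OF H1_\<psi>] .

lemma weak_div_\<psi>: "has_weak_tensor_div \<Omega>S (lame_stress l0 l1 \<Omega>S (\<psi> k)) (\<lambda>x. - \<mu> k *\<^sub>R \<psi> k x)"
  unfolding has_weak_tensor_div_def
proof (intro allI impI)
  fix \<phi> :: vfield assume \<phi>: "test_fun \<Omega>S \<phi>"
  note L\<phi> = test_field_L2[OF solid.bounded_U solid.sets_U \<phi>]
  note Lt = solid.lame_stress_L2[OF H1_\<psi>t]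
  have eq: "\<psi> k = (\<lambda>x. (1 / \<omega> k) *\<^sub>R \<psi>t k x + 0 *\<^sub>R \<psi>t k x)" by (simp add: fun_eq_iff \<psi>_eq)
  have "l2_inner \<Omega>S (lame_stress l0 l1 \<Omega>S (\<psi> k)) (jac \<phi>) =
      l2_inner \<Omega>S (\<lambda>x. (1 / \<omega> k) *\<^sub>R lame_stress l0 l1 \<Omega>S (\<psi>t k) x + 0 *\<^sub>R lame_stress l0 l1 \<Omega>S (\<psi>t k) x) (jac \<phi>)"
  proof (rule l2_inner_AE_cong)
    show "AE x in lebesgue_on \<Omega>S. lame_stress l0 l1 \<Omega>S (\<psi> k) x =
       (1 / \<omega> k) *\<^sub>R lame_stress l0 l1 \<Omega>S (\<psi>t k) x + 0 *\<^sub>R lame_stress l0 l1 \<Omega>S (\<psi>t k) x"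
      unfolding eq by (rule solid.lame_stress_lincomb[OF H1_\<psi>t H1_\<psi>t])
  qed (intro L2_lame_\<psi> L2_lincomb Lt L\<phi> AE_I2 refl)+
  also have "\<dots> = (1 / \<omega> k) * l2_inner \<Omega>S (lame_stress l0 l1 \<Omega>S (\<psi>t k)) (jac \<phi>)"
    using l2_inner_lincomb[OF Lt[of k] Lt[of k] L\<phi>(2), of "1 / \<omega> k" 0] by simp
  also have "\<dots> = (1 / \<omega> k) * (- l2_inner \<Omega>S (\<lambda>x. - \<mu> k *\<^sub>R \<psi>t k x) \<phi>)"
    using weak_div_\<psi>t \<phi> by (simp add: has_weak_tensor_div_def)
  also have "\<dots> = - l2_inner \<Omega>S (\<lambda>x. - \<mu> k *\<^sub>R \<psi> k x) \<phi>"
    by (simp add: l2_inner_def \<psi>_eq)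
  finally show "l2_inner \<Omega>S (lame_stress l0 l1 \<Omega>S (\<psi> k)) (jac \<phi>) = - l2_inner \<Omega>S (\<lambda>x. - \<mu> k *\<^sub>R \<psi> k x) \<phi>" .
qed

abbreviation rest_stress :: "real \<Rightarrow> tfield" where
  "rest_stress c \<equiv> fluid_stress \<nu> \<Omega>F (\<lambda>x. 0) (\<lambda>x. c)"

text \<open>The equation holds almost everywhere only, since the weak gradient chosen for the zero
  field need not be literally zero.\<close>

lemma fluid_stress_zero:
  "AE x in lebesgue_on \<Omega>F. rest_stress c x = (- c) *\<^sub>R mat 1"
  "L2 \<Omega>F (rest_stress c)"
proof -
  have H: "H1 \<Omega>F (\<lambda>x. 0)" by (rule fluid.H1_AE_zero) simp
  have "AE x in lebesgue_on \<Omega>F. wgrad \<Omega>F (\<lambda>x. 0) x = 0" by (rule fluid.wgrad_AE_zero) simp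
  then show "AE x in lebesgue_on \<Omega>F. rest_stress c x = (- c) *\<^sub>R mat 1"
    by eventually_elim (simp add: fluid_stress_def fluid.sgrad_eq linear_0[OF linear_symm])
  show "L2 \<Omega>F (rest_stress c)"
    unfolding fluid_stress_def[abs_def]
    by (intro L2_diff L2_scaleR fluid.sgrad_L2 H L2_const fluid.bounded_U fluid.sets_U)
qed

lemma fluid_stress_zero_inner:
  assumes "L2 \<Omega>F G"
  shows "l2_inner \<Omega>F (rest_stress c) G = - c * (\<integral>x. trace (G x) \<partial>lebesgue_on \<Omega>F)"
proof -
  have "l2_inner \<Omega>F (rest_stress c) G = l2_inner \<Omega>F (\<lambda>x. (- c) *\<^sub>R mat 1) G"
    by (rule l2_inner_AE_cong) (intro fluid_stress_zero AE_I2 refl assms L2_const fluid.bounded_U fluid.sets_U)+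
  then show ?thesis by (simp add: l2_inner_def inner_mat_1)
qed

lemma weak_div_fluid_stress_zero: "has_weak_tensor_div \<Omega>F (rest_stress c) (\<lambda>x. 0)"
  unfolding has_weak_tensor_div_def
proof (intro allI impI)
  fix \<phi> :: vfield assume \<phi>: "test_fun \<Omega>F \<phi>"
  show "l2_inner \<Omega>F (rest_stress c) (jac \<phi>) = - l2_inner \<Omega>F (\<lambda>x. 0) \<phi>"
    using fluid_stress_zero_inner[OF test_field_L2(2)[OF fluid.bounded_U fluid.sets_U \<phi>]]
      fluid.test_field_integrals(1)[OF \<phi>] by (simp add: l2_inner_def)
qed

lemma lame_zero_inner:
  assumes "L2 \<Omega>S G"
  shows "l2_inner \<Omega>S (lame_stress l0 l1 \<Omega>S (\<lambda>x. 0)) G = 0"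
proof -
  have H: "H1 \<Omega>S (\<lambda>x. 0)" by (rule solid.H1_AE_zero) simp
  have "l2_inner \<Omega>S (lame_stress l0 l1 \<Omega>S (\<lambda>x. 0)) G = l2_inner \<Omega>S (\<lambda>x. 0 :: real^3^3) G"
    by (rule l2_inner_AE_cong)
       (intro solid.lame_stress_AE_zero solid.lame_stress_L2 H AE_I2 refl assms L2_0)+
  then show ?thesis by (simp add: l2_inner_def)
qed

text \<open>A velocity in H^1_0 matches a fluid at rest at the interface, and a constant pressure
  has no force density; only the balance of normal stresses remains to be supplied.\<close>

lemma resting_generatorI:
  assumes "H1 \<Omega>S \<xi>" "H10 \<Omega>S \<zeta>" "has_weak_tensor_div \<Omega>S (lame_stress l0 l1 \<Omega>S \<xi>) f" "L2 \<Omega>S f"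
    and balance: "\<And>\<phi>. H10 \<Omega> \<phi> \<Longrightarrow>
      - normal_pairing \<Omega>F (rest_stress c) (\<lambda>x. 0) \<phi> =
      normal_pairing \<Omega>S (lame_stress l0 l1 \<Omega>S \<xi>) f \<phi>"
  shows "fsi_generator \<nu> l0 l1 \<Omega> \<Omega>S (\<xi>, \<zeta>, \<lambda>x. 0) (\<zeta>, \<lambda>x. f x - \<xi> x, \<lambda>x. 0)"
  unfolding fsi_generator.simps
proof (intro conjI)
  show "H1 \<Omega>F (\<lambda>x. 0)" by (rule fluid.H1_AE_zero) simp
  show LS0: "L_S \<Omega> \<Omega>S (\<lambda>x. 0)" by (rule L_S_AE_zero) simp
  show "\<exists>g. has_trace \<Omega>F (frontier \<Omega>S) (\<lambda>x. 0) g \<and> has_trace \<Omega>S (frontier \<Omega>S) \<zeta> g"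
    by (rule exI[of _ "\<lambda>x. 0"]) (intro conjI fluid_trace_zero trace_zero assms)
  show "\<exists>f' h. \<exists>p :: real^3 \<Rightarrow> real.
        L2 \<Omega>S f' \<and> has_weak_tensor_div \<Omega>S (lame_stress l0 l1 \<Omega>S \<xi>) f' \<and>
        L2 \<Omega>F p \<and> L_S \<Omega> \<Omega>S h \<and> has_weak_tensor_div \<Omega>F (fluid_stress \<nu> \<Omega>F (\<lambda>x. 0) p) h \<and>
        (\<forall>\<phi>. H10 \<Omega> \<phi> \<longrightarrow> - normal_pairing \<Omega>F (fluid_stress \<nu> \<Omega>F (\<lambda>x. 0) p) h \<phi> =
           normal_pairing \<Omega>S (lame_stress l0 l1 \<Omega>S \<xi>) f' \<phi>) \<and>
        state_eq \<Omega> \<Omega>S (\<zeta>, \<lambda>x. f x - \<xi> x, \<lambda>x. 0) (\<zeta>, \<lambda>x. f' x - \<xi> x, h)"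
    by (rule exI[of _ f], rule exI[of _ "\<lambda>x. 0"], rule exI[of _ "\<lambda>x. c"])
       (intro conjI assms LS0 weak_div_fluid_stress_zero L2_const fluid.bounded_U fluid.sets_U allI impI balance;
        simp)
qed (intro assms solid.H10_H1 fluid_trace_zero)+

text \<open>The fluid at rest under the constant pressure \<open>- q\<close> balances the boundary stress \<open>q n\<close>
  of an overdetermined eigenfunction.\<close>
lemma generator_v:
  assumes "k \<in> K"
  shows "fsi_generator \<nu> l0 l1 \<Omega> \<Omega>S (v k) ((- \<omega> k) *\<^sub>R w k)"
proof -
  obtain q where q: "solves_P l0 l1 \<Omega>S (\<mu> k) (\<psi> k) q" using assms by (auto simp: K_set_def)
  \<comment> \<open>Pressure \<open>- q\<close> gives the fluid stress q Id, so both pairings are q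
    times the integral of div \<phi>, over the fluid and over the solid. These integrals add up to
    zero, which agrees with the sign in front of the fluid pairing.\<close>
  have balance: "- normal_pairing \<Omega>F (rest_stress (- q)) (\<lambda>x. 0) \<phi> =
      normal_pairing \<Omega>S (lame_stress l0 l1 \<Omega>S (\<psi> k)) (\<lambda>x. - \<mu> k *\<^sub>R \<psi> k x) \<phi>" if \<phi>: "H10 \<Omega> \<phi>" for \<phi>
  proof -
    note d = integral_wdiv_split[OF \<phi>]
    have "normal_pairing \<Omega>F (rest_stress (- q)) (\<lambda>x. 0) \<phi> = q * (\<integral>x. wdiv \<Omega>F \<phi> x \<partial>lebesgue_on \<Omega>F)"
      using fluid_stress_zero_inner[OF fluid.wgrad_L2[OF d(2)]]
      by (simp add: normal_pairing_def l2_inner_def[of _ "\<lambda>x. 0"] wdiv_def[abs_def])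
    moreover have "normal_pairing \<Omega>S (lame_stress l0 l1 \<Omega>S (\<psi> k)) (\<lambda>x. - \<mu> k *\<^sub>R \<psi> k x) \<phi> =
        q * (\<integral>x. wdiv \<Omega>S \<phi> x \<partial>lebesgue_on \<Omega>S)"
    proof -
      have "l2_inner \<Omega>S (lame_stress l0 l1 \<Omega>S (\<psi> k)) (wgrad \<Omega>S \<phi>) - \<mu> k * l2_inner \<Omega>S (\<psi> k) \<phi> =
        q * (\<integral>x. wdiv \<Omega>S \<phi> x \<partial>lebesgue_on \<Omega>S)"
        using q d(1) by (simp add: solves_P_def)
      moreover have "l2_inner \<Omega>S (\<lambda>x. - \<mu> k *\<^sub>R \<psi> k x) \<phi> = - \<mu> k * l2_inner \<Omega>S (\<psi> k) \<phi>"
        by (simp add: l2_inner_def)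
      ultimately show ?thesis by (simp add: normal_pairing_def)
    qed
    moreover have "q * (\<integral>x. wdiv \<Omega>S \<phi> x \<partial>lebesgue_on \<Omega>S) + q * (\<integral>x. wdiv \<Omega>F \<phi> x \<partial>lebesgue_on \<Omega>F) = 0"
      unfolding distrib_left[symmetric] d(3) by simp
    ultimately show ?thesis by linarith
  qed
  have eq: "(- \<omega> k) *\<^sub>R w k = (\<lambda>x. 0, \<lambda>x. - \<mu> k *\<^sub>R \<psi> k x - \<psi> k x, \<lambda>x. 0)"
  proof -
    have "- \<omega> k *\<^sub>R \<psi>t k x = - \<mu> k *\<^sub>R \<psi> k x - \<psi> k x" for x
    proof -
      have "- \<omega> k *\<^sub>R \<psi>t k x = - (\<omega> k * \<omega> k) *\<^sub>R \<psi> k x" by (simp add: \<psi>t_eq)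
      then show ?thesis unfolding \<omega>_sq by (simp add: algebra_simps)
    qed
    then show ?thesis by (simp add: w_def fun_eq_iff)
  qed
  have "L2 \<Omega>S (\<lambda>x. - \<mu> k *\<^sub>R \<psi> k x)" by (rule L2_scaleR[OF L2_\<psi>])
  then show ?thesis
    unfolding v_def eq
    by (rule resting_generatorI[OF H1_\<psi> H10_zero weak_div_\<psi>])
       (use balance in auto)
qed

text \<open>With zero displacement there is no elastic stress, and pressure 0 balances it; the
  velocity \<psi>t vanishes at the interface.\<close>

lemma generator_w: "fsi_generator \<nu> l0 l1 \<Omega> \<Omega>S (w k) (\<omega> k *\<^sub>R v k)"
proof -
  have balance: "- normal_pairing \<Omega>F (rest_stress 0) (\<lambda>x. 0) \<phi> =
      normal_pairing \<Omega>S (lame_stress l0 l1 \<Omega>S (\<lambda>x. 0)) (\<lambda>x. 0) \<phi>" if \<phi>: "H10 \<Omega> \<phi>" for \<phi>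
    using fluid_stress_zero_inner[OF fluid.wgrad_L2[OF integral_wdiv_split(2)[OF \<phi>]], of 0]
      lame_zero_inner[OF solid.wgrad_L2[OF integral_wdiv_split(1)[OF \<phi>]]]
    by (simp add: normal_pairing_def l2_inner_def[of _ "\<lambda>x. 0"])
  have div0: "has_weak_tensor_div \<Omega>S (lame_stress l0 l1 \<Omega>S (\<lambda>x. 0)) (\<lambda>x. 0)"
    using lame_zero_inner[OF test_field_L2(2)[OF solid.bounded_U solid.sets_U]]
    by (simp add: has_weak_tensor_div_def l2_inner_def[of _ "\<lambda>x. 0"])
  have eq: "\<omega> k *\<^sub>R v k = (\<psi>t k, \<lambda>x. 0 - 0, \<lambda>x. 0)"
    by (simp add: v_def fun_eq_iff \<psi>t_eq)
  show ?thesis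
    unfolding w_def eq
    by (rule resting_generatorI[OF solid.H10_H1[OF H10_zero] H10_\<psi>t div0 L2_0, where c = 0])
       (use balance in auto)
qed

text \<open>Testing (P) with the other eigenfunction kills the term with q, because fields in H^1_0
  have no flux. The energy product is thus 1 + \<mu> times the L^2 product, and the normalisation by
  \<omega> cancels this factor.\<close>

lemma \<psi>_orthonormal:
  assumes "k \<in> K"
  shows "h1_inner l0 l1 \<Omega>S (\<psi> k) (\<psi> l) = (if k = l then 1 else 0)"
proof -
  obtain q where q: "solves_P l0 l1 \<Omega>S (\<mu> k) (\<psi> k) q" using assms by (auto simp: K_set_def)
  have "l2_inner \<Omega>S (lame_stress l0 l1 \<Omega>S (\<psi> k)) (wgrad \<Omega>S (\<psi> l)) - \<mu> k * l2_inner \<Omega>S (\<psi> k) (\<psi> l) = 0"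
    using q H1_\<psi>[of l] solid.integral_wdiv_H10[OF H10_\<psi>[of l]] by (simp add: solves_P_def)
  then have "h1_inner l0 l1 \<Omega>S (\<psi> k) (\<psi> l) = (1 + \<mu> k) * l2_inner \<Omega>S (\<psi> k) (\<psi> l)"
    by (simp add: h1_inner_def solid.lame_inner_sgrad algebra_simps)
  also have "l2_inner \<Omega>S (\<psi> k) (\<psi> l) = (1 / \<omega> k) * (1 / \<omega> l) * l2_inner \<Omega>S (\<psi>t k) (\<psi>t l)"
    by (simp add: l2_inner_def \<psi>_eq)
  finally show ?thesis
    using \<omega>_pos[of k] \<omega>_pos[of l] by (simp add: \<psi>t_orthonormal flip: \<omega>_sq)
qed

lemma v_X [simp]: "v k \<in> X \<Omega> \<Omega>S" and w_X [simp]: "w k \<in> X \<Omega> \<Omega>S"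
  using H1_\<psi>[of k] L2_\<psi>t[of k] solid.H1_AE_zero[of "\<lambda>x. 0"] L_S_AE_zero[of "\<lambda>x. 0"]
  by (simp_all add: X_iff v_def w_def)

lemma sinner_v: 
  assumes "x \<in> X \<Omega> \<Omega>S" shows "sinner x (v k) = h1_inner l0 l1 \<Omega>S (fst x) (\<psi> k)"
  by (simp add: sinner_def v_def l2_inner_def[of _ _ "\<lambda>x. 0"])

lemma sinner_w:
  assumes "x \<in> X \<Omega> \<Omega>S" shows "sinner x (w k) = l2_inner \<Omega>S (fst (snd x)) (\<psi>t k)"
proof -
  have "h1_inner l0 l1 \<Omega>S (fst x) (\<lambda>x. 0) = 0"
    using solid.h1.zero_right[of "fst x"] assms by (simp add: X_iff zero_fun_def)
  then show ?thesis by (simp add: sinner_def w_def l2_inner_def[of _ _ "\<lambda>x. 0"])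
qed

lemma rotation:
  assumes "k \<in> K"
  shows "rotation_pair (X \<Omega> \<Omega>S) sinner S (v k) (w k) (\<omega> k)"
proof
  show "((\<lambda>t. energy.nrm ((1/t) *\<^sub>R S t (v k) - (1/t) *\<^sub>R v k - (- \<omega> k) *\<^sub>R w k)) \<longlongrightarrow> 0) (at_right 0)"
    by (rule generator_limit[OF generator_v[OF assms]]) (intro v_X w_X energy.V_scale)+
  show "((\<lambda>t. energy.nrm ((1/t) *\<^sub>R S t (w k) - (1/t) *\<^sub>R w k - \<omega> k *\<^sub>R v k)) \<longlongrightarrow> 0) (at_right 0)"
    by (rule generator_limit[OF generator_w]) (intro v_X w_X energy.V_scale)+
  show "sinner (v k) (v k) = 1" using \<psi>_orthonormal[OF assms, of k] by (simp add: sinner_v) (simp add: v_def)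
  show "sinner (w k) (w k) = 1" using \<psi>t_orthonormal[of k k] by (simp add: sinner_w) (simp add: w_def)
  show "sinner (v k) (w k) = 0" by (simp add: sinner_w) (simp add: v_def l2_inner_def)
qed (simp_all add: \<omega>_pos)

section \<open>The projections\<close>

abbreviation PW :: "state \<Rightarrow> state" where "PW \<equiv> proj_W l0 l1 \<Omega>S \<psi>t \<mu>"

text \<open>The limit that \<open>proj_W_xi\<close> chooses exists: Bessel bounds the coefficients,
  and completeness yields the witness for the choice.\<close>

lemma proj_W_xi:
  assumes \<xi>: "H1 \<Omega>S \<xi>"
  shows "H1 \<Omega>S (proj_W_xi l0 l1 \<Omega>S \<psi>t \<mu> \<xi>)"
    "((\<lambda>F. h1_norm l0 l1 \<Omega>S ((\<Sum>k\<in>F. h1_inner l0 l1 \<Omega>S \<xi> (\<psi> k) *\<^sub>R \<psi> k) - proj_W_xi l0 l1 \<Omega>S \<psi>t \<mu> \<xi>)) \<longlongrightarrow> 0)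
       (finite_subsets_at_top K)"
proof -
  define c where "c k = h1_inner l0 l1 \<Omega>S \<xi> (\<psi> k)" for k
  obtain \<eta> where \<eta>: "\<eta> \<in> {f. H1 \<Omega>S f}"
    "((\<lambda>F. solid.h1.nrm ((\<Sum>k\<in>F. c k *\<^sub>R \<psi> k) - \<eta>)) \<longlongrightarrow> 0) (finite_subsets_at_top K)"
  proof (rule solid.h1.Fourier_net_limit[where K = K and e = \<psi> and c = c and M = "h1_inner l0 l1 \<Omega>S \<xi> \<xi>"])
    show "\<psi> k \<in> {f. H1 \<Omega>S f}" for k using H1_\<psi> by simp
    show "h1_inner l0 l1 \<Omega>S (\<psi> k) (\<psi> l) = (if k = l then 1 else 0)" if "k \<in> K" for k l
      using that by (rule \<psi>_orthonormal)
    show "(\<Sum>k\<in>F. (c k)\<^sup>2) \<le> h1_inner l0 l1 \<Omega>S \<xi> \<xi>" if "finite F" "F \<subseteq> K" for F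
      unfolding c_def using that \<xi> H1_\<psi> \<psi>_orthonormal
      by (intro solid.h1.Bessel) (auto simp: subset_iff)
    fix s assume s: "\<And>n. s n = (\<Sum>k\<in>K \<inter> {..<n}. c k *\<^sub>R \<psi> k)"
      and Cauchy: "\<And>\<epsilon>. \<epsilon> > 0 \<Longrightarrow> \<exists>N. \<forall>m\<ge>N. \<forall>n\<ge>N. solid.h1.nrm (s m - s n) < \<epsilon>"
    \<comment> \<open>Completeness of the energy norm is available for sequences in H^1_0, so the
      partial sums must stay there.\<close>
    have "H10 \<Omega>S (\<Sum>k\<in>F. c k *\<^sub>R \<psi> k)" for F
    proof (induction F rule: infinite_finite_induct)
      case (insert k F)
      then show ?case
        using solid.H10_lincomb[OF H10_\<psi>[of k] insert.IH, of "c k" 1]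
        by (simp add: plus_fun_def scaleR_fun_def)
    qed (use H10_zero in \<open>simp_all add: zero_fun_def\<close>)
    then have "H10 \<Omega>S (s n)" for n unfolding s .
    then obtain \<eta> where "H1 \<Omega>S \<eta>" "(\<lambda>n. h1_norm l0 l1 \<Omega>S (\<lambda>x. s n x - \<eta> x)) \<longlonglongrightarrow> 0"
      by (rule solid.H10_complete) (use Cauchy in \<open>simp_all add: solid.h1_nrm_eq fun_diff_def\<close>)
    then show "\<exists>\<eta>\<in>{f. H1 \<Omega>S f}. (\<lambda>n. solid.h1.nrm (s n - \<eta>)) \<longlonglongrightarrow> 0"
      by (auto simp: solid.h1_nrm_eq fun_diff_def)
  qed (use that in blast)
  have conv: "(\<lambda>x. (\<Sum>k\<in>F. c k *\<^sub>R \<psi> k x) - \<eta> x) = (\<Sum>k\<in>F. c k *\<^sub>R \<psi> k) - \<eta>" for F \<eta>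
    by (simp add: fun_eq_iff)
  have "H1 \<Omega>S (proj_W_xi l0 l1 \<Omega>S \<psi>t \<mu> \<xi>) \<and>
     ((\<lambda>F. h1_norm l0 l1 \<Omega>S (\<lambda>x. (\<Sum>k\<in>F. c k *\<^sub>R \<psi> k x) - proj_W_xi l0 l1 \<Omega>S \<psi>t \<mu> \<xi> x)) \<longlongrightarrow> 0)
       (finite_subsets_at_top K)"
    unfolding proj_W_xi_def c_def[symmetric]
    by (rule someI[of _ \<eta>]) (use \<eta> in \<open>simp add: solid.h1_nrm_eq conv\<close>)
  then show "H1 \<Omega>S (proj_W_xi l0 l1 \<Omega>S \<psi>t \<mu> \<xi>)"
    "((\<lambda>F. h1_norm l0 l1 \<Omega>S ((\<Sum>k\<in>F. h1_inner l0 l1 \<Omega>S \<xi> (\<psi> k) *\<^sub>R \<psi> k) - proj_W_xi l0 l1 \<Omega>S \<psi>t \<mu> \<xi>)) \<longlongrightarrow> 0)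
       (finite_subsets_at_top K)"
    by (simp_all only: conv c_def[symmetric])
qed

lemma proj_W_zeta:
  assumes \<zeta>: "L2 \<Omega>S \<zeta>"
  shows "L2 \<Omega>S (proj_W_zeta l0 l1 \<Omega>S \<psi>t \<mu> \<zeta>)"
    "((\<lambda>F. l2_norm \<Omega>S ((\<Sum>k\<in>F. l2_inner \<Omega>S \<zeta> (\<psi>t k) *\<^sub>R \<psi>t k) - proj_W_zeta l0 l1 \<Omega>S \<psi>t \<mu> \<zeta>)) \<longlongrightarrow> 0)
       (finite_subsets_at_top K)"
proof -
  define c where "c k = l2_inner \<Omega>S \<zeta> (\<psi>t k)" for k
  obtain \<eta> where \<eta>: "\<eta> \<in> {f. L2 \<Omega>S f}"
    "((\<lambda>F. l2.nrm \<Omega>S ((\<Sum>k\<in>F. c k *\<^sub>R \<psi>t k) - \<eta>)) \<longlongrightarrow> 0) (finite_subsets_at_top K)"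
  proof (rule l2.Fourier_net_limit[where K = K and e = \<psi>t and c = c and M = "l2_inner \<Omega>S \<zeta> \<zeta>"])
    show "\<psi>t k \<in> {f. L2 \<Omega>S f}" for k using L2_\<psi>t by simp
    show "l2_inner \<Omega>S (\<psi>t k) (\<psi>t l) = (if k = l then 1 else 0)" for k l
      by (rule \<psi>t_orthonormal)
    show "(\<Sum>k\<in>F. (c k)\<^sup>2) \<le> l2_inner \<Omega>S \<zeta> \<zeta>" if "finite F" for F
      unfolding c_def using that \<zeta> L2_\<psi>t \<psi>t_orthonormal
      by (intro l2.Bessel) auto
    fix s assume s: "\<And>n. s n = (\<Sum>k\<in>K \<inter> {..<n}. c k *\<^sub>R \<psi>t k)"
      and Cauchy: "\<And>\<epsilon>. \<epsilon> > 0 \<Longrightarrow> \<exists>N. \<forall>m\<ge>N. \<forall>n\<ge>N. l2.nrm \<Omega>S (s m - s n) < \<epsilon>"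
    have "(\<Sum>k\<in>F. c k *\<^sub>R \<psi>t k) \<in> {f. L2 \<Omega>S f}" for F
      using L2_\<psi>t by (intro l2.V_sum l2.V_scale) simp
    then have "L2 \<Omega>S (s n)" for n unfolding s by simp
    then obtain \<eta> where "L2 \<Omega>S \<eta>" "(\<lambda>n. l2_norm \<Omega>S (\<lambda>x. s n x - \<eta> x)) \<longlonglongrightarrow> 0"
      by (rule L2_complete[OF solid.bounded_U solid.sets_U]) (use Cauchy in \<open>simp_all add: fun_diff_def\<close>)
    then show "\<exists>\<eta>\<in>{f. L2 \<Omega>S f}. (\<lambda>n. l2.nrm \<Omega>S (s n - \<eta>)) \<longlonglongrightarrow> 0"
      by (auto simp: fun_diff_def)
  qed (use that in blast)
  have conv: "(\<lambda>x. (\<Sum>k\<in>F. c k *\<^sub>R \<psi>t k x) - \<eta> x) = (\<Sum>k\<in>F. c k *\<^sub>R \<psi>t k) - \<eta>" for F \<eta>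
    by (simp add: fun_eq_iff)
  have "L2 \<Omega>S (proj_W_zeta l0 l1 \<Omega>S \<psi>t \<mu> \<zeta>) \<and>
     ((\<lambda>F. l2_norm \<Omega>S (\<lambda>x. (\<Sum>k\<in>F. c k *\<^sub>R \<psi>t k x) - proj_W_zeta l0 l1 \<Omega>S \<psi>t \<mu> \<zeta> x)) \<longlongrightarrow> 0)
       (finite_subsets_at_top K)"
    unfolding proj_W_zeta_def c_def[symmetric]
    by (rule someI[of _ \<eta>]) (use \<eta> in \<open>simp add: conv\<close>)
  then show "L2 \<Omega>S (proj_W_zeta l0 l1 \<Omega>S \<psi>t \<mu> \<zeta>)"
    "((\<lambda>F. l2_norm \<Omega>S ((\<Sum>k\<in>F. l2_inner \<Omega>S \<zeta> (\<psi>t k) *\<^sub>R \<psi>t k) - proj_W_zeta l0 l1 \<Omega>S \<psi>t \<mu> \<zeta>)) \<longlongrightarrow> 0)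
       (finite_subsets_at_top K)"
    by (simp_all only: conv c_def[symmetric])
qed

section \<open>Modes and commutation with the semigroup\<close>

definition mode :: "real \<Rightarrow> real \<Rightarrow> nat \<Rightarrow> state" where
  "mode a b k = a *\<^sub>R v k + b *\<^sub>R w k"

lemma mode_X [simp]: "mode a b k \<in> X \<Omega> \<Omega>S"
  unfolding mode_def by (intro energy.V_add energy.V_scale v_X w_X)

lemma mode_components:
  "fst (\<Sum>k\<in>F. mode (a k) (b k) k) = (\<Sum>k\<in>F. a k *\<^sub>R \<psi> k)"
  "fst (snd (\<Sum>k\<in>F. mode (a k) (b k) k)) = (\<Sum>k\<in>F. b k *\<^sub>R \<psi>t k)"
  "snd (snd (\<Sum>k\<in>F. mode (a k) (b k) k)) = 0"
  by (simp_all add: mode_def v_def w_def fst_sum snd_sum fun_eq_iff)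

lemma PW_X:
  assumes "x \<in> X \<Omega> \<Omega>S"
  shows "PW x \<in> X \<Omega> \<Omega>S"
  using assms proj_W_xi(1)[of "fst x"] proj_W_zeta(1)[of "fst (snd x)"] L_S_AE_zero[of "\<lambda>x. 0"]
  by (cases x) (simp add: X_iff)

text \<open>The displacement and velocity series converge along the same net of finite sets, so
  their partial sums can be paired mode by mode, which is the form the rotations act on.\<close>

lemma PW_limit:
  assumes x: "x \<in> X \<Omega> \<Omega>S"
  shows "((\<lambda>F. energy.nrm ((\<Sum>k\<in>F. mode (sinner x (v k)) (sinner x (w k)) k) - PW x)) \<longlongrightarrow> 0)
    (finite_subsets_at_top K)"
proof (rule Lim_null_comparison)
  let ?p = "proj_W_xi l0 l1 \<Omega>S \<psi>t \<mu> (fst x)" and ?q = "proj_W_zeta l0 l1 \<Omega>S \<psi>t \<mu> (fst (snd x))"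
  let ?a = "\<lambda>F. h1_norm l0 l1 \<Omega>S ((\<Sum>k\<in>F. sinner x (v k) *\<^sub>R \<psi> k) - ?p)"
  let ?b = "\<lambda>F. l2_norm \<Omega>S ((\<Sum>k\<in>F. sinner x (w k) *\<^sub>R \<psi>t k) - ?q)"
  have "((\<lambda>F. ?a F + ?b F) \<longlongrightarrow> 0 + 0) (finite_subsets_at_top K)"
    using x proj_W_xi(2)[of "fst x"] proj_W_zeta(2)[of "fst (snd x)"]
    by (intro tendsto_add) (auto simp: sinner_v sinner_w X_iff)
  then show "((\<lambda>F. ?a F + ?b F) \<longlongrightarrow> 0) (finite_subsets_at_top K)" by simp
  have PW: "PW x = (?p, ?q, \<lambda>x. 0)" by (cases x) simp
  show "\<forall>\<^sub>F F in finite_subsets_at_top K. norm (energy.nrm ((\<Sum>k\<in>F. mode (sinner x (v k)) (sinner x (w k)) k) - PW x)) \<le> ?a F + ?b F"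
  proof (intro always_eventually allI)
    fix F
    have X: "(\<Sum>k\<in>F. mode (sinner x (v k)) (sinner x (w k)) k) - PW x \<in> X \<Omega> \<Omega>S"
      using PW_X[OF x] by (intro energy.V_diff energy.V_sum mode_X)
    have "l2_norm \<Omega>F (0 - (\<lambda>x. 0 :: real^3)) = 0" by (simp add: l2_norm_def l2_inner_def)
    then show "norm (energy.nrm ((\<Sum>k\<in>F. mode (sinner x (v k)) (sinner x (w k)) k) - PW x)) \<le> ?a F + ?b F"
      using energy_nrm_le[OF X] energy.nrm_nonneg[OF X] by (simp add: mode_components PW)
  qed
qed

text \<open>The same map of coefficient pairs describes the action of the semigroup on a mode and
  the change of the coefficients of an arbitrary state. This coincidence is the commutation for
  finite sums.\<close>

definition rot :: "real \<Rightarrow> nat \<Rightarrow> real \<Rightarrow> real \<Rightarrow> real \<times> real" where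
  "rot t k a b = (cos (\<omega> k * t) * a + sin (\<omega> k * t) * b, cos (\<omega> k * t) * b - sin (\<omega> k * t) * a)"

lemma S_mode:
  assumes t: "t > 0" and k: "k \<in> K"
  shows "energy.nrm (S t (mode a b k) - mode (fst (rot t k a b)) (snd (rot t k a b)) k) = 0"
proof -
  interpret rotation_pair "X \<Omega> \<Omega>S" sinner S "v k" "w k" "\<omega> k" using k by (rule rotation)
  show ?thesis using T_pair[OF t, of a b] by (simp only: mode_def rot_def fst_conv snd_conv)
qed

lemma S_mode_sum:
  assumes t: "t > 0" and F: "finite F" "F \<subseteq> K"
  shows "energy.nrm (S t (\<Sum>k\<in>F. mode (a k) (b k) k) -
    (\<Sum>k\<in>F. mode (fst (rot t k (a k) (b k))) (snd (rot t k (a k) (b k))) k)) = 0"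
proof -
  let ?m = "\<lambda>k. mode (a k) (b k) k"
  let ?r = "\<lambda>k. mode (fst (rot t k (a k) (b k))) (snd (rot t k (a k) (b k))) k"
  have SX: "S t (?m k) \<in> X \<Omega> \<Omega>S" "S t (\<Sum>k\<in>F. ?m k) \<in> X \<Omega> \<Omega>S" for k
    using t by (auto intro!: flow.T_V energy.V_sum)
  have "energy.nrm (\<Sum>k\<in>F. S t (?m k) - ?r k) = 0"
    using F SX S_mode[OF t] by (intro energy.nrm_sum_null energy.V_diff mode_X) auto
  then have 1: "energy.nrm ((\<Sum>k\<in>F. S t (?m k)) - (\<Sum>k\<in>F. ?r k)) = 0" by (simp add: sum_subtractf)
  have 2: "energy.nrm (S t (\<Sum>k\<in>F. ?m k) - (\<Sum>k\<in>F. S t (?m k))) = 0"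
    using t F by (intro flow.T_sum) auto
  have "energy.nrm (S t (\<Sum>k\<in>F. ?m k) - (\<Sum>k\<in>F. ?r k)) \<le>
      energy.nrm (S t (\<Sum>k\<in>F. ?m k) - (\<Sum>k\<in>F. S t (?m k))) + energy.nrm ((\<Sum>k\<in>F. S t (?m k)) - (\<Sum>k\<in>F. ?r k))"
    using SX by (intro energy.nrm_triangle_diff energy.V_sum mode_X)
  then have "energy.nrm (S t (\<Sum>k\<in>F. ?m k) - (\<Sum>k\<in>F. ?r k)) \<le> 0" using 1 2 by linarith
  then show ?thesis using SX by (intro antisym energy.nrm_nonneg energy.V_diff energy.V_sum mode_X)
qed

lemma S_coeffs:
  assumes "t > 0" "k \<in> K" "x \<in> X \<Omega> \<Omega>S"
  shows "(sinner (S t x) (v k), sinner (S t x) (w k)) = rot t k (sinner x (v k)) (sinner x (w k))"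
proof -
  interpret rotation_pair "X \<Omega> \<Omega>S" sinner S "v k" "w k" "\<omega> k" using assms(2) by (rule rotation)
  show ?thesis using T_coeffs[OF assms(1,3)] by (simp add: rot_def)
qed

text \<open>For finite index sets the partial sum of \<open>S t x\<close> is, up to a null vector,
  the image under \<open>S t\<close> of the partial sum of \<open>x\<close>. Contractivity keeps the
  image of the remainder small, so both remainders vanish along the net.\<close>

theorem PW_commutes:
  assumes t: "t > 0" and x: "x \<in> X \<Omega> \<Omega>S"
  shows "energy.nrm (PW (S t x) - S t (PW x)) = 0"
proof -
  define s where "s y F = (\<Sum>k\<in>F. mode (sinner y (v k)) (sinner y (w k)) k)" for y F
  have sX: "s y F \<in> X \<Omega> \<Omega>S" for y F unfolding s_def by (intro energy.V_sum mode_X)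
  note Sx = flow.T_V[OF t x]
  note PX = PW_X[OF x] and SPX = flow.T_V[OF t PW_X[OF x]] and PSX = PW_X[OF Sx] and SsX = flow.T_V[OF t sX]
  have "((\<lambda>F. energy.nrm (s (S t x) F - PW (S t x)) + energy.nrm (s x F - PW x)) \<longlongrightarrow> 0 + 0) (finite_subsets_at_top K)"
    unfolding s_def by (intro tendsto_add PW_limit Sx x)
  then have lim: "((\<lambda>F. energy.nrm (s (S t x) F - PW (S t x)) + energy.nrm (s x F - PW x)) \<longlongrightarrow> 0) (finite_subsets_at_top K)"
    by simp
  have "\<forall>\<^sub>F F in finite_subsets_at_top K. energy.nrm (PW (S t x) - S t (PW x)) \<le>
      energy.nrm (s (S t x) F - PW (S t x)) + energy.nrm (s x F - PW x)"
  proof (rule eventually_finite_subsets_at_top_weakI)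
    fix F assume F: "finite F" "F \<subseteq> K"
    have "s (S t x) F = (\<Sum>k\<in>F. mode (fst (rot t k (sinner x (v k)) (sinner x (w k)))) (snd (rot t k (sinner x (v k)) (sinner x (w k)))) k)"
      unfolding s_def by (intro sum.cong refl) (simp add: S_coeffs[OF t subsetD[OF F(2)] x, symmetric])
    then have 1: "energy.nrm (S t (s x F) - s (S t x) F) = 0"
      using S_mode_sum[OF t F] by (simp add: s_def)
    have "energy.nrm (PW (S t x) - S t (PW x)) \<le> energy.nrm (PW (S t x) - s (S t x) F) + energy.nrm (s (S t x) F - S t (PW x))"
      by (intro energy.nrm_triangle_diff PSX sX SPX)
    also have "energy.nrm (s (S t x) F - S t (PW x)) \<le> energy.nrm (s (S t x) F - S t (s x F)) + energy.nrm (S t (s x F) - S t (PW x))"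
      by (intro energy.nrm_triangle_diff SsX sX SPX)
    also have "energy.nrm (S t (s x F) - S t (PW x)) \<le> energy.nrm (s x F - PW x)"
      by (intro flow.T_contr_diff t sX PX)
    also have "energy.nrm (s (S t x) F - S t (s x F)) = 0"
      using 1 energy.nrm_minus_commute[OF sX SsX] by simp
    also have "energy.nrm (PW (S t x) - s (S t x) F) = energy.nrm (s (S t x) F - PW (S t x))"
      by (rule energy.nrm_minus_commute[OF PSX sX])
    finally show "energy.nrm (PW (S t x) - S t (PW x)) \<le>
      energy.nrm (s (S t x) F - PW (S t x)) + energy.nrm (s x F - PW x)" by simp
  qed
  then have "energy.nrm (PW (S t x) - S t (PW x)) \<le> 0"
    using lim by (intro tendsto_lowerbound[OF lim]) auto
  then show ?thesis by (intro antisym energy.nrm_nonneg energy.V_diff PSX SPX)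
qed

section \<open>Invariance of the subspaces\<close>

text \<open>W is given as a closure of spans: a finite sum of modes near \<open>x\<close> is carried
  to a finite sum of modes over the same indices, at no greater distance from
  \<open>S t x\<close>.\<close>

lemma W_space_S:
  assumes t: "t > 0" and x: "x \<in> W_space l0 l1 \<Omega> \<Omega>S \<psi>t \<mu>"
  shows "S t x \<in> W_space l0 l1 \<Omega> \<Omega>S \<psi>t \<mu>"
proof -
  have x1: "fst x \<in> W_xi l0 l1 \<Omega>S \<psi>t \<mu>" and x2: "fst (snd x) \<in> W_zeta l0 l1 \<Omega>S \<psi>t \<mu>"
    and x3: "AE z in lebesgue_on \<Omega>F. snd (snd x) z = 0"
    using x by (cases x, simp add: W_space_def)+
  have xX: "x \<in> X \<Omega> \<Omega>S"
    unfolding X_iff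
    using x1[unfolded W_xi_def mem_Collect_eq, THEN conjunct1]
      x2[unfolded W_zeta_def mem_Collect_eq, THEN conjunct1] L_S_AE_zero[OF x3] by simp
  note SX = flow.T_V[OF t xX]
  have approx: "\<exists>F a b. finite F \<and> F \<subseteq> K \<and> energy.nrm (S t x - (\<Sum>k\<in>F. mode (a k) (b k) k)) < \<epsilon>" if \<epsilon>: "\<epsilon> > 0" for \<epsilon>
  proof -
    obtain F c where F: "finite F" "F \<subseteq> K" "h1_norm l0 l1 \<Omega>S (\<lambda>z. fst x z - (\<Sum>k\<in>F. c k *\<^sub>R \<psi> k z)) < \<epsilon> / 2"
      using x1 half_gt_zero[OF \<epsilon>] unfolding W_xi_def by blast
    obtain G d where G: "finite G" "G \<subseteq> K" "l2_norm \<Omega>S (\<lambda>z. fst (snd x) z - (\<Sum>k\<in>G. d k *\<^sub>R \<psi>t k z)) < \<epsilon> / 2"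
      using x2 half_gt_zero[OF \<epsilon>] unfolding W_zeta_def by blast
    \<comment> \<open>The two components come with different index sets. Padding by zero
      coefficients on the union makes them the components of one sum of modes.\<close>
    define a where "a k = (if k \<in> F then c k else 0)" for k
    define b where "b k = (if k \<in> G then d k else 0)" for k
    let ?m = "\<Sum>k\<in>F \<union> G. mode (a k) (b k) k"
    have sa: "(\<Sum>k\<in>F \<union> G. a k *\<^sub>R \<psi> k) = (\<Sum>k\<in>F. c k *\<^sub>R \<psi> k)"
      using F(1) G(1) by (intro sum.mono_neutral_cong_right) (auto simp: a_def)
    have sb: "(\<Sum>k\<in>F \<union> G. b k *\<^sub>R \<psi>t k) = (\<Sum>k\<in>G. d k *\<^sub>R \<psi>t k)"
      using F(1) G(1) by (intro sum.mono_neutral_cong_right) (auto simp: b_def)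
    have mX: "?m \<in> X \<Omega> \<Omega>S" by (intro energy.V_sum mode_X)
    have dX: "x - ?m \<in> X \<Omega> \<Omega>S" using xX mX by (rule energy.V_diff)
    have e1: "fst x - (\<Sum>k\<in>F. c k *\<^sub>R \<psi> k) = (\<lambda>z. fst x z - (\<Sum>k\<in>F. c k *\<^sub>R \<psi> k z))" by (simp add: fun_eq_iff)
    have e2: "fst (snd x) - (\<Sum>k\<in>G. d k *\<^sub>R \<psi>t k) = (\<lambda>z. fst (snd x) z - (\<Sum>k\<in>G. d k *\<^sub>R \<psi>t k z))" by (simp add: fun_eq_iff)
    have "l2_norm \<Omega>F (snd (snd x)) = 0" using x3 xX by (simp add: l2_norm_eq_0_iff X_iff L_S_L2)
    then have "energy.nrm (x - ?m) < \<epsilon>"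
      using energy_nrm_le[OF dX] F(3) G(3)
      by (simp add: mode_components sa sb e1 e2)
    moreover have "energy.nrm (S t x - S t ?m) \<le> energy.nrm (x - ?m)"
      using t xX mX by (intro flow.T_contr_diff)
    moreover
    let ?r = "\<Sum>k\<in>F \<union> G. mode (fst (rot t k (a k) (b k))) (snd (rot t k (a k) (b k))) k"
    have "energy.nrm (S t ?m - ?r) = 0"
      using F G by (intro S_mode_sum t) auto
    moreover have "energy.nrm (S t x - ?r) \<le> energy.nrm (S t x - S t ?m) + energy.nrm (S t ?m - ?r)"
      using SX flow.T_V[OF t mX] by (intro energy.nrm_triangle_diff energy.V_sum mode_X)
    ultimately have "energy.nrm (S t x - ?r) < \<epsilon>" by linarith
    then show ?thesis using F G
      by (intro exI[of _ "F \<union> G"] exI[of _ "\<lambda>k. fst (rot t k (a k) (b k))"] exI[of _ "\<lambda>k. snd (rot t k (a k) (b k))"]) auto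
  qed
  have comp: "\<exists>F a b. finite F \<and> F \<subseteq> K \<and>
      h1_norm l0 l1 \<Omega>S (\<lambda>z. fst (S t x) z - (\<Sum>k\<in>F. a k *\<^sub>R \<psi> k z)) < \<epsilon> \<and>
      l2_norm \<Omega>S (\<lambda>z. fst (snd (S t x)) z - (\<Sum>k\<in>F. b k *\<^sub>R \<psi>t k z)) < \<epsilon> \<and>
      l2_norm \<Omega>F (snd (snd (S t x))) < \<epsilon>" if \<epsilon>: "\<epsilon> > 0" for \<epsilon>
  proof -
    obtain F a b where F: "finite F" "F \<subseteq> K" and lt: "energy.nrm (S t x - (\<Sum>k\<in>F. mode (a k) (b k) k)) < \<epsilon>"
      using approx[OF \<epsilon>] by blast
    have dX: "S t x - (\<Sum>k\<in>F. mode (a k) (b k) k) \<in> X \<Omega> \<Omega>S"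
      using SX by (intro energy.V_diff energy.V_sum mode_X)
    have e1: "(\<lambda>z. fst (S t x) z - (\<Sum>k\<in>F. a k *\<^sub>R \<psi> k z)) = fst (S t x) - (\<Sum>k\<in>F. a k *\<^sub>R \<psi> k)" by (simp add: fun_eq_iff)
    have e2: "(\<lambda>z. fst (snd (S t x)) z - (\<Sum>k\<in>F. b k *\<^sub>R \<psi>t k z)) = fst (snd (S t x)) - (\<Sum>k\<in>F. b k *\<^sub>R \<psi>t k)"
      by (simp add: fun_eq_iff)
    show ?thesis
      using component_norms_le[OF dX] lt F
      by (intro exI[of _ F] exI[of _ a] exI[of _ b]) (simp add: e1 e2 mode_components)
  qed
  \<comment> \<open>Modes have no fluid component, so the fluid part of \<open>S t x\<close> is
    bounded by every approximation error.\<close>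
  have "l2_norm \<Omega>F (snd (snd (S t x))) \<le> 0"
    by (rule field_le_epsilon) (use comp in fastforce)
  then have "AE z in lebesgue_on \<Omega>F. snd (snd (S t x)) z = 0"
    using SX by (simp add: X_iff L_S_L2 flip: l2_norm_eq_0_iff) (simp add: antisym)
  moreover have "fst (S t x) \<in> W_xi l0 l1 \<Omega>S \<psi>t \<mu>"
    unfolding W_xi_def
  proof (intro CollectI conjI allI impI)
    show "H1 \<Omega>S (fst (S t x))" using SX by (simp add: X_iff)
    fix \<epsilon> :: real assume "\<epsilon> > 0"
    from comp[OF this] show "\<exists>F c. finite F \<and> F \<subseteq> K \<and> h1_norm l0 l1 \<Omega>S (\<lambda>z. fst (S t x) z - (\<Sum>k\<in>F. c k *\<^sub>R \<psi> k z)) < \<epsilon>"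
      by (elim exE conjE) (intro exI conjI)
  qed
  moreover have "fst (snd (S t x)) \<in> W_zeta l0 l1 \<Omega>S \<psi>t \<mu>"
    unfolding W_zeta_def
  proof (intro CollectI conjI allI impI)
    show "L2 \<Omega>S (fst (snd (S t x)))" using SX by (simp add: X_iff)
    fix \<epsilon> :: real assume "\<epsilon> > 0"
    from comp[OF this] show "\<exists>F c. finite F \<and> F \<subseteq> K \<and> l2_norm \<Omega>S (\<lambda>z. fst (snd (S t x)) z - (\<Sum>k\<in>F. c k *\<^sub>R \<psi>t k z)) < \<epsilon>"
      by (elim exE conjE) (intro exI conjI)
  qed
  ultimately show ?thesis by (cases "S t x") (simp add: W_space_def)
qed

text \<open>Turns membership in E into vanishing of all coefficient pairs plus membership in
  \<open>X_bar\<close>; the coefficients are the quantities whose evolution is known.\<close>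

lemma E_space_iff: 
  "x \<in> E_space l0 l1 \<Omega> \<Omega>S \<psi>t \<mu> \<longleftrightarrow>
    x \<in> X_bar \<Omega> \<Omega>S \<and> (\<forall>k\<in>K. sinner x (v k) = 0 \<and> sinner x (w k) = 0)"
proof -
  have bar: "x \<in> X_bar \<Omega> \<Omega>S \<longleftrightarrow> x \<in> X \<Omega> \<Omega>S \<and> flux \<Omega>S (fst x) = 0"
    by (cases x) (simp only: X_bar_def mem_Collect_eq split_conv fst_conv)
  have E: "x \<in> E_space l0 l1 \<Omega> \<Omega>S \<psi>t \<mu> \<longleftrightarrow> x \<in> X_bar \<Omega> \<Omega>S \<and>
      (\<forall>k\<in>K. h1_inner l0 l1 \<Omega>S (fst x) (\<psi> k) = 0) \<and> (\<forall>k\<in>K. l2_inner \<Omega>S (fst (snd x)) (\<psi>t k) = 0)"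
    unfolding bar X_iff
    by (cases x) (simp only: E_space_def E_xi_def E_zeta_def H1_bar_def mem_Collect_eq split_conv fst_conv snd_conv conj_ac)
  show ?thesis
  proof (cases "x \<in> X \<Omega> \<Omega>S")
    case True
    then show ?thesis unfolding E by (simp only: sinner_v sinner_w) blast
  next
    case False
    then show ?thesis unfolding E bar by blast
  qed
qed

lemma proj_E_commutes:
  assumes t: "t > 0" and x: "x \<in> X \<Omega> \<Omega>S"
  shows "state_eq \<Omega> \<Omega>S (proj_E l0 l1 \<Omega>S \<psi>t \<mu> (S t x)) (S t (proj_E l0 l1 \<Omega>S \<psi>t \<mu> x))"
proof -
  have PE: "proj_E l0 l1 \<Omega>S \<psi>t \<mu> y = y - PW y" for y
    by (simp add: proj_E_def lincomb_eq)
  note Sx = flow.T_V[OF t x] and PX = PW_X[OF x]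
  note PSX = PW_X[OF Sx] and SPX = flow.T_V[OF t PX] and dX = energy.V_diff[OF x PX]
  have "energy.nrm (S t (x - PW x) - (S t x - S t (PW x))) = 0"
    using flow.T_lin[OF t x PX, of 1 "- 1"] by simp
  moreover have "(S t x - S t (PW x)) - (S t x - PW (S t x)) = PW (S t x) - S t (PW x)" by simp
  ultimately have "energy.nrm (S t (x - PW x) - (S t x - PW (S t x))) \<le> 0"
    using energy.nrm_triangle_diff[OF flow.T_V[OF t dX] energy.V_diff[OF Sx SPX] energy.V_diff[OF Sx PSX]]
      PW_commutes[OF t x] by simp
  then have "energy.nrm (S t (x - PW x) - (S t x - PW (S t x))) = 0"
    by (intro antisym energy.nrm_nonneg energy.V_diff flow.T_V[OF t dX] Sx PSX)
  then have "energy.nrm ((S t x - PW (S t x)) - S t (x - PW x)) = 0"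
    using energy.nrm_minus_commute[OF energy.V_diff[OF Sx PSX] flow.T_V[OF t dX]] by simp
  then show ?thesis
    unfolding PE using state_eq_iff_nrm[OF energy.V_diff[OF Sx PSX] flow.T_V[OF t dX]] by simp
qed

end

theorem lemma8:
  fixes \<Omega> \<Omega>S :: "(real^3) set" and \<nu> l0 l1 :: real
    and \<psi>t :: "nat \<Rightarrow> vfield" and \<mu> :: "nat \<Rightarrow> real"
    and S :: "real \<Rightarrow> state \<Rightarrow> state"
  assumes "\<nu> > 0" and "l0 > 0" and "l1 > 0"
    and "fsi_geometry \<Omega> \<Omega>S"
    and "bad_domain l0 l1 \<Omega>S"
    and "adapted_eigenbasis l0 l1 \<Omega>S \<psi>t \<mu>"
    and "contraction_semigroup l0 l1 \<Omega> \<Omega>S S"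
    and "generates l0 l1 \<Omega> \<Omega>S (fsi_generator \<nu> l0 l1 \<Omega> \<Omega>S) S"
    and X_bar_invariant: "\<forall>t>0. \<forall>x\<in>X_bar \<Omega> \<Omega>S. S t x \<in> X_bar \<Omega> \<Omega>S"
  shows "(\<forall>t>0. \<forall>x0\<in>X_bar \<Omega> \<Omega>S.
            state_eq \<Omega> \<Omega>S (proj_W l0 l1 \<Omega>S \<psi>t \<mu> (S t x0)) (S t (proj_W l0 l1 \<Omega>S \<psi>t \<mu> x0)) \<and>
            state_eq \<Omega> \<Omega>S (proj_E l0 l1 \<Omega>S \<psi>t \<mu> (S t x0)) (S t (proj_E l0 l1 \<Omega>S \<psi>t \<mu> x0)))
       \<and> (\<forall>t>0. \<forall>x\<in>E_space l0 l1 \<Omega> \<Omega>S \<psi>t \<mu>. S t x \<in> E_space l0 l1 \<Omega> \<Omega>S \<psi>t \<mu>)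
       \<and> (\<forall>t>0. \<forall>x\<in>W_space l0 l1 \<Omega> \<Omega>S \<psi>t \<mu>. S t x \<in> W_space l0 l1 \<Omega> \<Omega>S \<psi>t \<mu>)"
proof -
  interpret fsi_eigenbasis \<Omega> \<Omega>S \<nu> l0 l1 S \<psi>t \<mu>
    by (intro fsi_eigenbasis.intro fsi_semigroup.intro fsi.intro fsi_semigroup_axioms.intro
        fsi_eigenbasis_axioms.intro assms)
  have bar_X: "x \<in> X \<Omega> \<Omega>S" if "x \<in> X_bar \<Omega> \<Omega>S" for x
    using that by (auto simp: X_bar_def)
  show ?thesis
  proof (intro conjI allI impI ballI)
    fix t :: real and x assume t: "t > 0" and x: "x \<in> X_bar \<Omega> \<Omega>S"
    note xX = bar_X[OF x]
    show "state_eq \<Omega> \<Omega>S (proj_W l0 l1 \<Omega>S \<psi>t \<mu> (S t x)) (S t (proj_W l0 l1 \<Omega>S \<psi>t \<mu> x))"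
      using state_eq_iff_nrm[OF PW_X[OF flow.T_V[OF t xX]] flow.T_V[OF t PW_X[OF xX]]] PW_commutes[OF t xX]
      by simp
    show "state_eq \<Omega> \<Omega>S (proj_E l0 l1 \<Omega>S \<psi>t \<mu> (S t x)) (S t (proj_E l0 l1 \<Omega>S \<psi>t \<mu> x))"
      by (rule proj_E_commutes[OF t xX])
  next
    fix t :: real and x assume t: "t > 0" and x: "x \<in> E_space l0 l1 \<Omega> \<Omega>S \<psi>t \<mu>"
    then have xb: "x \<in> X_bar \<Omega> \<Omega>S" and 0: "\<And>k. k \<in> K \<Longrightarrow> sinner x (v k) = 0 \<and> sinner x (w k) = 0"
      unfolding E_space_iff by auto
    \<comment> \<open>A rotation fixes the pair (0, 0); the zero flux of the displacement comes from
      the invariance of \<open>X_bar\<close>.\<close>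
    have "sinner (S t x) (v k) = 0 \<and> sinner (S t x) (w k) = 0" if "k \<in> K" for k
      using S_coeffs[OF t that bar_X[OF xb]] 0[OF that] by (simp add: rot_def)
    then show "S t x \<in> E_space l0 l1 \<Omega> \<Omega>S \<psi>t \<mu>"
      unfolding E_space_iff using X_bar_invariant t xb by blast
  next
    fix t :: real and x assume "t > 0" "x \<in> W_space l0 l1 \<Omega> \<Omega>S \<psi>t \<mu>"
    then show "S t x \<in> W_space l0 l1 \<Omega> \<Omega>S \<psi>t \<mu>" by (rule W_space_S)
  qed
qed

end
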